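(* Let $p,q$ be distinct primes with $p>2$, let $L/K$ be a Galois field extension of degree $p^2q$, and let $\Gamma=\mathrm{Gal}(L/K)$. Let $G$ be a group of order $p^2q$. (a) If the Sylow $p$-subgroups of $G$ and of $\Gamma$ are not isomorphic, then $e(\Gamma,G)=0$, i.e. $L/K$ has no Hopf–Galois structure of type $G$. (b) Suppose the Sylow $p$-subgroups of $\Gamma$ and $G$ are both cyclic, so that $\Gamma$ and $G$ are each of one of the types 1–4 described in the context. Write $e(i,j)$ for $e(\Gamma,G)$ when $\Gamma$ is of type $i$ and $G$ is of type $j$. (i) If $q\nmid p-1$: $e(1,1)=p$, $e(1,2)=2p(p-1)$, $e(1,3)=2p(p-1)$; $e(2,1)=pq$, $e(2,2)=2p(pq-2q+1)$, $e(2,3)=2pq(p-1)$; $e(3,1)=pq$, $e(3,2)=2pq(p-1)$, $e(3,3)=2(p^2q-pq-q+1)$. (Here entries involving type 2 are relevant only when $p\mid q-1$ and entries involving type 3 only when $p^2\mid q-1$; when $p\nmid q-1$ only $e(1,1)=p$ is relevant.) (ii) If $q\mid p-1$: $e(1,1)=p$, $e(1,4)=2p(q-1)$, $e(4,1)=p^2$, $e(4,4)=2(p^2q-2p^2+1)$.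
   Context: For finite groups $\Gamma,G$ of the same order, $e(\Gamma,G)$ denotes the number of Hopf–Galois structures of type $G$ on a Galois field extension with Galois group $\Gamma$; equivalently (Greither–Pareigis), the number of regular subgroups of the symmetric group $S(\Gamma)$ on the set $\Gamma$ which are isomorphic to $G$ and normalised by the image of the right regular representation of $\Gamma$. For distinct primes $p,q$, the groups of order $p^2q$ with cyclic Sylow $p$-subgroups are, up to isomorphism, exactly the following (each type is one isomorphism class): type 1: the cyclic group $C_{p^2}\times C_q$; type 2 (exists iff $p\mid q-1$): $C_q\rtimes C_{p^2}$ where a generator of $C_{p^2}$ acts on $C_q$ by an automorphism of order $p$ (non-abelian, centre of order $p$); type 3 (exists iff $p^2\mid q-1$): $C_q\rtimes C_{p^2}$ where a generator of $C_{p^2}$ acts on $C_q$ by an automorphism of order $p^2$ (trivial centre); type 4 (exists iff $q\mid p-1$): $C_{p^2}\rtimes C_q$ where a generator of $C_q$ acts on $C_{p^2}$ by an automorphism of order $q$. *)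

theory Defs
  imports "HOL-Algebra.Algebra" "HOL-Number_Theory.Number_Theory"
begin

section \<open>Hopf-Galois structures counted via Greither-Pareigis\<close>

definition rho_right :: "('a, 'c) monoid_scheme \<Rightarrow> 'a \<Rightarrow> ('a \<Rightarrow> 'a)" where
  "rho_right Gam g = (\<lambda>x \<in> carrier Gam. x \<otimes>\<^bsub>Gam\<^esub> inv\<^bsub>Gam\<^esub> g)"

definition regular_subgroup :: "('a \<Rightarrow> 'a) set \<Rightarrow> 'a set \<Rightarrow> bool" where
  "regular_subgroup N S \<longleftrightarrow> subgroup N (BijGroup S) \<and>
     (\<forall>x\<in>S. \<forall>y\<in>S. \<exists>!n. n \<in> N \<and> n x = y)"

definition hgs_count :: "('a, 'c) monoid_scheme \<Rightarrow> ('b, 'd) monoid_scheme \<Rightarrow> nat" where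
  "hgs_count Gam G = card {N. regular_subgroup N (carrier Gam) \<and>
      ((BijGroup (carrier Gam))\<lparr>carrier := N\<rparr>) \<cong> G \<and>
      (\<forall>g \<in> carrier Gam.
         (\<lambda>n. rho_right Gam g \<otimes>\<^bsub>BijGroup (carrier Gam)\<^esub> n
              \<otimes>\<^bsub>BijGroup (carrier Gam)\<^esub> inv\<^bsub>BijGroup (carrier Gam)\<^esub> (rho_right Gam g)) ` N = N)}"

text \<open>Sylow p-subgroups of groups of order p^2 q (p, q distinct primes) have order p^2.
  Since all Sylow p-subgroups are conjugate, "the Sylow p-subgroups of G and Gamma are
  isomorphic" means some (equivalently every) pair of them is isomorphic.\<close>
definition sylow_iso :: "nat \<Rightarrow> ('a, 'c) monoid_scheme \<Rightarrow> ('b, 'd) monoid_scheme \<Rightarrow> bool" where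
  "sylow_iso p Gam G \<longleftrightarrow> (\<exists>P Q. subgroup P Gam \<and> card P = p^2 \<and>
      subgroup Q G \<and> card Q = p^2 \<and> (Gam\<lparr>carrier := P\<rparr>) \<cong> (G\<lparr>carrier := Q\<rparr>))"

text \<open>Elements (a,b) with a in Z_m, b in Z_n; the generator of Z_n acts on Z_m as
  multiplication by r (r^n = 1 mod m is needed for this to be a group).\<close>
definition sdp :: "nat \<Rightarrow> nat \<Rightarrow> nat \<Rightarrow> (nat \<times> nat) monoid" where
  "sdp m n r = \<lparr>carrier = {0..<m} \<times> {0..<n},
      monoid.mult = (\<lambda>(a, b) (c, d). ((a + r ^ b * c) mod m, (b + d) mod n)),
      monoid.one = (0, 0)\<rparr>"

definition type1 :: "nat \<Rightarrow> nat \<Rightarrow> ('a, 'c) monoid_scheme \<Rightarrow> bool" where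
  "type1 p q G \<longleftrightarrow> G \<cong> sdp q (p^2) 1"

definition type2 :: "nat \<Rightarrow> nat \<Rightarrow> ('a, 'c) monoid_scheme \<Rightarrow> bool" where
  "type2 p q G \<longleftrightarrow> (\<exists>r. ord q r = p \<and> G \<cong> sdp q (p^2) r)"

definition type3 :: "nat \<Rightarrow> nat \<Rightarrow> ('a, 'c) monoid_scheme \<Rightarrow> bool" where
  "type3 p q G \<longleftrightarrow> (\<exists>r. ord q r = p^2 \<and> G \<cong> sdp q (p^2) r)"

definition type4 :: "nat \<Rightarrow> nat \<Rightarrow> ('a, 'c) monoid_scheme \<Rightarrow> bool" where
  "type4 p q G \<longleftrightarrow> (\<exists>s. ord (p^2) s = q \<and> G \<cong> sdp (p^2) q s)"

end

(*
  Instead of regular subgroups we count the maps f : Gam -> G that identify Gam with G in such a way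
  that translations of Gam become affine maps of G, i.e. maps eta with
  eta (x y) = eta x (eta 1)^-1 eta y. Such an f determines the regular subgroup f^-1 lambda(G) f, and
  two maps give the same subgroup iff they differ by an automorphism of G; so the number of maps is
  e(Gam, G) |Aut G|.

  For (b) write both groups as semidirect products of Z/m and Z/n with {m, n} = {q, p^2} such that m is
  coprime to n phi(n). The affine maps of G then are
    (a, b) |-> (u + i a + c chi(b), v + j b),   chi(b) = s^b,
  and a map f amounts to a pair (X, Y) of affine maps satisfying the defining relations of Gam and
  acting regularly. The relations force X = (u, i, c, 0, 1) with i = 1 modulo the prime P dividing m,
  and, up to the multiples of i - 1, say that Y = (u', e, c', v', j') has e u = r u and
  e c = r chi(v') c. As chi(v') - 1 is a unit, exactly one of u, c is a unit; both cases contribute,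
  which is where the factor 2 comes from. The correction term counts the v' with chi(v') = r.

  For (a) there is a normal Sylow subgroup of G of order p^2 or of order q. Restricting f to its preimage
  in the first case, and passing to the quotient in the second, reduces the claim to groups of order p^2,
  where for odd p both groups have elements of order p^2 or neither has.
*)
theory Submission
  imports Defs
begin

text \<open>As m may be p^2, Z/m need not be a field. What replaces field arguments is that the
  relevant questions are decided modulo P: being a unit is, and so is equality of n-th roots of
  unity, because n is a unit modulo P. The relation Y^n = 1 asks that u' be killed by 1 + e + ... +
  e^(n-1), and c' by the analogous sum in e and chi(v'). Such a sum over two n-th roots of unity is
  a unit if they agree and 0 otherwise, so each of u', c' is either 0 or arbitrary, and the count
  depends on which of 1, r, chi(v'), r chi(v') coincide. The coefficients u and c are left and right
  translation by elements of Z/m; exchanging them exchanges the two regular copies of Z/m.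
  Regularity is a matter of lifting the exponent: a |-> w + i a with i = 1 modulo P is a single
  cycle on Z/m exactly if w is a unit, which for m = P^2 needs P odd. Oddness is also essential for
  groups of order p^2 in (a): the holomorph of C_2 x C_2 is S_4, which contains regular cyclic
  subgroups.\<close>

section \<open>Regular subgroups and maps between the groups\<close>

text \<open>The condition says that \<open>f\<close> turns the right translation by \<open>g\<close> into a map \<open>\<eta>\<close> of \<open>G\<close> with
  \<open>\<eta> (u v) = \<eta> u (\<eta> 1)\<^sup>-\<^sup>1 \<eta> v\<close>, that is, into an element of the holomorph of \<open>G\<close>.\<close>

definition hgs_maps :: "('a, 'c) monoid_scheme \<Rightarrow> ('b, 'd) monoid_scheme \<Rightarrow> ('a \<Rightarrow> 'b) set" where
  "hgs_maps Gam G = {f \<in> extensional (carrier Gam). bij_betw f (carrier Gam) (carrier G) \<and>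
     (\<forall>g\<in>carrier Gam. \<forall>x\<in>carrier Gam. \<forall>y\<in>carrier Gam. \<forall>z\<in>carrier Gam.
        f z = f x \<otimes>\<^bsub>G\<^esub> f y \<longrightarrow>
        f (z \<otimes>\<^bsub>Gam\<^esub> g) = f (x \<otimes>\<^bsub>Gam\<^esub> g) \<otimes>\<^bsub>G\<^esub> inv\<^bsub>G\<^esub> (f g) \<otimes>\<^bsub>G\<^esub> f (y \<otimes>\<^bsub>Gam\<^esub> g))}"

lemma hgs_mapsD:
  assumes "f \<in> hgs_maps Gam G"
  shows "f \<in> extensional (carrier Gam)" "bij_betw f (carrier Gam) (carrier G)"
    "\<And>g x y z. \<lbrakk>g \<in> carrier Gam; x \<in> carrier Gam; y \<in> carrier Gam; z \<in> carrier Gam;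
        f z = f x \<otimes>\<^bsub>G\<^esub> f y\<rbrakk> \<Longrightarrow>
        f (z \<otimes>\<^bsub>Gam\<^esub> g) = f (x \<otimes>\<^bsub>Gam\<^esub> g) \<otimes>\<^bsub>G\<^esub> inv\<^bsub>G\<^esub> (f g) \<otimes>\<^bsub>G\<^esub> f (y \<otimes>\<^bsub>Gam\<^esub> g)"
  using assms by (auto simp: hgs_maps_def)

text \<open>This is f^-1 lambda(t) f. The restriction makes it extensional, as elements of
  \<open>BijGroup\<close> have to be.\<close>

definition transl :: "('a, 'c) monoid_scheme \<Rightarrow> ('b, 'd) monoid_scheme \<Rightarrow> ('a \<Rightarrow> 'b) \<Rightarrow> 'b \<Rightarrow> 'a \<Rightarrow> 'a" where
  "transl Gam G f t = (\<lambda>x \<in> carrier Gam. inv_into (carrier Gam) f (t \<otimes>\<^bsub>G\<^esub> f x))"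

definition hgs_set :: "('a, 'c) monoid_scheme \<Rightarrow> ('b, 'd) monoid_scheme \<Rightarrow> ('a \<Rightarrow> 'a) set set" where
  "hgs_set Gam G = {N. regular_subgroup N (carrier Gam) \<and>
      ((BijGroup (carrier Gam))\<lparr>carrier := N\<rparr>) \<cong> G \<and>
      (\<forall>g \<in> carrier Gam.
         (\<lambda>n. rho_right Gam g \<otimes>\<^bsub>BijGroup (carrier Gam)\<^esub> n
              \<otimes>\<^bsub>BijGroup (carrier Gam)\<^esub> inv\<^bsub>BijGroup (carrier Gam)\<^esub> (rho_right Gam g)) ` N = N)}"

lemma BijGroup_mult: "f \<in> Bij S \<Longrightarrow> g \<in> Bij S \<Longrightarrow> f \<otimes>\<^bsub>BijGroup S\<^esub> g = compose S f g"
  by (simp add: BijGroup_def)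

lemma carrier_BijGroup: "carrier (BijGroup S) = Bij S"
  by (simp add: BijGroup_def)

locale two_groups = Ga: group Gam + G: group G for Gam :: "('a, 'c) monoid_scheme"
  and G :: "('b, 'd) monoid_scheme" (structure) +
  assumes finS: "finite (carrier Gam)" and finG: "finite (carrier G)"
begin

abbreviation "S \<equiv> carrier Gam"

lemma rho_Bij: "g \<in> S \<Longrightarrow> rho_right Gam g \<in> Bij S"
proof -
  assume g: "g \<in> S"
  have "bij_betw (\<lambda>x. x \<otimes>\<^bsub>Gam\<^esub> inv\<^bsub>Gam\<^esub> g) S S"
    by (rule bij_betwI[where g="\<lambda>x. x \<otimes>\<^bsub>Gam\<^esub> g"]) (use g in \<open>auto simp: Ga.m_assoc\<close>)
  then show ?thesis
    by (auto simp: Bij_def rho_right_def cong: bij_betw_cong)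
qed

lemma inv_rho: "g \<in> S \<Longrightarrow> inv\<^bsub>BijGroup S\<^esub> (rho_right Gam g) = rho_right Gam (inv\<^bsub>Gam\<^esub> g)"
proof -
  assume g: "g \<in> S"
  interpret B: group "BijGroup S" by (rule group_BijGroup)
  show ?thesis
  proof (rule B.inv_equality)
    show "rho_right Gam (inv\<^bsub>Gam\<^esub> g) \<otimes>\<^bsub>BijGroup S\<^esub> rho_right Gam g = \<one>\<^bsub>BijGroup S\<^esub>"
      using g by (auto simp: BijGroup_mult rho_Bij)
        (auto simp: BijGroup_def rho_right_def compose_def Ga.m_assoc intro!: restrict_ext)
  qed (use g in \<open>auto simp: carrier_BijGroup rho_Bij\<close>)
qed

lemma conj_rho:
  assumes "g \<in> S" "n \<in> Bij S"
  shows "rho_right Gam g \<otimes>\<^bsub>BijGroup S\<^esub> n \<otimes>\<^bsub>BijGroup S\<^esub> inv\<^bsub>BijGroup S\<^esub> (rho_right Gam g)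
     = (\<lambda>y\<in>S. n (y \<otimes>\<^bsub>Gam\<^esub> g) \<otimes>\<^bsub>Gam\<^esub> inv\<^bsub>Gam\<^esub> g)"
  using assms Bij_imp_funcset[OF assms(2)]
  by (auto simp: inv_rho BijGroup_mult rho_Bij compose_Bij)
     (auto simp: compose_def rho_right_def intro!: restrict_ext)

context
  fixes f assumes f: "bij_betw f S (carrier G)"
begin

lemma map_closed: "x \<in> S \<Longrightarrow> f x \<in> carrier G"
  using f by (auto dest: bij_betwE)

lemma map_inv_into: "y \<in> carrier G \<Longrightarrow> f (inv_into S f y) = y" "y \<in> carrier G \<Longrightarrow> inv_into S f y \<in> S"
  using f bij_betw_inv_into_right[OF f] by (auto simp: bij_betw_def inv_into_into)

lemma map_inv_into_left: "x \<in> S \<Longrightarrow> inv_into S f (f x) = x"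
  using bij_betw_inv_into_left[OF f] .

lemma map_eq_iff: "x \<in> S \<Longrightarrow> y \<in> S \<Longrightarrow> f x = f y \<longleftrightarrow> x = y"
  using f by (auto simp: bij_betw_def inj_on_def)

lemma map_transl: "t \<in> carrier G \<Longrightarrow> x \<in> S \<Longrightarrow> f (transl Gam G f t x) = t \<otimes> f x"
  by (simp add: transl_def map_inv_into map_closed)

lemma transl_cl: "t \<in> carrier G \<Longrightarrow> x \<in> S \<Longrightarrow> transl Gam G f t x \<in> S"
  by (simp add: transl_def map_inv_into map_closed)

text \<open>As f is injective, a map is known once its composite with f is. All identities between
  translations are checked in this way, after applying f.\<close>

lemma transl_eqI: "t \<in> carrier G \<Longrightarrow> n \<in> extensional S \<Longrightarrow> (\<And>x. x \<in> S \<Longrightarrow> n x \<in> S \<and> f (n x) = t \<otimes> f x)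
   \<Longrightarrow> transl Gam G f t = n"
proof (rule extensionalityI[of _ S])
  fix x assume n: "\<And>x. x \<in> S \<Longrightarrow> n x \<in> S \<and> f (n x) = t \<otimes> f x" and x: "x \<in> S"
  have "inv_into S f (t \<otimes> f x) = inv_into S f (f (n x))" using n x by simp
  also have "\<dots> = n x" using n x map_inv_into_left[of "n x"] by blast
  finally show "transl Gam G f t x = n x" using x by (simp add: transl_def)
qed (auto simp: transl_def)

lemma transl_mult: "t \<in> carrier G \<Longrightarrow> u \<in> carrier G \<Longrightarrow>
   transl Gam G f (t \<otimes> u) = compose S (transl Gam G f t) (transl Gam G f u)"
  by (rule transl_eqI) (auto simp: compose_def map_transl transl_cl G.m_assoc map_closed)

lemma transl_one: "transl Gam G f \<one> = (\<lambda>x\<in>S. x)"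
  by (rule transl_eqI) (auto simp: map_closed)

lemma transl_Bij: assumes "t \<in> carrier G" shows "transl Gam G f t \<in> Bij S"
proof -
  have "bij_betw (transl Gam G f t) S S"
  proof (rule bij_betwI[where g="transl Gam G f (inv t)"])
    fix x assume x: "x \<in> S"
    have "compose S (transl Gam G f (inv t)) (transl Gam G f t) x = x"
      using x assms by (simp add: transl_mult[symmetric] transl_one)
    then show "transl Gam G f (inv t) (transl Gam G f t x) = x" using x by (simp add: compose_def)
    have "compose S (transl Gam G f t) (transl Gam G f (inv t)) x = x"
      using x assms by (simp add: transl_mult[symmetric] transl_one)
    then show "transl Gam G f t (transl Gam G f (inv t) x) = x" using x by (simp add: compose_def)
  qed (use assms in \<open>auto simp: transl_cl\<close>)
  then show ?thesis by (auto simp: Bij_def transl_def)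
qed

lemma transl_hom: "group_hom G (BijGroup S) (transl Gam G f)"
  by (intro group_hom.intro group_hom_axioms.intro G.is_group group_BijGroup)
     (auto simp: hom_def carrier_BijGroup transl_Bij BijGroup_mult transl_mult)

lemma transl_inj: "inj_on (transl Gam G f) (carrier G)"
proof (rule inj_onI)
  fix t u assume tu: "t \<in> carrier G" "u \<in> carrier G" and e: "transl Gam G f t = transl Gam G f u"
  have "t \<otimes> f \<one>\<^bsub>Gam\<^esub> = u \<otimes> f \<one>\<^bsub>Gam\<^esub>"
    using map_transl[OF tu(1), of "\<one>\<^bsub>Gam\<^esub>"] map_transl[OF tu(2), of "\<one>\<^bsub>Gam\<^esub>"] e by auto
  then show "t = u" using tu by (simp add: map_closed)
qed

lemma transl_regular: "regular_subgroup (transl Gam G f ` carrier G) S"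
proof -
  interpret h: group_hom G "BijGroup S" "transl Gam G f" by (rule transl_hom)
  have "\<exists>!n. n \<in> transl Gam G f ` carrier G \<and> n x = y" if xy: "x \<in> S" "y \<in> S" for x y
  \<comment> \<open>Seen through f, moving x to y means multiplying f(x) by f(y) f(x)^-1 on the
    left.\<close>
  proof (rule ex1I[of _ "transl Gam G f (f y \<otimes> inv (f x))"])
    show "transl Gam G f (f y \<otimes> inv (f x)) \<in> transl Gam G f ` carrier G \<and> transl Gam G f (f y \<otimes> inv (f x)) x = y"
      using xy by (simp add: map_closed transl_def G.m_assoc map_inv_into_left)
    fix n assume "n \<in> transl Gam G f ` carrier G \<and> n x = y"
    then obtain t where t: "t \<in> carrier G" "n = transl Gam G f t" "n x = y" by auto
    then have "f y = t \<otimes> f x" using map_transl xy by auto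
    then have "t = f y \<otimes> inv (f x)" using t xy by (simp add: map_closed G.m_assoc)
    then show "n = transl Gam G f (f y \<otimes> inv (f x))" using t by simp
  qed
  moreover have "subgroup (transl Gam G f ` carrier G) (BijGroup S)"
    by (rule h.img_is_subgroup)
  ultimately show ?thesis by (simp add: regular_subgroup_def)
qed

lemma transl_iso: "((BijGroup S)\<lparr>carrier := transl Gam G f ` carrier G\<rparr>) \<cong> G"
proof -
  have "transl Gam G f \<in> iso G ((BijGroup S)\<lparr>carrier := transl Gam G f ` carrier G\<rparr>)"
    using transl_inj by (auto simp: iso_def hom_def bij_betw_def transl_Bij BijGroup_mult transl_mult)
  then have "G \<cong> ((BijGroup S)\<lparr>carrier := transl Gam G f ` carrier G\<rparr>)" by (auto simp: is_iso_def)
  then show ?thesis by (rule G.iso_sym)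
qed

end

text \<open>The condition in \<open>hgs_maps\<close> says that a right translation, conjugated by f,
  is affine on \<open>G\<close>, and affine maps normalise the left translations.\<close>

lemma transl_in_hgs_set:
  assumes F: "f \<in> hgs_maps Gam G"
  shows "transl Gam G f ` carrier G \<in> hgs_set Gam G"
proof -
  note f = hgs_mapsD(2)[OF F]
  let ?N = "transl Gam G f ` carrier G"
  have sub: "(\<lambda>n. rho_right Gam g \<otimes>\<^bsub>BijGroup S\<^esub> n \<otimes>\<^bsub>BijGroup S\<^esub> inv\<^bsub>BijGroup S\<^esub> (rho_right Gam g)) ` ?N = ?N"
    (is "?c ` ?N = ?N") if g: "g \<in> S" for g
  proof -
    have "?c n \<in> ?N" if n: "n \<in> ?N" for n
    proof -
      obtain t where t: "t \<in> carrier G" "n = transl Gam G f t" using n by auto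
      obtain x0 where x0: "x0 \<in> S" "f x0 = t" using map_inv_into[OF f t(1)] by auto
      let ?h = "inv\<^bsub>Gam\<^esub> g"
      have h: "?h \<in> S" using g by simp
      \<comment> \<open>Read off from the condition on f at g^-1, with \<open>x0\<close>, y g and
        n(y g) in the places of x, y and z.\<close>
      let ?t = "f (x0 \<otimes>\<^bsub>Gam\<^esub> ?h) \<otimes> inv (f ?h)"
      have "transl Gam G f ?t = ?c n"
      proof (rule transl_eqI[OF f])
        show tt: "?t \<in> carrier G" using x0 h by (simp add: map_closed[OF f])
        show "?c n \<in> extensional S" using g t transl_Bij[OF f] by (simp add: conj_rho)
        fix y assume y: "y \<in> S"
        have yg: "y \<otimes>\<^bsub>Gam\<^esub> g \<in> S" using y g by simp
        have eq: "?c n y = n (y \<otimes>\<^bsub>Gam\<^esub> g) \<otimes>\<^bsub>Gam\<^esub> ?h" using y g t transl_Bij[OF f] by (simp add: conj_rho)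
        have nS: "n (y \<otimes>\<^bsub>Gam\<^esub> g) \<in> S" using t yg transl_cl[OF f] by simp
        have "f (n (y \<otimes>\<^bsub>Gam\<^esub> g)) = f x0 \<otimes> f (y \<otimes>\<^bsub>Gam\<^esub> g)" using t yg x0 map_transl[OF f] by simp
        from hgs_mapsD(3)[OF F h x0(1) yg nS this]
        have "f (n (y \<otimes>\<^bsub>Gam\<^esub> g) \<otimes>\<^bsub>Gam\<^esub> ?h) = ?t \<otimes> f y"
          using y g by (simp add: Ga.m_assoc)
        then show "?c n y \<in> S \<and> f (?c n y) = ?t \<otimes> f y" using eq nS h by simp
      qed
      then show ?thesis by (rule rev_image_eqI[OF _ sym, rotated]) (use x0 h in \<open>simp add: map_closed[OF f]\<close>)
    qed
    \<comment> \<open>Conjugation maps the finite set \<open>?N\<close> into itself injectively, so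
      the inclusion is an equality.\<close>
    moreover have "inj_on ?c ?N"
    proof -
      interpret B: group "BijGroup S" by (rule group_BijGroup)
      show ?thesis
      proof (rule inj_onI)
        fix n n' assume "n \<in> ?N" "n' \<in> ?N" and e: "?c n = ?c n'"
        then have *: "n \<in> carrier (BijGroup S)" "n' \<in> carrier (BijGroup S)"
          "rho_right Gam g \<in> carrier (BijGroup S)"
          using g by (auto simp: rho_Bij carrier_BijGroup transl_Bij[OF f])
        then show "n = n'" using e by (metis B.inv_closed B.l_cancel B.m_closed B.r_cancel)
      qed
    qed
    moreover have "finite ?N" using finG by simp
    ultimately show ?thesis by (intro endo_inj_surj) auto
  qed
  show ?thesis unfolding hgs_set_def
    using sub transl_regular[OF f] transl_iso[OF f] by auto
qed

text \<open>By regularity the points of \<open>carrier Gam\<close> correspond to elements of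
  \<open>N\<close> through the image of the identity. Following this by an isomorphism from
  \<open>N\<close> to \<open>G\<close> gives f, and the condition in \<open>hgs_maps\<close> follows
  because right translations normalise \<open>N\<close>.\<close>

lemma hgs_set_obtains:
  assumes N: "N \<in> hgs_set Gam G"
  obtains f where "f \<in> hgs_maps Gam G" "N = transl Gam G f ` carrier G"
proof -
  have reg: "subgroup N (BijGroup S)" "\<And>x y. x \<in> S \<Longrightarrow> y \<in> S \<Longrightarrow> \<exists>!n. n \<in> N \<and> n x = y"
    using N by (auto simp: hgs_set_def regular_subgroup_def)
  have nrm: "rho_right Gam g \<otimes>\<^bsub>BijGroup S\<^esub> n \<otimes>\<^bsub>BijGroup S\<^esub> inv\<^bsub>BijGroup S\<^esub> (rho_right Gam g) \<in> N"
    if "g \<in> S" "n \<in> N" for g n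
  proof -
    have "(\<lambda>n. rho_right Gam g \<otimes>\<^bsub>BijGroup S\<^esub> n \<otimes>\<^bsub>BijGroup S\<^esub> inv\<^bsub>BijGroup S\<^esub> (rho_right Gam g)) ` N = N"
      using N that(1) unfolding hgs_set_def by blast
    with that(2) show ?thesis by blast
  qed
  have NB: "N \<subseteq> Bij S" using subgroup.subset[OF reg(1)] by (simp add: carrier_BijGroup)
  have Nm: "compose S n n' \<in> N" if "n \<in> N" "n' \<in> N" for n n'
    using subgroup.m_closed[OF reg(1) that] NB that by (metis BijGroup_mult subsetD)
  obtain \<phi> where \<phi>: "\<phi> \<in> iso ((BijGroup S)\<lparr>carrier := N\<rparr>) G"
    using N by (auto simp: hgs_set_def is_iso_def)
  then have \<phi>b: "bij_betw \<phi> N (carrier G)" and \<phi>m: "\<And>n n'. n \<in> N \<Longrightarrow> n' \<in> N \<Longrightarrow> \<phi> (compose S n n') = \<phi> n \<otimes> \<phi> n'"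
    using NB by (auto simp: iso_def hom_def BijGroup_mult subset_iff)
  have \<phi>cl: "n \<in> N \<Longrightarrow> \<phi> n \<in> carrier G" for n using \<phi>b by (auto dest: bij_betwE)
  have \<phi>inj: "n \<in> N \<Longrightarrow> n' \<in> N \<Longrightarrow> \<phi> n = \<phi> n' \<Longrightarrow> n = n'" for n n'
    using \<phi>b by (auto simp: bij_betw_def inj_on_def)
  define v where "v x = (THE n. n \<in> N \<and> n \<one>\<^bsub>Gam\<^esub> = x)" for x
  have v: "v x \<in> N" "v x \<one>\<^bsub>Gam\<^esub> = x" if "x \<in> S" for x
    using theI'[OF reg(2)[OF Ga.one_closed that]] by (auto simp: v_def)
  have Ncl: "n \<in> N \<Longrightarrow> x \<in> S \<Longrightarrow> n x \<in> S" for n x using NB by (auto dest!: Bij_imp_funcset subsetD)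
  have uniq: "n = n'" if "n \<in> N" "n' \<in> N" "x \<in> S" "n x = n' x" for n n' x
    using reg(2)[OF that(3) Ncl[OF that(1,3)]] that by auto
  define f where "f = (\<lambda>x\<in>S. \<phi> (v x))"
  have vN: "v (n \<one>\<^bsub>Gam\<^esub>) = n" if "n \<in> N" for n
    using v[OF Ncl[OF that Ga.one_closed]] uniq[OF _ that Ga.one_closed] by auto
  have "bij_betw v S N"
    by (rule bij_betwI[where g="\<lambda>n. n \<one>\<^bsub>Gam\<^esub>"]) (auto simp: v vN Ncl)
  then have "bij_betw (\<phi> \<circ> v) S (carrier G)" using \<phi>b by (rule bij_betw_trans)
  then have fb: "bij_betw f S (carrier G)" by (simp add: f_def cong: bij_betw_cong)
  have vm: "v (n x) = compose S n (v x)" if "n \<in> N" "x \<in> S" for n x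
    by (rule uniq[OF _ _ Ga.one_closed]) (use that v[of x] v(1,2)[OF Ncl[OF that]] Nm in \<open>auto simp: compose_def\<close>)
  have fm: "f (n x) = \<phi> n \<otimes> f x" if "n \<in> N" "x \<in> S" for n x
    using that by (simp add: f_def Ncl vm \<phi>m v)
  have F: "f \<in> hgs_maps Gam G"
    unfolding hgs_maps_def
  proof (intro CollectI conjI ballI impI)
    show "f \<in> extensional S" by (simp add: f_def)
    show "bij_betw f S (carrier G)" by (rule fb)
    fix g x y z assume S: "g \<in> S" "x \<in> S" "y \<in> S" "z \<in> S" and e: "f z = f x \<otimes> f y"
    have "f z = f (v x y)" using e S by (simp add: fm v) (simp add: f_def)
    then have z: "z = v x y" using map_eq_iff[OF fb] S Ncl v by auto
    \<comment> \<open>A conjugate of \<open>v x\<close> by a right translation, hence in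
      \<open>N\<close>. Its value at g shows that \<open>\<phi>\<close> sends it to f(x g)
      f(g)^-1.\<close>
    define n where "n = (\<lambda>w\<in>S. v x (w \<otimes>\<^bsub>Gam\<^esub> inv\<^bsub>Gam\<^esub> g) \<otimes>\<^bsub>Gam\<^esub> g)"
    have nN: "n \<in> N"
      using nrm[of "inv\<^bsub>Gam\<^esub> g" "v x"] S v NB by (auto simp: conj_rho n_def subset_iff)
    have "f (n g) = \<phi> n \<otimes> f g" using fm nN S by simp
    moreover have "n g = x \<otimes>\<^bsub>Gam\<^esub> g" using S by (simp add: n_def v)
    ultimately have pn: "\<phi> n = f (x \<otimes>\<^bsub>Gam\<^esub> g) \<otimes> inv (f g)"
      using \<phi>cl[OF nN] S map_closed[OF fb] by (simp add: G.m_assoc)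
    have "z \<otimes>\<^bsub>Gam\<^esub> g = n (y \<otimes>\<^bsub>Gam\<^esub> g)" using S z by (simp add: n_def Ga.m_assoc)
    then show "f (z \<otimes>\<^bsub>Gam\<^esub> g) = f (x \<otimes>\<^bsub>Gam\<^esub> g) \<otimes> inv (f g) \<otimes> f (y \<otimes>\<^bsub>Gam\<^esub> g)"
      using fm[OF nN, of "y \<otimes>\<^bsub>Gam\<^esub> g"] S pn by simp
  qed
  have tr: "transl Gam G f (\<phi> n) = n" if "n \<in> N" for n
    by (rule transl_eqI[OF fb]) (use that NB Ncl fm \<phi>cl in \<open>auto simp: Bij_def\<close>)
  have "transl Gam G f ` carrier G = (transl Gam G f \<circ> \<phi>) ` N"
    using \<phi>b by (simp add: bij_betw_def image_comp[symmetric] image_image) (metis image_image)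
  also have "\<dots> = N" using tr by force
  finally show ?thesis using that F by blast
qed

text \<open>Passing from f to \<alpha> f only relabels the translations: the one by t for f is the
  one by \<alpha>(t) for \<alpha> f.\<close>

lemma hgs_maps_compose:
  assumes F: "f \<in> hgs_maps Gam G" and a: "\<alpha> \<in> auto G"
  shows "compose S \<alpha> f \<in> hgs_maps Gam G"
    "transl Gam G (compose S \<alpha> f) ` carrier G = transl Gam G f ` carrier G"
proof -
  note f = hgs_mapsD(2)[OF F]
  have ab: "bij_betw \<alpha> (carrier G) (carrier G)" and am: "\<And>x y. x \<in> carrier G \<Longrightarrow> y \<in> carrier G \<Longrightarrow> \<alpha> (x \<otimes> y) = \<alpha> x \<otimes> \<alpha> y"
    and acl: "\<And>x. x \<in> carrier G \<Longrightarrow> \<alpha> x \<in> carrier G" and ah: "\<alpha> \<in> hom G G"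
    using a by (auto simp: auto_def Bij_def hom_def)
  have ainj: "x \<in> carrier G \<Longrightarrow> y \<in> carrier G \<Longrightarrow> \<alpha> x = \<alpha> y \<Longrightarrow> x = y" for x y
    using ab by (auto simp: bij_betw_def inj_on_def)
  interpret ahom: group_hom G G \<alpha>
    by (intro group_hom.intro group_hom_axioms.intro G.is_group ah)
  have bij: "bij_betw (compose S \<alpha> f) S (carrier G)" using bij_betw_compose[OF f ab] .
  show "compose S \<alpha> f \<in> hgs_maps Gam G"
    unfolding hgs_maps_def
  proof (intro CollectI conjI ballI impI)
    show "compose S \<alpha> f \<in> extensional S" by simp
    show "bij_betw (compose S \<alpha> f) S (carrier G)" by (rule bij)
    fix g x y z assume S: "g \<in> S" "x \<in> S" "y \<in> S" "z \<in> S" and e: "compose S \<alpha> f z = compose S \<alpha> f x \<otimes> compose S \<alpha> f y"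
    then have "\<alpha> (f z) = \<alpha> (f x \<otimes> f y)" by (simp add: compose_def am map_closed[OF f])
    then have "f z = f x \<otimes> f y" using S by (metis ainj map_closed[OF f] G.m_closed)
    from hgs_mapsD(3)[OF F S this] S show "compose S \<alpha> f (z \<otimes>\<^bsub>Gam\<^esub> g) =
        compose S \<alpha> f (x \<otimes>\<^bsub>Gam\<^esub> g) \<otimes> inv (compose S \<alpha> f g) \<otimes> compose S \<alpha> f (y \<otimes>\<^bsub>Gam\<^esub> g)"
      by (simp add: compose_def map_closed[OF f])
  qed
  have "transl Gam G (compose S \<alpha> f) (\<alpha> t) = transl Gam G f t" if "t \<in> carrier G" for t
    by (rule transl_eqI[OF bij]) (use that transl_Bij[OF f that] in \<open>auto simp: compose_def acl transl_cl[OF f] map_transl[OF f] map_closed[OF f] Bij_def\<close>)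
  then have "(\<lambda>t. transl Gam G (compose S \<alpha> f) (\<alpha> t)) ` carrier G = transl Gam G f ` carrier G" by (intro image_cong) auto
  moreover have "(\<lambda>t. transl Gam G (compose S \<alpha> f) (\<alpha> t)) ` carrier G = transl Gam G (compose S \<alpha> f) ` carrier G"
    using ab by (metis bij_betw_imp_surj_on image_image)
  ultimately show "transl Gam G (compose S \<alpha> f) ` carrier G = transl Gam G f ` carrier G" by simp
qed

text \<open>The map f' f^-1 carries left translations of \<open>G\<close> to left translations and
  fixes the identity; this makes it multiplicative.\<close>

lemma hgs_maps_fibre:
  assumes F: "f \<in> hgs_maps Gam G" and F': "f' \<in> hgs_maps Gam G"
    and eq: "transl Gam G f ` carrier G = transl Gam G f' ` carrier G"
  shows "\<exists>\<alpha>\<in>auto G. f' = compose S \<alpha> f"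
proof -
  note f = hgs_mapsD(2)[OF F] and f' = hgs_mapsD(2)[OF F']
  \<comment> \<open>At g = x = y = 1 the condition on h gives h(z) = h(1), where h(z) = h(1)
    h(1).\<close>
  have one: "h \<one>\<^bsub>Gam\<^esub> = \<one>" if H: "h \<in> hgs_maps Gam G" for h
  proof -
    note h = hgs_mapsD(2)[OF H]
    define z where "z = inv_into S h (h \<one>\<^bsub>Gam\<^esub> \<otimes> h \<one>\<^bsub>Gam\<^esub>)"
    have z: "z \<in> S" "h z = h \<one>\<^bsub>Gam\<^esub> \<otimes> h \<one>\<^bsub>Gam\<^esub>" using map_inv_into[OF h] map_closed[OF h] by (auto simp: z_def)
    from hgs_mapsD(3)[OF H Ga.one_closed Ga.one_closed Ga.one_closed z]
    have "h z = h \<one>\<^bsub>Gam\<^esub>" using z map_closed[OF h] by (simp add: G.m_assoc)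
    then have "h \<one>\<^bsub>Gam\<^esub> \<otimes> h \<one>\<^bsub>Gam\<^esub> = h \<one>\<^bsub>Gam\<^esub>" using z by simp
    then show ?thesis using map_closed[OF h] by simp
  qed
  define \<alpha> where "\<alpha> = (\<lambda>y\<in>carrier G. f' (inv_into S f y))"
  have af: "\<alpha> (f x) = f' x" if "x \<in> S" for x
    using that by (simp add: \<alpha>_def map_closed[OF f] map_inv_into_left[OF f])
  have "bij_betw (f' \<circ> inv_into S f) (carrier G) (carrier G)"
    using bij_betw_inv_into[OF f] f' by (rule bij_betw_trans)
  then have ab: "bij_betw \<alpha> (carrier G) (carrier G)" by (simp add: \<alpha>_def cong: bij_betw_cong)
  have "\<alpha> (t \<otimes> u) = \<alpha> t \<otimes> \<alpha> u" if tu: "t \<in> carrier G" "u \<in> carrier G" for t u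
  proof -
    obtain t' where t': "t' \<in> carrier G" "transl Gam G f t = transl Gam G f' t'" using eq tu by blast
    have *: "f' (inv_into S f (t \<otimes> f x)) = t' \<otimes> f' x" if "x \<in> S" for x
    proof -
      have "inv_into S f (t \<otimes> f x) = transl Gam G f' t' x"
        using t'(2)[symmetric] that by (simp add: transl_def)
      then show ?thesis using map_transl[OF f' t'(1) that] by simp
    qed
    have t1: "\<alpha> t = t'" using *[of "\<one>\<^bsub>Gam\<^esub>"] tu t' one[OF F] one[OF F'] by (simp add: \<alpha>_def)
    show ?thesis using *[of "inv_into S f u"] tu t1 map_inv_into[OF f] by (simp add: \<alpha>_def)
  qed
  then have "\<alpha> \<in> auto G" using ab bij_betwE[OF ab] by (auto simp: auto_def Bij_def hom_def) (simp add: \<alpha>_def)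
  moreover have "f' = compose S \<alpha> f"
    by (rule extensionalityI[of _ S]) (use hgs_mapsD(1)[OF F'] af in \<open>auto simp: compose_def\<close>)
  ultimately show ?thesis by blast
qed

lemma finite_hgs_maps: "finite (hgs_maps Gam G)"
proof (rule finite_subset)
  show "hgs_maps Gam G \<subseteq> (S \<rightarrow>\<^sub>E carrier G)"
    by (auto simp: hgs_maps_def PiE_def bij_betwE)
qed (use finS finG in \<open>blast intro: finite_PiE\<close>)

text \<open>The fibres of the map from f to its regular subgroup are orbits of
  \<open>auto G\<close>, which acts freely because every f is onto \<open>G\<close>.\<close>

theorem hgs_count_times_auto: "hgs_count Gam G * card (auto G) = card (hgs_maps Gam G)"
proof -
  let ?T = "\<lambda>f. transl Gam G f ` carrier G"
  have fibre: "card {f \<in> hgs_maps Gam G. ?T f = N} = card (auto G)" if N: "N \<in> hgs_set Gam G" for N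
  proof -
    obtain f where F: "f \<in> hgs_maps Gam G" "N = ?T f" using hgs_set_obtains[OF N] .
    note f = hgs_mapsD(2)[OF F(1)]
    have "{h \<in> hgs_maps Gam G. ?T h = N} = (\<lambda>\<alpha>. compose S \<alpha> f) ` auto G"
    proof (intro equalityI subsetI)
      fix h assume "h \<in> {h \<in> hgs_maps Gam G. ?T h = N}"
      then show "h \<in> (\<lambda>\<alpha>. compose S \<alpha> f) ` auto G"
        using hgs_maps_fibre[OF F(1), of h] F(2) by auto
    next
      fix h assume "h \<in> (\<lambda>\<alpha>. compose S \<alpha> f) ` auto G"
      then show "h \<in> {h \<in> hgs_maps Gam G. ?T h = N}"
        using hgs_maps_compose[OF F(1)] F(2) by blast
    qed
    moreover have "inj_on (\<lambda>\<alpha>. compose S \<alpha> f) (auto G)"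
    proof (rule inj_onI)
      fix \<alpha> \<beta> assume ab: "\<alpha> \<in> auto G" "\<beta> \<in> auto G" and e: "compose S \<alpha> f = compose S \<beta> f"
      show "\<alpha> = \<beta>"
      proof (rule extensionalityI[of _ "carrier G"])
        fix y assume y: "y \<in> carrier G"
        have "compose S \<alpha> f (inv_into S f y) = compose S \<beta> f (inv_into S f y)" using e by simp
        then show "\<alpha> y = \<beta> y" using map_inv_into[OF f y] by (simp add: compose_def)
      qed (use ab in \<open>auto simp: auto_def Bij_def\<close>)
    qed
    ultimately show ?thesis by (simp add: card_image)
  qed
  have fin: "finite (hgs_set Gam G)"
  proof (rule finite_subset)
    show "hgs_set Gam G \<subseteq> ?T ` hgs_maps Gam G" using hgs_set_obtains by blast
  qed (simp add: finite_hgs_maps)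
  have "hgs_maps Gam G = (\<Union>N\<in>hgs_set Gam G. {f \<in> hgs_maps Gam G. ?T f = N})"
    using transl_in_hgs_set by auto
  then have "card (hgs_maps Gam G) = card (\<Union>N\<in>hgs_set Gam G. {f \<in> hgs_maps Gam G. ?T f = N})" by simp
  also have "\<dots> = (\<Sum>N\<in>hgs_set Gam G. card {f \<in> hgs_maps Gam G. ?T f = N})"
    by (rule card_UN_disjoint) (auto simp: fin finite_hgs_maps)
  also have "\<dots> = card (hgs_set Gam G) * card (auto G)" by (simp add: fibre)
  finally show ?thesis by (simp add: hgs_count_def hgs_set_def)
qed

end

text \<open>These are the bijective crossed homomorphisms (1-cocycles) from \<open>Gam\<close> to
  \<open>G\<close>: each g acts on \<open>G\<close> by the automorphism \<alpha> followed by left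
  translation by k(g).\<close>

definition left_hgs_maps :: "('a, 'c) monoid_scheme \<Rightarrow> ('b, 'd) monoid_scheme \<Rightarrow> ('a \<Rightarrow> 'b) set" where
  "left_hgs_maps Gam G = {k \<in> extensional (carrier Gam). bij_betw k (carrier Gam) (carrier G) \<and>
     (\<forall>g\<in>carrier Gam. \<exists>\<alpha>\<in>auto G. \<forall>x\<in>carrier Gam. k (g \<otimes>\<^bsub>Gam\<^esub> x) = k g \<otimes>\<^bsub>G\<^esub> \<alpha> (k x))}"

lemma autoD:
  assumes "\<alpha> \<in> auto G"
  shows "\<alpha> \<in> extensional (carrier G)" "bij_betw \<alpha> (carrier G) (carrier G)"
    "\<And>x. x \<in> carrier G \<Longrightarrow> \<alpha> x \<in> carrier G"
    "\<And>x y. x \<in> carrier G \<Longrightarrow> y \<in> carrier G \<Longrightarrow> \<alpha> (x \<otimes>\<^bsub>G\<^esub> y) = \<alpha> x \<otimes>\<^bsub>G\<^esub> \<alpha> y"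
    "\<And>x y. x \<in> carrier G \<Longrightarrow> y \<in> carrier G \<Longrightarrow> \<alpha> x = \<alpha> y \<Longrightarrow> x = y"
  using assms by (auto simp: auto_def Bij_def hom_def bij_betw_def inj_on_def)

lemma (in group) auto_one: "\<alpha> \<in> auto G \<Longrightarrow> \<alpha> \<one> = \<one>"
  using hom_one[of \<alpha> G] is_group by (auto simp: auto_def)

lemma (in group) auto_pow: "\<alpha> \<in> auto G \<Longrightarrow> x \<in> carrier G \<Longrightarrow> \<alpha> (x [^] (n::nat)) = \<alpha> x [^] n"
  by (induction n) (auto simp: auto_one autoD(3,4))

lemma auto_compose: "\<alpha> \<in> auto G \<Longrightarrow> \<beta> \<in> auto G \<Longrightarrow> group G \<Longrightarrow> compose (carrier G) \<alpha> \<beta> \<in> auto G"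
proof -
  assume a: "\<alpha> \<in> auto G" "\<beta> \<in> auto G" and "group G"
  then interpret group G by simp
  have "compose (carrier G) \<alpha> \<beta> \<in> Bij (carrier G)" using a by (auto simp: auto_def compose_Bij)
  then show ?thesis using autoD(3,4)[OF a(1)] autoD(3,4)[OF a(2)] by (auto simp: auto_def hom_def compose_def)
qed

context two_groups
begin

text \<open>The hypothesis makes x |-> g x, seen through k, an affine map of \<open>G\<close>;
  dividing off the translation by k(g) leaves an automorphism.\<close>

lemma left_hgs_mapsI:
  assumes "k \<in> extensional S" and k: "bij_betw k S (carrier G)"
    and H: "\<And>g x y z. \<lbrakk>g \<in> S; x \<in> S; y \<in> S; z \<in> S; k z = k x \<otimes> k y\<rbrakk> \<Longrightarrow>
        k (g \<otimes>\<^bsub>Gam\<^esub> z) = k (g \<otimes>\<^bsub>Gam\<^esub> x) \<otimes> inv (k g) \<otimes> k (g \<otimes>\<^bsub>Gam\<^esub> y)"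
  shows "k \<in> left_hgs_maps Gam G"
proof -
  have "\<exists>\<alpha>\<in>auto G. \<forall>x\<in>S. k (g \<otimes>\<^bsub>Gam\<^esub> x) = k g \<otimes> \<alpha> (k x)" if g: "g \<in> S" for g
  proof -
    define \<alpha> where "\<alpha> = (\<lambda>w\<in>carrier G. inv (k g) \<otimes> k (g \<otimes>\<^bsub>Gam\<^esub> inv_into S k w))"
    have ak: "\<alpha> (k x) = inv (k g) \<otimes> k (g \<otimes>\<^bsub>Gam\<^esub> x)" if "x \<in> S" for x
      using that by (simp add: \<alpha>_def map_closed[OF k] map_inv_into_left[OF k])
    have ex: "\<exists>x\<in>S. w = k x" if "w \<in> carrier G" for w using map_inv_into[OF k that] by metis
    have "\<alpha> \<in> auto G"
    proof -
      have "inj_on \<alpha> (carrier G)"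
      proof (rule inj_onI)
        fix w w' assume w: "w \<in> carrier G" "w' \<in> carrier G" "\<alpha> w = \<alpha> w'"
        obtain x x' where "x \<in> S" "w = k x" "x' \<in> S" "w' = k x'" using ex w by blast
        with w g show "w = w'" by (auto simp: ak map_closed[OF k] map_eq_iff[OF k])
      qed
      moreover have cl: "\<alpha> w \<in> carrier G" if "w \<in> carrier G" for w
        using ex[OF that] g by (auto simp: ak map_closed[OF k])
      ultimately have "bij_betw \<alpha> (carrier G) (carrier G)"
        using finG by (auto simp: bij_betw_def endo_inj_surj image_subset_iff)
      moreover have "\<alpha> (w \<otimes> w') = \<alpha> w \<otimes> \<alpha> w'" if w: "w \<in> carrier G" "w' \<in> carrier G" for w w'
      proof -
        obtain x x' where x: "x \<in> S" "w = k x" "x' \<in> S" "w' = k x'" using ex w by blast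
        obtain z where z: "z \<in> S" "k z = w \<otimes> w'" using ex[of "w \<otimes> w'"] w by auto
        have "k (g \<otimes>\<^bsub>Gam\<^esub> z) = k (g \<otimes>\<^bsub>Gam\<^esub> x) \<otimes> inv (k g) \<otimes> k (g \<otimes>\<^bsub>Gam\<^esub> x')"
          using H g x z by auto
        then have "\<alpha> (k z) = inv (k g) \<otimes> (k (g \<otimes>\<^bsub>Gam\<^esub> x) \<otimes> inv (k g) \<otimes> k (g \<otimes>\<^bsub>Gam\<^esub> x'))" using ak[OF z(1)] by simp
        also have "\<dots> = \<alpha> w \<otimes> \<alpha> w'" using x g by (simp add: ak map_closed[OF k] G.m_assoc)
        finally show ?thesis using z by simp
      qed
      ultimately show ?thesis using cl by (auto simp: auto_def Bij_def hom_def \<alpha>_def)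
    qed
    moreover have "k (g \<otimes>\<^bsub>Gam\<^esub> x) = k g \<otimes> \<alpha> (k x)" if "x \<in> S" for x
      using that g by (simp add: ak map_closed[OF k] G.m_assoc[symmetric])
    ultimately show ?thesis by blast
  qed
  then show ?thesis using assms by (auto simp: left_hgs_maps_def)
qed

lemma left_hgs_mapsD:
  assumes K: "k \<in> left_hgs_maps Gam G"
    and S: "g \<in> S" "x \<in> S" "y \<in> S" "z \<in> S" and e: "k z = k x \<otimes> k y"
  shows "k (g \<otimes>\<^bsub>Gam\<^esub> z) = k (g \<otimes>\<^bsub>Gam\<^esub> x) \<otimes> inv (k g) \<otimes> k (g \<otimes>\<^bsub>Gam\<^esub> y)"
proof -
  have k: "bij_betw k S (carrier G)" using K by (auto simp: left_hgs_maps_def)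
  obtain \<alpha> where a: "\<alpha> \<in> auto G" "\<And>x. x \<in> S \<Longrightarrow> k (g \<otimes>\<^bsub>Gam\<^esub> x) = k g \<otimes> \<alpha> (k x)"
    using K S by (auto simp: left_hgs_maps_def)
  show ?thesis using S e a(2) autoD(3,4)[OF a(1)]
    by (simp add: map_closed[OF k] G.m_assoc) (simp add: map_closed[OF k] G.m_assoc[symmetric])
qed

text \<open>Inversion turns right translations of \<open>Gam\<close> into left translations.\<close>

lemma card_hgs_maps_iso:
  fixes Gam0 :: "('e, 'f) monoid_scheme"
  assumes g0: "group Gam0" and iso: "\<psi> \<in> iso Gam0 Gam"
  shows "card (hgs_maps Gam G) = card (left_hgs_maps Gam0 G)"
proof -
  interpret G0: group Gam0 by (rule g0)
  let ?S0 = "carrier Gam0"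
  have pb: "bij_betw \<psi> ?S0 S" and pm: "\<And>x y. x \<in> ?S0 \<Longrightarrow> y \<in> ?S0 \<Longrightarrow> \<psi> (x \<otimes>\<^bsub>Gam0\<^esub> y) = \<psi> x \<otimes>\<^bsub>Gam\<^esub> \<psi> y"
    using iso by (auto simp: iso_def hom_def)
  have pcl: "\<And>x. x \<in> ?S0 \<Longrightarrow> \<psi> x \<in> S" using pb by (auto dest: bij_betwE)
  interpret T0: two_groups Gam0 G
    by (intro two_groups.intro two_groups_axioms.intro g0 G.is_group finG) (use pb finS in \<open>simp add: bij_betw_finite\<close>)
  define \<tau> where "\<tau> = (\<lambda>w. inv\<^bsub>Gam\<^esub> (\<psi> w))"
  define \<sigma> where "\<sigma> = inv_into ?S0 \<tau>"
  have "bij_betw (\<lambda>x. inv\<^bsub>Gam\<^esub> x) S S"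
    by (rule bij_betwI[where g="\<lambda>x. inv\<^bsub>Gam\<^esub> x"]) auto
  from bij_betw_trans[OF pb this] have tb: "bij_betw \<tau> ?S0 S" by (simp add: \<tau>_def comp_def)
  have sb: "bij_betw \<sigma> S ?S0" unfolding \<sigma>_def using tb by (rule bij_betw_inv_into)
  have tcl: "w \<in> ?S0 \<Longrightarrow> \<tau> w \<in> S" for w using tb by (auto dest: bij_betwE)
  have scl: "x \<in> S \<Longrightarrow> \<sigma> x \<in> ?S0" for x using sb by (auto dest: bij_betwE)
  have ts: "x \<in> S \<Longrightarrow> \<tau> (\<sigma> x) = x" for x using tb by (simp add: \<sigma>_def bij_betw_inv_into_right)
  have st: "w \<in> ?S0 \<Longrightarrow> \<sigma> (\<tau> w) = w" for w using tb by (simp add: \<sigma>_def bij_betw_inv_into_left)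
  have tm: "w \<in> ?S0 \<Longrightarrow> w' \<in> ?S0 \<Longrightarrow> \<tau> (w \<otimes>\<^bsub>Gam0\<^esub> w') = \<tau> w' \<otimes>\<^bsub>Gam\<^esub> \<tau> w" for w w'
    by (simp add: \<tau>_def pm pcl Ga.inv_mult_group)
  have sm: "\<sigma> (x \<otimes>\<^bsub>Gam\<^esub> y) = \<sigma> y \<otimes>\<^bsub>Gam0\<^esub> \<sigma> x" if "x \<in> S" "y \<in> S" for x y
    using tm[of "\<sigma> y" "\<sigma> x"] that by (metis G0.m_closed scl st ts)
  have "bij_betw (\<lambda>f. \<lambda>w\<in>?S0. f (\<tau> w)) (hgs_maps Gam G) (left_hgs_maps Gam0 G)"
  proof (rule bij_betwI[where g="\<lambda>k. \<lambda>x\<in>S. k (\<sigma> x)"])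
    show "(\<lambda>f. \<lambda>w\<in>?S0. f (\<tau> w)) \<in> hgs_maps Gam G \<rightarrow> left_hgs_maps Gam0 G"
    proof
      fix f assume F: "f \<in> hgs_maps Gam G"
      note f = hgs_mapsD(2)[OF F]
      show "(\<lambda>w\<in>?S0. f (\<tau> w)) \<in> left_hgs_maps Gam0 G"
      proof (rule T0.left_hgs_mapsI)
        show "bij_betw (\<lambda>w\<in>?S0. f (\<tau> w)) ?S0 (carrier G)"
          using bij_betw_trans[OF tb f] by (simp add: comp_def)
        fix g x y z assume "g \<in> ?S0" "x \<in> ?S0" "y \<in> ?S0" "z \<in> ?S0"
          and "(\<lambda>w\<in>?S0. f (\<tau> w)) z = (\<lambda>w\<in>?S0. f (\<tau> w)) x \<otimes> (\<lambda>w\<in>?S0. f (\<tau> w)) y"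
        then show "(\<lambda>w\<in>?S0. f (\<tau> w)) (g \<otimes>\<^bsub>Gam0\<^esub> z) = (\<lambda>w\<in>?S0. f (\<tau> w)) (g \<otimes>\<^bsub>Gam0\<^esub> x)
           \<otimes> inv ((\<lambda>w\<in>?S0. f (\<tau> w)) g) \<otimes> (\<lambda>w\<in>?S0. f (\<tau> w)) (g \<otimes>\<^bsub>Gam0\<^esub> y)"
          using hgs_mapsD(3)[OF F, of "\<tau> g" "\<tau> x" "\<tau> y" "\<tau> z"] by (simp add: tm tcl)
      qed simp
    qed
    show "(\<lambda>k. \<lambda>x\<in>S. k (\<sigma> x)) \<in> left_hgs_maps Gam0 G \<rightarrow> hgs_maps Gam G"
    proof
      fix k assume K: "k \<in> left_hgs_maps Gam0 G"
      then have k: "bij_betw k ?S0 (carrier G)" by (simp add: left_hgs_maps_def)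
      show "(\<lambda>x\<in>S. k (\<sigma> x)) \<in> hgs_maps Gam G"
        unfolding hgs_maps_def
      proof (intro CollectI conjI ballI impI)
        show "bij_betw (\<lambda>w\<in>S. k (\<sigma> w)) S (carrier G)"
          using bij_betw_trans[OF sb k] by (simp add: comp_def)
        fix g x y z assume "g \<in> S" "x \<in> S" "y \<in> S" "z \<in> S"
          and "(\<lambda>w\<in>S. k (\<sigma> w)) z = (\<lambda>w\<in>S. k (\<sigma> w)) x \<otimes> (\<lambda>w\<in>S. k (\<sigma> w)) y"
        then show "(\<lambda>w\<in>S. k (\<sigma> w)) (z \<otimes>\<^bsub>Gam\<^esub> g) = (\<lambda>w\<in>S. k (\<sigma> w)) (x \<otimes>\<^bsub>Gam\<^esub> g)
           \<otimes> inv ((\<lambda>w\<in>S. k (\<sigma> w)) g) \<otimes> (\<lambda>w\<in>S. k (\<sigma> w)) (y \<otimes>\<^bsub>Gam\<^esub> g)"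
          using T0.left_hgs_mapsD[OF K, of "\<sigma> g" "\<sigma> x" "\<sigma> y" "\<sigma> z"] by (simp add: sm scl)
      qed simp
    qed
    show "(\<lambda>x\<in>S. (\<lambda>w\<in>?S0. f (\<tau> w)) (\<sigma> x)) = f" if "f \<in> hgs_maps Gam G" for f
      by (rule extensionalityI[of _ S]) (use hgs_mapsD(1)[OF that] in \<open>auto simp: ts scl\<close>)
    show "(\<lambda>w\<in>?S0. (\<lambda>x\<in>S. k (\<sigma> x)) (\<tau> w)) = k" if "k \<in> left_hgs_maps Gam0 G" for k
      by (rule extensionalityI[of _ ?S0]) (use that in \<open>auto simp: st tcl left_hgs_maps_def\<close>)
  qed
  then show ?thesis by (rule bij_betw_same_card)
qed

end

lemma hgs_count_cong_iso:
  fixes Gam :: "('a, 'c) monoid_scheme"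
  assumes "group G" "group G'" "G \<cong> G'"
  shows "hgs_count Gam G = hgs_count Gam G'"
proof -
  have "N \<cong> G \<longleftrightarrow> N \<cong> G'" for N :: "('a \<Rightarrow> 'a) monoid"
    using assms iso_trans group.iso_sym by metis
  then show ?thesis by (simp add: hgs_count_def)
qed

text \<open>The polynomial \<open>(x ^ k - y ^ k) / (x - y)\<close>, which also makes sense for \<open>x = y\<close>.\<close>

primrec gsum :: "nat \<Rightarrow> int \<Rightarrow> int \<Rightarrow> int" where
  "gsum 0 x y = 0"
| "gsum (Suc k) x y = x * gsum k x y + y ^ k"

lemma gsum_mult: "(x - y) * gsum k x y = x ^ k - y ^ k"
proof (induction k)
  case (Suc k)
  have "(x - y) * gsum (Suc k) x y = x * ((x - y) * gsum k x y) + (x - y) * y ^ k"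
    by (simp add: algebra_simps)
  also have "\<dots> = x * (x ^ k - y ^ k) + (x - y) * y ^ k" using Suc by simp
  also have "\<dots> = x ^ Suc k - y ^ Suc k" by (simp add: algebra_simps)
  finally show ?case .
qed simp

lemma gsum_add: "gsum (a + b) x y = x ^ b * gsum a x y + y ^ a * gsum b x y"
  by (induction b) (auto simp: algebra_simps power_add)

lemma gsum_cong:
  assumes "[x = x'] (mod d)" "[y = y'] (mod d)"
  shows "[gsum k x y = gsum k x' y'] (mod d)"
  using assms by (induction k) (auto intro!: cong_add cong_mult cong_pow)

lemma gsum_same: "gsum k x x = int k * x ^ (k - 1)"
proof (induction k)
  case (Suc k)
  then show ?case by (cases k) (auto simp: algebra_simps)
qed simp

lemma gsum_one [simp]: "gsum k 1 1 = int k"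
  by (simp add: gsum_same)

text \<open>This is the binomial expansion to first order in P t. Doubling avoids the division in d
  (d - 1) / 2.\<close>

lemma double_gsum_cong:
  "[2 * gsum d (1 + P * t) 1 = 2 * int d + P * t * (int d * (int d - 1))] (mod P ^ 2)"
proof (induction d)
  case (Suc d)
  then obtain k where k: "2 * gsum d (1 + P * t) 1 = 2 * int d + P * t * (int d * (int d - 1)) + k * P ^ 2"
    by (metis cong_iff_lin mult.commute add.commute cong_sym)
  have "2 * gsum (Suc d) (1 + P * t) 1 = (1 + P * t) * (2 * gsum d (1 + P * t) 1) + 2" by (simp add: algebra_simps)
  also have "\<dots> = 2 * int (Suc d) + P * t * (int (Suc d) * (int (Suc d) - 1)) +
     P ^ 2 * (k + k * P * t + t * t * (int d * (int d - 1)))"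
    unfolding k by (simp add: algebra_simps power2_eq_square)
  finally show ?case by (metis cong_iff_lin cong_sym)
qed simp

text \<open>For odd primes this is the first case of lifting the exponent.\<close>

lemma dvd_gsum_iff:
  fixes P :: nat
  assumes P: "Factorial_Ring.prime P" and N: "N = P \<or> N = P\<^sup>2 \<and> odd P" and i: "[i = 1] (mod int P)"
  shows "int N dvd gsum d i 1 \<longleftrightarrow> N dvd d"
  using N
proof
  assume "N = P"
  moreover have "[gsum d i 1 = int d] (mod int P)" using gsum_cong[OF i cong_refl, of d 1] by simp
  ultimately show ?thesis by (metis cong_dvd_iff int_dvd_int_iff)
next
  assume N: "N = P\<^sup>2 \<and> odd P"
  obtain t where t: "i = 1 + int P * t" using i by (metis cong_iff_lin cong_sym)
  have pP: "Factorial_Ring.prime (int P)" using P by simp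
  have c2: "coprime (int N) 2" using N by simp
  \<comment> \<open>This cofactor of d is 2 modulo P, a unit because P is odd.\<close>
  have "\<not> int P dvd 2 + int P * t * (int d - 1)"
  proof
    assume "int P dvd 2 + int P * t * (int d - 1)"
    then have "int P dvd 2" by (metis dvd_add_left_iff dvd_triv_left mult.assoc)
    then have "P dvd 2" by presburger
    then show False using N P by (metis primes_dvd_imp_eq two_is_prime_nat even_numeral dvd_refl)
  qed
  then have c3: "coprime (int N) (2 + int P * t * (int d - 1))"
    using N pP by (simp add: prime_imp_coprime)
  have "int N dvd gsum d i 1 \<longleftrightarrow> int N dvd 2 * gsum d i 1" using c2 by (simp add: coprime_dvd_mult_right_iff)
  also have "\<dots> \<longleftrightarrow> int N dvd 2 * int d + int P * t * (int d * (int d - 1))"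
    using double_gsum_cong[of d "int P" t] N t by (intro cong_dvd_iff) simp
  also have "2 * int d + int P * t * (int d * (int d - 1)) = int d * (2 + int P * t * (int d - 1))" by (simp add: algebra_simps)
  also have "int N dvd \<dots> \<longleftrightarrow> int N dvd int d" using c3 by (simp add: coprime_dvd_mult_left_iff)
  finally show ?thesis by simp
qed

section \<open>The holomorph of a metacyclic group\<close>

text \<open>An integer copy of \<^const>\<open>sdp\<close>, in which coordinates can be subtracted.\<close>

definition isdp :: "nat \<Rightarrow> nat \<Rightarrow> nat \<Rightarrow> (int \<times> int) monoid" where
  "isdp m n s = \<lparr>carrier = {0..<int m} \<times> {0..<int n},
      monoid.mult = (\<lambda>(a, b) (c, d). ((a + int s ^ nat b * c) mod int m, (b + d) mod int n)),
      monoid.one = (0, 0)\<rparr>"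

lemma carrier_isdp: "carrier (isdp m n s) = {0..<int m} \<times> {0..<int n}"
  and one_isdp: "\<one>\<^bsub>isdp m n s\<^esub> = (0, 0)"
  and mult_isdp: "(a, b) \<otimes>\<^bsub>isdp m n s\<^esub> (c, d) = ((a + int s ^ nat b * c) mod int m, (b + d) mod int n)"
  by (simp_all add: isdp_def)

lemma sdp_iso_isdp: "sdp m n s \<cong> isdp m n s"
proof -
  let ?h = "\<lambda>(a, b). (int a, int b)"
  have "?h \<in> iso (sdp m n s) (isdp m n s)"
  proof (rule isoI)
    show "?h \<in> hom (sdp m n s) (isdp m n s)"
      by (auto simp: hom_def sdp_def isdp_def zmod_int)
    show "bij_betw ?h (carrier (sdp m n s)) (carrier (isdp m n s))"
      by (rule bij_betwI[where g="\<lambda>(a, b). (nat a, nat b)"]) (auto simp: sdp_def isdp_def)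
  qed
  then show ?thesis by (auto simp: is_iso_def)
qed

lemma mod_nest:
  fixes a b k x d :: int
  shows "(a + k * (x mod d)) mod d = (a + k * x) mod d"
    "(a + (x mod d) * k) mod d = (a + x * k) mod d"
    "(a + (x mod d) * k + b) mod d = (a + x * k + b) mod d"
    "(x mod d + a + b) mod d = (x + a + b) mod d"
    "(a + k * (x mod d) + b) mod d = (a + k * x + b) mod d"
proof -
  have x: "[x mod d = x] (mod d)" by simp
  show "(a + k * (x mod d)) mod d = (a + k * x) mod d"
    "(a + (x mod d) * k) mod d = (a + x * k) mod d"
    "(a + (x mod d) * k + b) mod d = (a + x * k + b) mod d"
    "(x mod d + a + b) mod d = (x + a + b) mod d"
    "(a + k * (x mod d) + b) mod d = (a + k * x + b) mod d"
    unfolding cong_def[symmetric] by (intro cong_add cong_mult cong_refl x)+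
qed

text \<open>Two instances are needed: P = q, Q = p, m = q, n = p^2 if q does not divide p - 1, and P
  = p, Q = q, m = p^2, n = q if it does. By \<open>s_cases\<close> the action is trivial only for
  the literal value s = 1, and otherwise chi(v) - 1 is a unit for every unit v of Z/n. Squares are
  restricted to odd primes for the sake of \<open>dvd_gsum_iff\<close>.\<close>

locale sd_data =
  fixes P Q m n s :: nat
  assumes primeP: "Factorial_Ring.prime P" and primeQ: "Factorial_Ring.prime Q"
    and PQ: "P \<noteq> Q" "\<not> P dvd Q - 1"
    and m: "m = P \<or> m = P\<^sup>2 \<and> odd P" and n: "n = Q \<or> n = Q\<^sup>2 \<and> odd Q"
    and s_pow: "[s ^ n = 1] (mod m)"
    and s_cases: "s = 1 \<or> (\<forall>v. \<not> Q dvd v \<longrightarrow> \<not> [s ^ v = 1] (mod P))"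
begin

abbreviation M :: int where "M \<equiv> int m"
abbreviation N :: int where "N \<equiv> int n"

text \<open>Reducing the exponent makes periodicity an equality, also at negative arguments, whereas
  multiplicativity holds only modulo m.\<close>

definition chi :: "int \<Rightarrow> int" where
  "chi b = int s ^ nat (b mod N)"

lemma m_pos: "m > 1" and n_pos: "n > 1"
  using m n prime_gt_1_nat[OF primeP] prime_gt_1_nat[OF primeQ] one_less_power[of P 2] one_less_power[of Q 2]
  by fastforce+

lemma coprime_m_iff: "coprime x M \<longleftrightarrow> \<not> int P dvd x"
proof -
  have "coprime x M \<longleftrightarrow> coprime x (int P)" using m by auto
  also have "\<dots> \<longleftrightarrow> \<not> int P dvd x"
    using primeP by (metis coprime_commute prime_imp_coprime prime_nat_int_transfer not_coprimeI dvd_refl not_prime_unit)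
  finally show ?thesis .
qed

lemma coprime_n_iff: "coprime x N \<longleftrightarrow> \<not> int Q dvd x"
proof -
  have "coprime x N \<longleftrightarrow> coprime x (int Q)" using n by auto
  also have "\<dots> \<longleftrightarrow> \<not> int Q dvd x"
    using primeQ by (metis coprime_commute prime_imp_coprime prime_nat_int_transfer not_coprimeI dvd_refl not_prime_unit)
  finally show ?thesis .
qed

lemma P_dvd_m: "int P dvd M" and Q_dvd_n: "int Q dvd N"
  using m n by auto

lemma P_cong: "[x = y] (mod M) \<Longrightarrow> [x = y] (mod int P)"
  using cong_dvd_modulus P_dvd_m by blast

lemma coprime_nm: "coprime N M"
proof -
  have "coprime Q P" using primeP primeQ PQ by (simp add: primes_coprime)
  then show ?thesis using m n by auto
qed

lemma chi_cong: "[b = b'] (mod N) \<Longrightarrow> chi b = chi b'"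
  by (simp add: chi_def cong_def)

lemma chi_0 [simp]: "chi 0 = 1" by (simp add: chi_def)

lemma chi_of_nat: "[chi (int k) = int s ^ k] (mod M)"
proof -
  have "k = k mod n + n * (k div n)" by simp
  then have "int s ^ k = int s ^ (k mod n) * (int s ^ n) ^ (k div n)" by (metis power_add power_mult)
  moreover have "[int s ^ n = 1] (mod M)" using s_pow by (metis cong_int_iff of_nat_1 of_nat_power)
  then have "[int s ^ (k mod n) * (int s ^ n) ^ (k div n) = int s ^ (k mod n) * 1 ^ (k div n)] (mod M)"
    by (intro cong_mult cong_pow cong_refl)
  ultimately show ?thesis by (simp add: chi_def cong_sym flip: zmod_int)
qed

lemma chi_nonneg: "0 \<le> b \<Longrightarrow> [chi b = int s ^ nat b] (mod M)"
  using chi_of_nat[of "nat b"] by simp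

lemma chi_add: "[chi (a + b) = chi a * chi b] (mod M)"
proof -
  let ?a = "nat (a mod N)" and ?b = "nat (b mod N)"
  have "chi (a + b) = chi (int (?a + ?b))"
    using n_pos by (intro chi_cong) (simp add: cong_def mod_simps)
  also have "[\<dots> = int s ^ (?a + ?b)] (mod M)" by (rule chi_of_nat)
  finally show ?thesis by (simp add: chi_def power_add)
qed

lemma chi_mult: "[chi (int k * b) = chi b ^ k] (mod M)"
proof (induction k)
  case (Suc k)
  have "[chi (int (Suc k) * b) = chi b * chi (int k * b)] (mod M)"
    using chi_add[of b "int k * b"] by (simp add: algebra_simps)
  also have "[chi b * chi (int k * b) = chi b ^ Suc k] (mod M)"
    using cong_mult[OF cong_refl Suc] by simp
  finally show ?case .
qed simp

lemma chi_minus: "[chi b * chi (- b) = 1] (mod M)" "[chi (- b) * chi b = 1] (mod M)"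
  using chi_add[of b "-b"] chi_add[of "-b" b] by (auto dest: cong_sym)

lemma coprime_chi: "coprime (chi b) M"
  using chi_minus(1)[of b] by (metis coprime_iff_invertible_int)

lemma chi_pow_n: "[chi b ^ n = 1] (mod M)"
proof -
  have "chi (N * b) = chi 0" by (rule chi_cong) (simp add: cong_def)
  then show ?thesis using chi_mult[of n b] by (simp add: cong_sym)
qed

abbreviation G where "G \<equiv> isdp m n s"
abbreviation S where "S \<equiv> {0..<M} \<times> {0..<N}"

lemma mult_chi: "0 \<le> b \<Longrightarrow> b < N \<Longrightarrow> (a, b) \<otimes>\<^bsub>G\<^esub> (c, d) = ((a + chi b * c) mod M, (b + d) mod N)"
  by (simp add: mult_isdp chi_def)

lemma mod_m_eqI: "[x = y] (mod M) \<Longrightarrow> x mod M = y mod M"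
  by (simp add: cong_def)

lemma mod_in: "x mod M \<in> {0..<M}" "y mod N \<in> {0..<N}"
  using m_pos n_pos by auto

lemma group_isdp: "group G"
proof (rule groupI)
  fix x y z assume "x \<in> carrier G" "y \<in> carrier G" "z \<in> carrier G"
  then obtain a b c d e f where *: "x = (a, b)" "y = (c, d)" "z = (e, f)" "0 \<le> b" "b < N" "0 \<le> d" "d < N"
    by (auto simp: carrier_isdp)
  have "[a + chi b * c + chi (b + d) * e = a + chi b * c + chi b * chi d * e] (mod M)"
    by (intro cong_add cong_mult chi_add cong_refl)
  then have "((a + chi b * c) + chi (b + d) * e) mod M = (a + chi b * (c + chi d * e)) mod M"
    by (simp add: cong_def algebra_simps)
  moreover have "chi ((b + d) mod N) = chi (b + d)" by (rule chi_cong) (simp add: cong_def)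
  ultimately show "x \<otimes>\<^bsub>G\<^esub> y \<otimes>\<^bsub>G\<^esub> z = x \<otimes>\<^bsub>G\<^esub> (y \<otimes>\<^bsub>G\<^esub> z)"
    using * mod_in(2) by (simp add: mult_chi mod_simps mod_nest add.assoc)
next
  fix x assume "x \<in> carrier G"
  then obtain a b where *: "x = (a, b)" "0 \<le> a" "a < M" "0 \<le> b" "b < N" by (auto simp: carrier_isdp)
  show "\<one>\<^bsub>G\<^esub> \<otimes>\<^bsub>G\<^esub> x = x" using * n_pos by (simp add: one_isdp mult_chi)
  have "chi ((-b) mod N) = chi (-b)" by (rule chi_cong) (simp add: cong_def)
  then have "((- chi (- b) * a) mod M, (- b) mod N) \<otimes>\<^bsub>G\<^esub> x = \<one>\<^bsub>G\<^esub>"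
    using * mod_in(2)[of "-b"] by (simp add: mult_chi mod_simps one_isdp)
  then show "\<exists>y\<in>carrier G. y \<otimes>\<^bsub>G\<^esub> x = \<one>\<^bsub>G\<^esub>" using mod_in by (intro bexI) (auto simp: carrier_isdp)
qed (use m_pos n_pos in \<open>auto simp: carrier_isdp one_isdp mult_isdp\<close>)

sublocale G: group G by (rule group_isdp)

lemma pow_fst: "0 \<le> a \<Longrightarrow> a < M \<Longrightarrow> (a, 0) [^]\<^bsub>G\<^esub> (k::nat) = ((int k * a) mod M, 0)"
  by (induction k) (use n_pos in \<open>auto simp: one_isdp mult_chi mod_simps algebra_simps\<close>)

lemma pow_gen:
  assumes "0 \<le> c" "c < M" "0 \<le> j" "j < N"
  shows "(c, j) [^]\<^bsub>G\<^esub> (k::nat) = ((c * gsum k 1 (chi j)) mod M, (int k * j) mod N)"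
proof (induction k)
  case (Suc k)
  have "chi ((int k * j) mod N) = chi (int k * j)" by (rule chi_cong) (simp add: cong_def)
  moreover have "[c * gsum k 1 (chi j) + chi (int k * j) * c = c * gsum k 1 (chi j) + chi j ^ k * c] (mod M)"
    by (intro cong_add cong_mult cong_refl chi_mult)
  then have "(c * gsum k 1 (chi j) + chi (int k * j) * c) mod M = (c * gsum k 1 (chi j) + chi j ^ k * c) mod M"
    by (rule mod_m_eqI)
  ultimately show ?case using Suc mod_in(2)[of "int k * j"]
    by (simp add: mult_chi mod_simps algebra_simps)
qed (simp add: one_isdp)

text \<open>For \<open>s = 1\<close> only the sum of the coefficients \<open>u\<close> and \<open>c\<close> of an affine map matters, so \<open>c\<close> is
  normalised to \<open>0\<close>.\<close>

definition C :: "int set" where "C = (if s = 1 then {0} else {0..<M})"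
text \<open>The factor j acts on the quotient Z/n of \<open>G\<close>. It extends to an automorphism
  only if it respects the action of that quotient on Z/m, which is what chi(j) = s says.\<close>

definition J :: "int set" where "J = {j \<in> {0..<N}. coprime j N \<and> [chi j = int s] (mod M)}"
definition U :: "int set" where "U = {i \<in> {0..<M}. coprime i M}"

text \<open>Here u is left translation by (u, 0), and c is right translation by (c, 0), since (a, b)
  (c, 0) = (a + chi(b) c, b).\<close>

definition T :: "int \<times> int \<times> int \<times> int \<times> int \<Rightarrow> int \<times> int \<Rightarrow> int \<times> int" where
  "T = (\<lambda>(u, i, c, v, j) (a, b). ((u + i * a + c * chi b) mod M, (v + j * b) mod N))"

definition \<Theta> :: "(int \<times> int \<times> int \<times> int \<times> int) set" where
  "\<Theta> = {0..<M} \<times> U \<times> C \<times> {0..<N} \<times> J"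

lemma T_simp: "T (u, i, c, v, j) (a, b) = ((u + i * a + c * chi b) mod M, (v + j * b) mod N)"
  by (simp add: T_def)

lemma T_in: "T \<theta> z \<in> S"
  using mod_in by (cases \<theta>; cases z) (auto simp: T_def)

lemma chi_1: "[chi 1 = int s] (mod M)"
  using chi_of_nat[of 1] by simp

lemma s1_chi: assumes "s = 1" shows "chi b = 1"
  unfolding chi_def using assms by (metis of_nat_1 power_one)

text \<open>If P divided chi(v) - 1, then \<open>s_cases\<close> would make Q a divisor of
  v.\<close>

lemma coprime_chi_minus_one:
  assumes "s \<noteq> 1" "coprime v N"
  shows "coprime (chi v - 1) M"
proof -
  have "\<not> int P dvd chi v - 1"
  proof
    assume "int P dvd chi v - 1"
    then have "[chi v = 1] (mod int P)" by (simp add: cong_iff_dvd_diff)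
    moreover define w where "w = nat (v mod N)"
    moreover have "chi v = int (s ^ w)" by (simp add: chi_def w_def)
    ultimately have "[s ^ w = 1] (mod P)" by (metis cong_int_iff of_nat_1)
    then have "Q dvd w" using assms s_cases by blast
    then have "int Q dvd v mod N" using n_pos by (simp add: w_def int_dvd_int_iff[symmetric])
    then have "int Q dvd v" using Q_dvd_n by (simp add: dvd_mod_iff)
    then show False using assms by (simp add: coprime_n_iff)
  qed
  then show ?thesis by (simp add: coprime_m_iff)
qed

lemma coprime_s_minus_one: "s \<noteq> 1 \<Longrightarrow> coprime (int s - 1) M"
proof -
  assume "s \<noteq> 1"
  then have "coprime (chi 1 - 1) M" by (rule coprime_chi_minus_one) simp
  moreover have "[chi 1 - 1 = int s - 1] (mod M)" by (intro cong_diff chi_1 cong_refl)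
  ultimately show ?thesis by (metis cong_imp_coprime)
qed

lemma chi_J: "j \<in> J \<Longrightarrow> 0 \<le> b \<Longrightarrow> [chi (j * b) = chi b] (mod M)"
proof -
  assume j: "j \<in> J" and b: "0 \<le> b"
  have "[chi (int (nat b) * j) = chi j ^ nat b] (mod M)" by (rule chi_mult)
  also have "[chi j ^ nat b = int s ^ nat b] (mod M)" using j by (intro cong_pow) (auto simp: J_def)
  also have "[int s ^ nat b = chi b] (mod M)" using chi_nonneg[OF b] by (rule cong_sym)
  finally show ?thesis using b by (simp add: mult.commute)
qed

lemma lt_eq_mod_m: "x \<in> {0..<M} \<Longrightarrow> y \<in> {0..<M} \<Longrightarrow> [x = y] (mod M) \<Longrightarrow> x = y"
  by (simp add: cong_def)
lemma lt_eq_mod_n: "x \<in> {0..<N} \<Longrightarrow> y \<in> {0..<N} \<Longrightarrow> [x = y] (mod N) \<Longrightarrow> x = y"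
  by (simp add: cong_def)

text \<open>The values at the identity and at the generators (1, 0), (0, 1) suffice. To separate c
  from u one needs that chi(1) - 1 is a unit, or that c is normalised to 0.\<close>

lemma T_inj:
  assumes \<theta>: "\<theta> \<in> \<Theta>" "\<theta>' \<in> \<Theta>" and eq: "\<And>z. z \<in> S \<Longrightarrow> T \<theta> z = T \<theta>' z"
  shows "\<theta> = \<theta>'"
proof -
  obtain u i c v j u' i' c' v' j' where t: "\<theta> = (u, i, c, v, j)" "\<theta>' = (u', i', c', v', j')"
    by (cases \<theta>; cases \<theta>') auto
  have R: "u \<in> {0..<M}" "i \<in> {0..<M}" "c \<in> {0..<M}" "v \<in> {0..<N}" "j \<in> {0..<N}"
    "u' \<in> {0..<M}" "i' \<in> {0..<M}" "c' \<in> {0..<M}" "v' \<in> {0..<N}" "j' \<in> {0..<N}" "c \<in> C" "c' \<in> C"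
    using \<theta> t m_pos by (auto simp: \<Theta>_def U_def C_def J_def split: if_splits)
  have E: "(0, 0) \<in> S" "(1, 0) \<in> S" "(0, 1) \<in> S" using m_pos n_pos by auto
  have 0: "[u + c = u' + c'] (mod M)" "[v = v'] (mod N)"
    using eq[OF E(1)] by (simp_all add: t T_simp cong_def)
  have 1: "[u + i + c = u' + i' + c'] (mod M)"
    using eq[OF E(2)] by (simp_all add: t T_simp cong_def)
  have 2: "[u + c * chi 1 = u' + c' * chi 1] (mod M)" "[v + j = v' + j'] (mod N)"
    using eq[OF E(3)] by (simp_all add: t T_simp cong_def)
  have v: "v = v'" by (rule lt_eq_mod_n[OF R(4,9) 0(2)])
  have "[j = j'] (mod N)" using 2(2) v by (simp add: cong_add_lcancel)
  then have j: "j = j'" by (rule lt_eq_mod_n[OF R(5,10)])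
  have "[u + i + c - (u + c) = u' + i' + c' - (u' + c')] (mod M)" by (intro cong_diff 0 1)
  then have "[i = i'] (mod M)" by simp
  then have i: "i = i'" by (rule lt_eq_mod_m[OF R(2,7)])
  have c: "c = c'"
  proof (cases "s = 1")
    case True then show ?thesis using R(11,12) unfolding C_def by simp
  next
    case False
    have "[u + c * chi 1 - (u + c) = u' + c' * chi 1 - (u' + c')] (mod M)" by (intro cong_diff 0 2)
    then have "[c * (chi 1 - 1) = c' * (chi 1 - 1)] (mod M)" by (simp add: algebra_simps)
    then have "[c = c'] (mod M)" using coprime_chi_minus_one[OF False, of 1] by (simp add: cong_mult_rcancel)
    then show ?thesis by (rule lt_eq_mod_m[OF R(3,8)])
  qed
  have "[u = u'] (mod M)" using 0(1) c by (simp add: cong_add_rcancel)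
  then have "u = u'" by (rule lt_eq_mod_m[OF R(1,6)])
  then show ?thesis using t v j i c by simp
qed

lemma T_inj_on:
  assumes \<theta>: "\<theta> \<in> \<Theta>" shows "inj_on (T \<theta>) S"
proof (rule inj_onI)
  fix z z' assume z: "z \<in> S" "z' \<in> S" and e: "T \<theta> z = T \<theta> z'"
  obtain u i c v j where t: "\<theta> = (u, i, c, v, j)" by (cases \<theta>) auto
  obtain a b a' b' where ab: "z = (a, b)" "z' = (a', b')" by (cases z; cases z') auto
  have "[v + j * b = v + j * b'] (mod N)" using e by (simp add: t ab T_simp cong_def)
  then have "[b = b'] (mod N)" using \<theta> by (auto simp: t \<Theta>_def J_def cong_add_lcancel cong_mult_lcancel)
  then have b: "b = b'" using z ab by (intro lt_eq_mod_n) auto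
  have "[u + i * a + c * chi b = u + i * a' + c * chi b] (mod M)" using e b by (simp add: t ab T_simp cong_def)
  then have "[a = a'] (mod M)" using \<theta> by (auto simp: t \<Theta>_def U_def cong_add_lcancel cong_add_rcancel cong_mult_lcancel)
  then have "a = a'" using z ab by (intro lt_eq_mod_m) auto
  then show "z = z'" using ab b by simp
qed

lemma T_bij: "\<theta> \<in> \<Theta> \<Longrightarrow> bij_betw (T \<theta>) S S"
  using T_inj_on[of \<theta>] T_in[of \<theta>] unfolding bij_betw_def by (metis endo_inj_surj finite_SigmaI finite_atLeastLessThan_int image_subsetI)

text \<open>As (0, 0) is sent to (u + c, v), these are the parameters of the affine maps that fix
  the identity.\<close>

definition \<Theta>0 :: "(int \<times> int \<times> int \<times> int \<times> int) set" where
  "\<Theta>0 = {(u, i, c, v, j) \<in> \<Theta>. [u + c = 0] (mod M) \<and> v = 0}"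

lemma T_auto:
  assumes "\<theta> \<in> \<Theta>0" shows "restrict (T \<theta>) S \<in> auto G"
proof -
  obtain u i c j where t: "\<theta> = (u, i, c, 0, j)" and uc: "[u + c = 0] (mod M)" and \<theta>: "\<theta> \<in> \<Theta>" using assms by (auto simp: \<Theta>0_def)
  then have j: "j \<in> J" by (auto simp: \<Theta>_def)
  have "T \<theta> (x \<otimes>\<^bsub>G\<^esub> y) = T \<theta> x \<otimes>\<^bsub>G\<^esub> T \<theta> y" if xy: "x \<in> S" "y \<in> S" for x y
  proof -
    obtain a b d e where ab: "x = (a, b)" "y = (d, e)" "0 \<le> b" "b < N" "0 \<le> e" "e < N" using xy by auto
    have ce: "chi ((b + e) mod N) = chi (b + e)" "chi ((j * b) mod N) = chi (j * b)" by (auto intro!: chi_cong simp: cong_def)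
    have "[u + i * (a + chi b * d) + c * chi (b + e) = u + i * (a + chi b * d) + c * (chi b * chi e)] (mod M)"
      by (intro cong_add cong_mult cong_refl chi_add)
    \<comment> \<open>The added multiple of u + c vanishes and supplies what is missing for the
      factor \<open>chi b\<close> to come out.\<close>
    also have "[u + i * (a + chi b * d) + c * (chi b * chi e) =
       u + i * (a + chi b * d) + c * (chi b * chi e) + (u + c) * chi b] (mod M)"
      using cong_add[OF cong_refl[of "u + i * (a + chi b * d) + c * (chi b * chi e)"] cong_scalar_right[OF uc, of "chi b"]] by (simp add: cong_sym)
    also have "u + i * (a + chi b * d) + c * (chi b * chi e) + (u + c) * chi b
       = (u + i * a + c * chi b) + chi b * (u + i * d + c * chi e)" by (simp add: algebra_simps)
    also have "[\<dots> = (u + i * a + c * chi b) + chi (j * b) * (u + i * d + c * chi e)] (mod M)"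
      using chi_J[OF j ab(3)] by (intro cong_add cong_mult cong_refl) (rule cong_sym)
    finally have *: "(u + i * (a + chi b * d) + c * chi (b + e)) mod M =
      ((u + i * a + c * chi b) + chi (j * b) * (u + i * d + c * chi e)) mod M" by (rule mod_m_eqI)
    have "T \<theta> (x \<otimes>\<^bsub>G\<^esub> y) = ((u + i * (a + chi b * d) + c * chi (b + e)) mod M, (j * (b + e)) mod N)"
      using ab by (simp add: t T_simp mult_chi ce mod_simps mod_nest)
    moreover have "T \<theta> x \<otimes>\<^bsub>G\<^esub> T \<theta> y = (((u + i * a + c * chi b) + chi (j * b) * (u + i * d + c * chi e)) mod M, (j * (b + e)) mod N)"
      using ab mod_in(2)[of "j * b"] by (simp add: t T_simp mult_chi ce mod_simps mod_nest distrib_left)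
    ultimately show ?thesis using * by simp
  qed
  then have "restrict (T \<theta>) S \<in> hom G G" using T_in G.m_closed by (auto simp: hom_def carrier_isdp)
  moreover have "restrict (T \<theta>) S \<in> Bij S" using T_bij[OF \<theta>] by (simp add: Bij_def)
  ultimately show ?thesis by (simp add: auto_def carrier_isdp)
qed

text \<open>An automorphism is determined by the images of (1, 0) and (0, 1); the relations between
  these generators force the images into the shape that \<open>\<Theta>0\<close> prescribes.\<close>

lemma auto_obtains_T:
  assumes a: "\<alpha> \<in> auto G"
  obtains \<theta> where "\<theta> \<in> \<Theta>0" "\<alpha> = restrict (T \<theta>) S"
proof -
  have ab: "bij_betw \<alpha> S S" and acl: "\<And>x. x \<in> S \<Longrightarrow> \<alpha> x \<in> S"
    and am: "\<And>x y. x \<in> S \<Longrightarrow> y \<in> S \<Longrightarrow> \<alpha> (x \<otimes>\<^bsub>G\<^esub> y) = \<alpha> x \<otimes>\<^bsub>G\<^esub> \<alpha> y"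
    and ae: "\<alpha> \<in> extensional S"
    using autoD[OF a] by (simp_all add: carrier_isdp)
  have E: "(1, 0) \<in> S" "(0, 1) \<in> S" using m_pos n_pos by auto
  obtain i b0 where ib: "\<alpha> (1, 0) = (i, b0)" "0 \<le> i" "i < M" "0 \<le> b0" "b0 < N" using acl[OF E(1)] by auto
  obtain c0 j where cj: "\<alpha> (0, 1) = (c0, j)" "0 \<le> c0" "c0 < M" "0 \<le> j" "j < N" using acl[OF E(2)] by auto
  have ap: "\<alpha> (x [^]\<^bsub>G\<^esub> (k::nat)) = \<alpha> x [^]\<^bsub>G\<^esub> k" if "x \<in> S" for x k
    using G.auto_pow[OF a] that by (simp add: carrier_isdp)
  \<comment> \<open>The image of (1, 0) is killed by m, which is prime to n, so its second
    coordinate vanishes.\<close>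
  have "(1, 0) [^]\<^bsub>G\<^esub> m = \<one>\<^bsub>G\<^esub>" using pow_fst[of 1 m] m_pos by (simp add: one_isdp)
  then have "(i, b0) [^]\<^bsub>G\<^esub> m = \<one>\<^bsub>G\<^esub>" using ap[OF E(1), of m] ib G.auto_one[OF a] by simp
  then have "N dvd M * b0" using ib by (simp add: pow_gen one_isdp mod_eq_0_iff_dvd)
  then have "N dvd b0" using coprime_nm by (simp add: coprime_dvd_mult_right_iff)
  then have b0: "b0 = 0" using ib(4,5) zdvd_not_zless[of b0 N] by fastforce
  have a1: "\<alpha> (a, 0) = ((i * a) mod M, 0)" if "0 \<le> a" "a < M" for a
    using ap[OF E(1), of "nat a"] that ib b0 pow_fst[of 1 "nat a"] pow_fst[of i "nat a"] m_pos
    by (simp add: mult.commute)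
  have a2: "\<alpha> (0, b) = ((c0 * gsum (nat b) 1 (chi j)) mod M, (j * b) mod N)" if "0 \<le> b" "b < N" for b
    using ap[OF E(2), of "nat b"] that cj pow_gen[of 0 1 "nat b"] pow_gen[of c0 j "nat b"] m_pos n_pos
    by (simp add: mult.commute)
  have a3: "\<alpha> (a, b) = ((i * a + c0 * gsum (nat b) 1 (chi j)) mod M, (j * b) mod N)"
    if "0 \<le> a" "a < M" "0 \<le> b" "b < N" for a b
  proof -
    have "(a, b) = (a, 0) \<otimes>\<^bsub>G\<^esub> (0, b)" using that n_pos by (simp add: mult_chi)
    then have "\<alpha> (a, b) = ((i * a) mod M, 0) \<otimes>\<^bsub>G\<^esub> ((c0 * gsum (nat b) 1 (chi j)) mod M, (j * b) mod N)"
      using that m_pos n_pos am[of "(a, 0)" "(0, b)"] by (simp add: a1 a2)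
    then show ?thesis using n_pos by (simp add: mult_chi mod_simps)
  qed
  have surj: "\<exists>x\<in>S. \<alpha> x = y" if "y \<in> S" for y
  proof -
    have "y \<in> \<alpha> ` S" using that by (simp only: bij_betw_imp_surj_on[OF ab])
    then obtain x where "y = \<alpha> x" "x \<in> S" by (rule imageE)
    then show ?thesis by (intro bexI[of _ x]) simp_all
  qed
  \<comment> \<open>Preimages of the two generators provide inverses of j and of i.\<close>
  obtain a b where ab1: "(a, b) \<in> S" "\<alpha> (a, b) = (0, 1)" using surj[OF E(2)] by auto
  then have "[j * b = 1] (mod N)" using n_pos by (auto simp: a3 cong_def)
  then have cop_j: "coprime j N" by (metis coprime_iff_invertible_int)
  obtain a b where ab1: "(a, b) \<in> S" "\<alpha> (a, b) = (1, 0)" using surj[OF E(1)] by auto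
  then have "N dvd j * b" by (auto simp: a3)
  then have "N dvd b" using cop_j by (simp add: coprime_dvd_mult_right_iff coprime_commute)
  then have "b = 0" using ab1(1) zdvd_not_zless[of b N] by fastforce
  then have "[i * a = 1] (mod M)" using ab1 m_pos by (auto simp: a1 cong_def)
  then have cop_i: "coprime i M" by (metis coprime_iff_invertible_int)
  have chj: "[chi j = int s] (mod M)"
  proof -
    \<comment> \<open>The relation y x = x^s y between the generators has to survive.\<close>
    have "(0, 1) \<otimes>\<^bsub>G\<^esub> (1, 0) = ((chi 1) mod M, 0) \<otimes>\<^bsub>G\<^esub> (0, 1)" using m_pos n_pos by (simp add: mult_chi)
    then have "\<alpha> (0, 1) \<otimes>\<^bsub>G\<^esub> \<alpha> (1, 0) = \<alpha> ((chi 1) mod M, 0) \<otimes>\<^bsub>G\<^esub> \<alpha> (0, 1)"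
      using am[OF E(2,1)] am[of "((chi 1) mod M, 0)" "(0, 1)"] E mod_in(1) n_pos by simp
    then have "(c0 + chi j * i) mod M = (i * chi 1 + c0) mod M"
      using cj ib b0 n_pos mod_in by (simp add: a1 mult_chi mod_simps)
    then have "[chi j * i = chi 1 * i] (mod M)" by (simp add: cong_def[symmetric] add.commute[of c0] cong_add_rcancel mult.commute)
    then have "[chi j = chi 1] (mod M)" using cop_i by (simp add: cong_mult_rcancel)
    then show ?thesis using chi_1 cong_trans by blast
  qed
  have gj: "[gsum k 1 (chi j) = gsum k 1 (int s)] (mod M)" for k by (intro gsum_cong chj cong_refl)
  \<comment> \<open>For s different from 1 this is c0 / (s - 1), so that c0 (1 + s + ... + s^(b-1))
    = c s^b - c. For s = 1 the image (c0, j) is killed by n, which forces c0 = 0.\<close>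
  define c where "c = (if s = 1 then 0 else (c0 * (SOME y. [(int s - 1) * y = 1] (mod M))) mod M)"
  have cC: "c \<in> C" using mod_in(1) by (auto simp: c_def C_def)
  have key: "[c0 * gsum (nat b) 1 (chi j) = - c + c * chi b] (mod M)" if b: "0 \<le> b" for b
  proof (cases "s = 1")
    case True
    have "(0, 1) [^]\<^bsub>G\<^esub> n = \<one>\<^bsub>G\<^esub>" using pow_gen[of 0 1 n] m_pos n_pos by (simp add: one_isdp)
    then have "(c0, j) [^]\<^bsub>G\<^esub> n = \<one>\<^bsub>G\<^esub>" using ap[OF E(2), of n] cj G.auto_one[OF a] by simp
    then have "M dvd c0 * N" using cj by (simp add: pow_gen one_isdp mod_eq_0_iff_dvd s1_chi[OF True])
    then have "M dvd c0" using coprime_nm by (simp add: coprime_dvd_mult_left_iff coprime_commute)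
    then have "c0 = 0" using cj(2,3) zdvd_not_zless[of c0 M] by fastforce
    moreover have "c = 0" using True unfolding c_def by simp
    ultimately show ?thesis by simp
  next
    case False
    define y where "y = (SOME y. [(int s - 1) * y = 1] (mod M))"
    have y: "[(int s - 1) * y = 1] (mod M)"
      unfolding y_def using coprime_s_minus_one[OF False] by (metis (mono_tags, lifting) coprime_iff_invertible_int someI_ex)
    have "[c = c0 * y] (mod M)" using False unfolding c_def y_def by simp
    then have "[- c + c * chi b = - (c0 * y) + (c0 * y) * int s ^ nat b] (mod M)"
      using chi_nonneg[OF b] by (intro cong_add cong_mult) (auto simp: cong_minus_minus_iff)
    also have "- (c0 * y) + (c0 * y) * int s ^ nat b = (c0 * gsum (nat b) 1 (int s)) * ((int s - 1) * y)"
    proof -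
      have "(c0 * gsum (nat b) 1 (int s)) * ((int s - 1) * y) = - (c0 * y) * ((1 - int s) * gsum (nat b) 1 (int s))"
        by (simp add: algebra_simps)
      then show ?thesis unfolding gsum_mult by (simp add: algebra_simps)
    qed
    also have "[\<dots> = (c0 * gsum (nat b) 1 (int s)) * 1] (mod M)" by (intro cong_mult y cong_refl)
    also have "[(c0 * gsum (nat b) 1 (int s)) * 1 = c0 * gsum (nat b) 1 (chi j)] (mod M)"
      using cong_sym[OF gj] by (simp add: cong_scalar_left)
    finally show ?thesis by (rule cong_sym)
  qed
  have "\<alpha> = restrict (T ((- c) mod M, i, c, 0, j)) S"
  proof (rule extensionalityI[OF ae])
    fix x assume "x \<in> S"
    then obtain a b where x: "x = (a, b)" "0 \<le> a" "a < M" "0 \<le> b" "b < N" by auto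
    have "[i * a + c0 * gsum (nat b) 1 (chi j) = i * a + (- c + c * chi b)] (mod M)"
      by (intro cong_add key cong_refl x)
    also have "i * a + (- c + c * chi b) = - c + i * a + c * chi b" by simp
    also have "[\<dots> = (- c) mod M + i * a + c * chi b] (mod M)"
      by (intro cong_add cong_refl) simp
    finally show "\<alpha> x = restrict (T ((- c) mod M, i, c, 0, j)) S x"
      using x by (simp add: a3 T_simp cong_def)
  qed simp
  moreover have "((- c) mod M, i, c, 0, j) \<in> \<Theta>0"
    using mod_in cC ib cj cop_i cop_j chj n_pos by (auto simp: \<Theta>0_def \<Theta>_def U_def J_def cong_def mod_simps)
  ultimately show ?thesis using that by blast
qed

lemma auto_eq: "auto G = (\<lambda>\<theta>. restrict (T \<theta>) S) ` \<Theta>0"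
  using T_auto auto_obtains_T by blast

lemma card_auto_\<Theta>0: "card (auto G) = card \<Theta>0"
proof -
  have "inj_on (\<lambda>\<theta>. restrict (T \<theta>) S) \<Theta>0"
  proof (rule inj_onI)
    fix \<theta> \<theta>' assume "\<theta> \<in> \<Theta>0" "\<theta>' \<in> \<Theta>0" and e: "restrict (T \<theta>) S = restrict (T \<theta>') S"
    moreover have "T \<theta> z = T \<theta>' z" if "z \<in> S" for z
      using fun_cong[OF e, of z] that by simp
    ultimately show "\<theta> = \<theta>'"
      by (intro T_inj) (auto simp: \<Theta>0_def)
  qed
  then show ?thesis by (simp add: auto_eq card_image)
qed

lemma finite_sets: "finite C" "finite J" "finite U"
  by (auto simp: C_def J_def U_def intro: finite_subset[of _ "{0..<N}"] finite_subset[of _ "{0..<M}"])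

lemma card_auto: "card (auto G) = card C * card U * card J"
proof -
  have "bij_betw (\<lambda>(c, i, j). ((- c) mod M, i, c, 0, j)) (C \<times> U \<times> J) \<Theta>0"
  proof (rule bij_betwI[where g="\<lambda>(u, i, c, v, j). (c, i, j)"])
    show "(\<lambda>(c, i, j). ((- c) mod M, i, c, 0, j)) \<in> C \<times> U \<times> J \<rightarrow> \<Theta>0"
      using mod_in n_pos by (auto simp: \<Theta>0_def \<Theta>_def cong_def mod_simps)
    fix x assume "x \<in> \<Theta>0"
    then obtain u i c j where x: "x = (u, i, c, 0, j)" "[u + c = 0] (mod M)" "u \<in> {0..<M}" by (auto simp: \<Theta>0_def \<Theta>_def)
    then have "[u = - c] (mod M)" by (metis add.right_inverse cong_add_rcancel add.left_inverse)
    then have "(- c) mod M = u" using x by (simp add: cong_def)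
    then show "(case (case x of (u, i, c, v, j) \<Rightarrow> (c, i, j)) of (c, i, j) \<Rightarrow> ((- c) mod M, i, c, 0, j)) = x"
      using x by simp
  qed (auto simp: \<Theta>0_def \<Theta>_def)
  then show ?thesis unfolding card_auto_\<Theta>0 by (simp add: bij_betw_same_card[symmetric] card_cartesian_product)
qed

text \<open>Left multiplication by (t1, t2) scales u, i and c by \<open>chi t2\<close> and then
  shifts u. With \<open>T_decomp\<close> this identifies the maps \<open>T \<theta>\<close> with the
  holomorph of \<open>G\<close>.\<close>

lemma T_translation:
  assumes t: "t \<in> S" and a: "\<alpha> \<in> auto G"
  shows "\<exists>\<theta>\<in>\<Theta>. \<forall>w\<in>S. t \<otimes>\<^bsub>G\<^esub> \<alpha> w = T \<theta> w"
proof -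
  obtain \<theta> where \<theta>: "\<theta> \<in> \<Theta>0" "\<alpha> = restrict (T \<theta>) S" using auto_obtains_T[OF a] .
  obtain u i c j where th: "\<theta> = (u, i, c, 0, j)" and "\<theta> \<in> \<Theta>" using \<theta> by (auto simp: \<Theta>0_def)
  obtain t1 t2 where tt: "t = (t1, t2)" "0 \<le> t2" "t2 < N" using t by auto
  let ?th = "((t1 + chi t2 * u) mod M, (chi t2 * i) mod M, (chi t2 * c) mod M, t2, j)"
  have "?th \<in> \<Theta>" using mod_in \<open>\<theta> \<in> \<Theta>\<close> tt coprime_chi by (auto simp: th \<Theta>_def C_def U_def split: if_splits)
  moreover have "t \<otimes>\<^bsub>G\<^esub> \<alpha> w = T ?th w" if "w \<in> S" for w
  proof -
    obtain a b where w: "w = (a, b)" by (cases w)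
    show ?thesis using that tt by (simp add: w \<theta> th T_simp mult_chi mod_simps mod_nest)
        (simp add: algebra_simps)
  qed
  ultimately show ?thesis by blast
qed

lemma T_decomp:
  assumes "\<theta> \<in> \<Theta>"
  shows "\<exists>\<alpha>\<in>auto G. \<forall>w\<in>S. T \<theta> w = T \<theta> (0, 0) \<otimes>\<^bsub>G\<^esub> \<alpha> w"
proof -
  obtain u i c v j where th: "\<theta> = (u, i, c, v, j)" by (cases \<theta>)
  \<comment> \<open>Removing the translation by (u + c, v) divides the coefficients by chi(v);
    fixing the identity then forces the first one to be minus the third.\<close>
  let ?th = "((- (chi (- v) * c)) mod M, (chi (- v) * i) mod M, (chi (- v) * c) mod M, 0, j)"
  have v: "0 \<le> v" "v < N" using assms by (auto simp: th \<Theta>_def)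
  have "?th \<in> \<Theta>0" using mod_in assms n_pos coprime_chi by (auto simp: th \<Theta>0_def \<Theta>_def C_def U_def cong_def mod_simps split: if_splits)
  then have "restrict (T ?th) S \<in> auto G" by (rule T_auto)
  moreover have "T \<theta> w = T \<theta> (0, 0) \<otimes>\<^bsub>G\<^esub> restrict (T ?th) S w" if wS: "w \<in> S" for w
  proof -
    obtain a b where w: "w = (a, b)" by (cases w)
    have "[u + c + (chi v * chi (- v)) * (- c + i * a + c * chi b) = u + c + 1 * (- c + i * a + c * chi b)] (mod M)"
      by (intro cong_add cong_mult cong_refl chi_minus)
    then have "(u + i * a + c * chi b) mod M = (u + c + chi v * (- (chi (- v) * c) + chi (- v) * i * a + chi (- v) * c * chi b)) mod M"
      by (simp add: cong_def algebra_simps)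
    then show ?thesis using wS v by (simp add: w th T_simp mult_chi mod_simps mod_nest)
  qed
  ultimately show ?thesis by blast
qed

end

section \<open>Regular maps as pairs of affine maps\<close>

lemma funpow_in: "(\<And>z. z \<in> A \<Longrightarrow> f z \<in> A) \<Longrightarrow> z \<in> A \<Longrightarrow> (f ^^ k) z \<in> A"
  by (induction k) auto

lemma funpow_mod_on:
  assumes cl: "\<And>z. z \<in> A \<Longrightarrow> f z \<in> A" and per: "\<And>z. z \<in> A \<Longrightarrow> (f ^^ m) z = z" and z: "z \<in> A"
  shows "(f ^^ (k mod m)) z = (f ^^ k) z"
proof -
  have p: "(f ^^ (m * q)) z = z" for q
  proof (induction q)
    case (Suc q)
    have "(f ^^ (m * Suc q)) z = (f ^^ m) ((f ^^ (m * q)) z)" by (simp add: funpow_add)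
    then show ?case using Suc per z by simp
  qed simp
  have "(f ^^ k) z = (f ^^ (k mod m + m * (k div m))) z" by simp
  also have "\<dots> = (f ^^ (k mod m)) ((f ^^ (m * (k div m))) z)" by (simp only: funpow_add comp_apply)
  finally show ?thesis using p by simp
qed

context sd_data
begin

text \<open>The identity t \<alpha>(t' \<beta>(w)) = (t \<alpha>(t')) \<alpha>(\<beta>(w)) gives
  closure without computing the parameters of the composite.\<close>

lemma T_comp:
  assumes "\<theta> \<in> \<Theta>" "\<theta>' \<in> \<Theta>"
  shows "\<exists>\<theta>''\<in>\<Theta>. \<forall>w\<in>S. T \<theta> (T \<theta>' w) = T \<theta>'' w"
proof -
  let ?t = "T \<theta> (0, 0)" and ?t' = "T \<theta>' (0, 0)"
  obtain \<alpha> where a: "\<alpha> \<in> auto G" "\<And>w. w \<in> S \<Longrightarrow> T \<theta> w = ?t \<otimes>\<^bsub>G\<^esub> \<alpha> w" using T_decomp[OF assms(1)] by blast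
  obtain \<beta> where b: "\<beta> \<in> auto G" "\<And>w. w \<in> S \<Longrightarrow> T \<theta>' w = ?t' \<otimes>\<^bsub>G\<^esub> \<beta> w" using T_decomp[OF assms(2)] by blast
  have t: "?t \<in> carrier G" "?t' \<in> carrier G" using T_in by (auto simp only: carrier_isdp)
  have ab: "compose S \<alpha> \<beta> \<in> auto G" using auto_compose[OF a(1) b(1) group_isdp] by (simp add: carrier_isdp)
  have tS: "?t \<otimes>\<^bsub>G\<^esub> \<alpha> ?t' \<in> S" using t autoD(3)[OF a(1) t(2)] G.m_closed by (simp add: carrier_isdp)
  obtain \<theta>'' where th: "\<theta>'' \<in> \<Theta>" "\<And>w. w \<in> S \<Longrightarrow> (?t \<otimes>\<^bsub>G\<^esub> \<alpha> ?t') \<otimes>\<^bsub>G\<^esub> compose S \<alpha> \<beta> w = T \<theta>'' w"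
    using T_translation[OF tS ab] by blast
  have "T \<theta> (T \<theta>' w) = T \<theta>'' w" if w: "w \<in> S" for w
  proof -
    have wc: "w \<in> carrier G" using w by (simp only: carrier_isdp)
    have bw: "\<beta> w \<in> carrier G" using autoD(3)[OF b(1) wc] .
    have "T \<theta> (T \<theta>' w) = ?t \<otimes>\<^bsub>G\<^esub> \<alpha> (T \<theta>' w)" by (rule a(2)[OF T_in])
    also have "\<dots> = ?t \<otimes>\<^bsub>G\<^esub> (\<alpha> ?t' \<otimes>\<^bsub>G\<^esub> \<alpha> (\<beta> w))" using b(2)[OF w] autoD(4)[OF a(1) t(2) bw] by simp
    also have "\<dots> = ?t \<otimes>\<^bsub>G\<^esub> \<alpha> ?t' \<otimes>\<^bsub>G\<^esub> compose S \<alpha> \<beta> w"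
      using w t autoD(3)[OF a(1) t(2)] autoD(3)[OF a(1) bw] by (simp add: G.m_assoc compose_def)
    finally show ?thesis using th(2)[OF w] by simp
  qed
  then show ?thesis using th(1) by blast
qed

lemma id_in_\<Theta>: "(0, 1, 0, 0, 1) \<in> \<Theta>"
  using m_pos n_pos chi_1 by (auto simp: \<Theta>_def U_def C_def J_def)

lemma T_funpow:
  assumes "\<theta> \<in> \<Theta>"
  shows "\<exists>\<theta>''\<in>\<Theta>. \<forall>w\<in>S. (T \<theta> ^^ k) w = T \<theta>'' w"
proof (induction k)
  case 0
  show ?case by (rule bexI[OF _ id_in_\<Theta>]) (simp add: T_simp )
next
  case (Suc k)
  then obtain \<theta>' where "\<theta>' \<in> \<Theta>" "\<And>w. w \<in> S \<Longrightarrow> (T \<theta> ^^ k) w = T \<theta>' w" by blast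
  then show ?case using T_comp[OF assms, of \<theta>'] by auto
qed

end

text \<open>The parameter s belongs to \<open>G\<close>, the type of the structure, and r to the
  Galois group; the two groups share P, Q, m and n.\<close>

locale sd_pair = sd_data P Q m n s + B: sd_data P Q m n r for P Q m n s r
begin

text \<open>In the group with parameter r the element (a, b) is (1, 0)^a (0, 1)^b. If the generators
  act by X and Y, this is the orbit of the identity of \<open>G\<close>.\<close>

definition orbit_map :: "int \<times> int \<times> int \<times> int \<times> int \<Rightarrow> int \<times> int \<times> int \<times> int \<times> int \<Rightarrow> int \<times> int \<Rightarrow> int \<times> int" where
  "orbit_map \<theta> \<theta>' = (\<lambda>(a, b). (T \<theta> ^^ nat a) ((T \<theta>' ^^ nat b) (0, 0)))"

text \<open>The first three conditions are the presentation x^m = y^n = 1, y x = x^r y of the Galois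
  group; the last one is regularity, since both groups have the same finite order.\<close>

definition pairs where
  "pairs = {(\<theta>, \<theta>') \<in> \<Theta> \<times> \<Theta>. (\<forall>z\<in>S. (T \<theta> ^^ m) z = z) \<and> (\<forall>z\<in>S. (T \<theta>' ^^ n) z = z) \<and>
     (\<forall>z\<in>S. T \<theta>' (T \<theta> z) = (T \<theta> ^^ r) (T \<theta>' z)) \<and> inj_on (orbit_map \<theta> \<theta>') S}"

lemma Tp_in: "z \<in> S \<Longrightarrow> (T \<theta> ^^ k) z \<in> S"
  by (rule funpow_in[OF T_in])

lemma zero_in: "(0, 0) \<in> S" using m_pos n_pos by auto

lemma orbit_map_in: "orbit_map \<theta> \<theta>' w \<in> S"
  unfolding orbit_map_def split_beta by (intro Tp_in zero_in)

context
  fixes \<theta> \<theta>' assumes pr: "(\<theta>, \<theta>') \<in> pairs"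
begin

lemma pr: "\<theta> \<in> \<Theta>" "\<theta>' \<in> \<Theta>" "z \<in> S \<Longrightarrow> (T \<theta> ^^ m) z = z" "z \<in> S \<Longrightarrow> (T \<theta>' ^^ n) z = z"
  "z \<in> S \<Longrightarrow> T \<theta>' (T \<theta> z) = (T \<theta> ^^ r) (T \<theta>' z)" "inj_on (orbit_map \<theta> \<theta>') S"
  using pr unfolding pairs_def by blast+

lemma pairs_comm: "z \<in> S \<Longrightarrow> T \<theta>' ((T \<theta> ^^ c) z) = (T \<theta> ^^ (r * c)) (T \<theta>' z)"
proof (induction c)
  case (Suc c)
  then show ?case using pr(5)[OF Tp_in[OF Suc.prems, where \<theta>=\<theta> and k=c]] by (simp add: funpow_add)
qed simp

lemma pairs_comm_power: "z \<in> S \<Longrightarrow> (T \<theta>' ^^ b) ((T \<theta> ^^ c) z) = (T \<theta> ^^ (r ^ b * c)) ((T \<theta>' ^^ b) z)"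
proof (induction b)
  case (Suc b)
  then show ?case using pairs_comm[OF Tp_in[OF Suc.prems, where \<theta>=\<theta>' and k=b], of "r ^ b * c"] by (simp add: mult.assoc)
qed simp

text \<open>Periodicity of X and Y reduces the exponents modulo m and n, and the commutation
  relation moves powers of Y past powers of X.\<close>

lemma orbit_map_mult:
  assumes "w \<in> S" "0 \<le> a" "0 \<le> b"
  shows "orbit_map \<theta> \<theta>' ((a, b) \<otimes>\<^bsub>B.G\<^esub> w) = (T \<theta> ^^ nat a) ((T \<theta>' ^^ nat b) (orbit_map \<theta> \<theta>' w))"
proof -
  obtain c d where w: "w = (c, d)" "0 \<le> c" "0 \<le> d" using assms by auto
  let ?z = "(T \<theta>' ^^ nat d) (0, 0)"
  have "nat ((a + int r ^ nat b * c) mod M) = (nat a + r ^ nat b * nat c) mod m"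
    using assms w by (simp add: nat_mod_distrib nat_add_distrib nat_mult_distrib nat_power_eq)
  moreover have "nat ((b + d) mod N) = (nat b + nat d) mod n" using assms w by (simp add: nat_mod_distrib nat_add_distrib)
  ultimately have "orbit_map \<theta> \<theta>' ((a, b) \<otimes>\<^bsub>B.G\<^esub> w) =
    (T \<theta> ^^ ((nat a + r ^ nat b * nat c) mod m)) ((T \<theta>' ^^ ((nat b + nat d) mod n)) (0, 0))"
    by (simp add: w mult_isdp orbit_map_def)
  also have "\<dots> = (T \<theta> ^^ (nat a + r ^ nat b * nat c)) ((T \<theta>' ^^ (nat b + nat d)) (0, 0))"
    using funpow_mod_on[of S "T \<theta>", OF T_in pr(3) Tp_in[OF zero_in]] funpow_mod_on[of S "T \<theta>'", OF T_in pr(4) zero_in] by simp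
  also have "\<dots> = (T \<theta> ^^ nat a) ((T \<theta> ^^ (r ^ nat b * nat c)) ((T \<theta>' ^^ nat b) ?z))" by (simp add: funpow_add)
  also have "\<dots> = (T \<theta> ^^ nat a) ((T \<theta>' ^^ nat b) ((T \<theta> ^^ nat c) ?z))"
    using pairs_comm_power[OF Tp_in[OF zero_in, where \<theta>=\<theta>' and k="nat d"]] by simp
  finally show ?thesis by (simp add: w orbit_map_def)
qed

text \<open>An element (a, b) acts as X^a Y^b, which is again affine; \<open>T_decomp\<close> splits
  it into a translation and the automorphism required of a crossed homomorphism.\<close>

lemma orbit_map_left_hgs: "restrict (orbit_map \<theta> \<theta>') S \<in> left_hgs_maps B.G G"
proof -
  have "bij_betw (orbit_map \<theta> \<theta>') S S"
    unfolding bij_betw_def using pr(6) orbit_map_in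
    by (metis endo_inj_surj finite_SigmaI finite_atLeastLessThan_int image_subsetI)
  moreover have "\<exists>\<alpha>\<in>auto G. \<forall>x\<in>S. orbit_map \<theta> \<theta>' (g \<otimes>\<^bsub>B.G\<^esub> x) = orbit_map \<theta> \<theta>' g \<otimes>\<^bsub>G\<^esub> \<alpha> (orbit_map \<theta> \<theta>' x)" if g: "g \<in> S" for g
  proof -
    obtain a b where ab: "g = (a, b)" "0 \<le> a" "0 \<le> b" using g by auto
    obtain \<theta>1 where t1: "\<theta>1 \<in> \<Theta>" "\<And>w. w \<in> S \<Longrightarrow> (T \<theta> ^^ nat a) w = T \<theta>1 w" using T_funpow[OF pr(1)] by blast
    obtain \<theta>2 where t2: "\<theta>2 \<in> \<Theta>" "\<And>w. w \<in> S \<Longrightarrow> (T \<theta>' ^^ nat b) w = T \<theta>2 w" using T_funpow[OF pr(2)] by blast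
    obtain \<theta>3 where t3: "\<theta>3 \<in> \<Theta>" "\<And>w. w \<in> S \<Longrightarrow> T \<theta>1 (T \<theta>2 w) = T \<theta>3 w" using T_comp[OF t1(1) t2(1)] by blast
    have 3: "(T \<theta> ^^ nat a) ((T \<theta>' ^^ nat b) w) = T \<theta>3 w" if "w \<in> S" for w
      using that t1(2)[OF T_in] t2(2)[OF that] t3(2)[OF that] by simp
    obtain \<alpha> where a: "\<alpha> \<in> auto G" "\<And>w. w \<in> S \<Longrightarrow> T \<theta>3 w = T \<theta>3 (0, 0) \<otimes>\<^bsub>G\<^esub> \<alpha> w" using T_decomp[OF t3(1)] by blast
    have "orbit_map \<theta> \<theta>' (g \<otimes>\<^bsub>B.G\<^esub> x) = T \<theta>3 (orbit_map \<theta> \<theta>' x)" if "x \<in> S" for x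
      using orbit_map_mult[OF that ab(2,3)] 3[OF orbit_map_in] by (simp add: ab)
    moreover have "orbit_map \<theta> \<theta>' g = T \<theta>3 (0, 0)" using 3[OF zero_in] by (simp add: ab orbit_map_def)
    ultimately show ?thesis using a orbit_map_in by metis
  qed
  moreover have "g \<otimes>\<^bsub>B.G\<^esub> x \<in> S" if "g \<in> S" "x \<in> S" for g x
    using B.G.m_closed that by (simp only: carrier_isdp)
  ultimately show ?thesis unfolding left_hgs_maps_def by (simp add: carrier_isdp)
qed

end

text \<open>Through the orbit map, multiplication by the generators becomes X and Y. As the map is
  onto, it determines both of them everywhere.\<close>

lemma pairs_inj:
  assumes p: "(\<theta>, \<theta>') \<in> pairs" "(\<eta>, \<eta>') \<in> pairs"
    and e: "restrict (orbit_map \<theta> \<theta>') S = restrict (orbit_map \<eta> \<eta>') S"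
  shows "\<theta> = \<eta> \<and> \<theta>' = \<eta>'"
proof -
  have eq: "orbit_map \<theta> \<theta>' w = orbit_map \<eta> \<eta>' w" if "w \<in> S" for w using fun_cong[OF e, of w] that by simp
  have surj: "\<exists>w\<in>S. z = orbit_map \<theta> \<theta>' w" if "z \<in> S" for z
  proof -
    have "orbit_map \<theta> \<theta>' ` S = S" using pr(6)[OF p(1)] orbit_map_in
      by (metis endo_inj_surj finite_SigmaI finite_atLeastLessThan_int image_subsetI)
    then have "z \<in> orbit_map \<theta> \<theta>' ` S" using that by (simp only:)
    then show ?thesis by (rule imageE) (rule bexI)
  qed
  have E: "(1, 0) \<in> S" "(0, 1) \<in> S" using m_pos n_pos by auto
  have cl: "g \<otimes>\<^bsub>B.G\<^esub> w \<in> S" if "g \<in> S" "w \<in> S" for g w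
    using B.G.m_closed that by (simp only: carrier_isdp)
  have "T \<theta> z = T \<eta> z \<and> T \<theta>' z = T \<eta>' z" if z: "z \<in> S" for z
  proof -
    obtain w where w: "w \<in> S" "z = orbit_map \<theta> \<theta>' w" using surj[OF z] by blast
    then have w': "z = orbit_map \<eta> \<eta>' w" using eq by simp
    show ?thesis
      using orbit_map_mult[OF p(1) w(1), of 1 0] orbit_map_mult[OF p(2) w(1), of 1 0]
        orbit_map_mult[OF p(1) w(1), of 0 1] orbit_map_mult[OF p(2) w(1), of 0 1]
        eq[OF cl[OF E(1) w(1)]] eq[OF cl[OF E(2) w(1)]] w(2) w' by simp
  qed
  then show ?thesis using T_inj pr(1,2)[OF p(1)] pr(1,2)[OF p(2)] by blast
qed

text \<open>X and Y are left multiplication by (1, 0) and (0, 1), transported along k. They inherit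
  the relations of the generators, and \<open>T_translation\<close> makes them affine.\<close>

lemma left_hgs_obtains:
  assumes K: "k \<in> left_hgs_maps B.G G"
  obtains \<theta> \<theta>' where "(\<theta>, \<theta>') \<in> pairs" "k = restrict (orbit_map \<theta> \<theta>') S"
proof -
  have ke: "k \<in> extensional S" and kb: "bij_betw k S S"
    using K unfolding left_hgs_maps_def by (simp_all add: carrier_isdp)
  have km: "\<And>g. g \<in> S \<Longrightarrow> \<exists>\<alpha>\<in>auto G. \<forall>x\<in>S. k (g \<otimes>\<^bsub>B.G\<^esub> x) = k g \<otimes>\<^bsub>G\<^esub> \<alpha> (k x)"
    using K unfolding left_hgs_maps_def carrier_isdp by blast
  have k_closed: "k x \<in> S" if "x \<in> S" for x using bij_betwE[OF kb] that by blast
  have k_surj: "\<exists>x\<in>S. y = k x" if "y \<in> S" for y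
  proof -
    have "y \<in> k ` S" using that by (simp only: bij_betw_imp_surj_on[OF kb])
    then show ?thesis by (rule imageE) (rule bexI)
  qed
  have ex: "\<exists>\<theta>\<in>\<Theta>. \<forall>x\<in>S. k (g \<otimes>\<^bsub>B.G\<^esub> x) = T \<theta> (k x)" if g: "g \<in> S" for g
  proof -
    obtain \<alpha> where a: "\<alpha> \<in> auto G" "\<And>x. x \<in> S \<Longrightarrow> k (g \<otimes>\<^bsub>B.G\<^esub> x) = k g \<otimes>\<^bsub>G\<^esub> \<alpha> (k x)" using km[OF g] by blast
    obtain \<theta> where "\<theta> \<in> \<Theta>" "\<And>w. w \<in> S \<Longrightarrow> k g \<otimes>\<^bsub>G\<^esub> \<alpha> w = T \<theta> w" using T_translation[OF k_closed[OF g] a(1)] by blast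
    then show ?thesis using a(2) k_closed by (intro bexI[of _ \<theta>] ballI) auto
  qed
  have E: "(1, 0) \<in> S" "(0, 1) \<in> S" using m_pos n_pos by auto
  obtain \<theta> where t: "\<theta> \<in> \<Theta>" "\<And>x. x \<in> S \<Longrightarrow> k ((1, 0) \<otimes>\<^bsub>B.G\<^esub> x) = T \<theta> (k x)" using ex[OF E(1)] by blast
  obtain \<theta>' where t': "\<theta>' \<in> \<Theta>" "\<And>x. x \<in> S \<Longrightarrow> k ((0, 1) \<otimes>\<^bsub>B.G\<^esub> x) = T \<theta>' (k x)" using ex[OF E(2)] by blast
  have cl: "g \<otimes>\<^bsub>B.G\<^esub> w \<in> S" if "g \<in> S" "w \<in> S" for g w
    using B.G.m_closed that by (simp only: carrier_isdp)
  have E': "(1, 0) \<in> carrier B.G" "(0, 1) \<in> carrier B.G" using E by (simp_all only: carrier_isdp)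
  have Tt: "(T \<theta> ^^ c) (k x) = k ((1, 0) [^]\<^bsub>B.G\<^esub> c \<otimes>\<^bsub>B.G\<^esub> x)" if x: "x \<in> S" for c x
  proof (induction c)
    case (Suc c)
    have xc: "x \<in> carrier B.G" using x by (simp only: carrier_isdp)
    have "(1, 0) [^]\<^bsub>B.G\<^esub> c \<otimes>\<^bsub>B.G\<^esub> x \<in> S" using B.G.nat_pow_closed[OF E'(1)] x by (intro cl) (simp_all only: carrier_isdp)
    then have "(T \<theta> ^^ Suc c) (k x) = k ((1, 0) \<otimes>\<^bsub>B.G\<^esub> ((1, 0) [^]\<^bsub>B.G\<^esub> c \<otimes>\<^bsub>B.G\<^esub> x))" using Suc t(2) by simp
    also have "(1, 0) \<otimes>\<^bsub>B.G\<^esub> ((1, 0) [^]\<^bsub>B.G\<^esub> c \<otimes>\<^bsub>B.G\<^esub> x) = (1, 0) [^]\<^bsub>B.G\<^esub> Suc c \<otimes>\<^bsub>B.G\<^esub> x"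
      unfolding B.G.nat_pow_Suc2[OF E'(1)] using E' xc B.G.nat_pow_closed[OF E'(1)] by (simp only: B.G.m_assoc)
    finally show ?case .
  next
    case 0
    have "x \<in> carrier B.G" using x by (simp only: carrier_isdp)
    then show ?case by simp
  qed
  have Tt': "(T \<theta>' ^^ c) (k x) = k ((0, 1) [^]\<^bsub>B.G\<^esub> c \<otimes>\<^bsub>B.G\<^esub> x)" if x: "x \<in> S" for c x
  proof (induction c)
    case (Suc c)
    have xc: "x \<in> carrier B.G" using x by (simp only: carrier_isdp)
    have "(0, 1) [^]\<^bsub>B.G\<^esub> c \<otimes>\<^bsub>B.G\<^esub> x \<in> S" using B.G.nat_pow_closed[OF E'(2)] x by (intro cl) (simp_all only: carrier_isdp)
    then have "(T \<theta>' ^^ Suc c) (k x) = k ((0, 1) \<otimes>\<^bsub>B.G\<^esub> ((0, 1) [^]\<^bsub>B.G\<^esub> c \<otimes>\<^bsub>B.G\<^esub> x))" using Suc t'(2) by simp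
    also have "(0, 1) \<otimes>\<^bsub>B.G\<^esub> ((0, 1) [^]\<^bsub>B.G\<^esub> c \<otimes>\<^bsub>B.G\<^esub> x) = (0, 1) [^]\<^bsub>B.G\<^esub> Suc c \<otimes>\<^bsub>B.G\<^esub> x"
      unfolding B.G.nat_pow_Suc2[OF E'(2)] using E' xc B.G.nat_pow_closed[OF E'(2)] by (simp only: B.G.m_assoc)
    finally show ?case .
  next
    case 0
    have "x \<in> carrier B.G" using x by (simp only: carrier_isdp)
    then show ?case by simp
  qed
  \<comment> \<open>Multiplying the identity by itself, the cocycle condition says that \<alpha>
    sends its image to 1.\<close>
  have k0: "k (0, 0) = (0, 0)"
  proof -
    obtain \<alpha> where a: "\<alpha> \<in> auto G" "\<And>x. x \<in> S \<Longrightarrow> k ((0, 0) \<otimes>\<^bsub>B.G\<^esub> x) = k (0, 0) \<otimes>\<^bsub>G\<^esub> \<alpha> (k x)" using km[OF zero_in] by blast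
    have z: "k (0, 0) \<in> carrier G" using k_closed[OF zero_in] by (simp only: carrier_isdp)
    have "(0, 0) \<otimes>\<^bsub>B.G\<^esub> (0, 0) = (0, 0)" by (simp add: mult_isdp)
    then have "k (0, 0) = k (0, 0) \<otimes>\<^bsub>G\<^esub> \<alpha> (k (0, 0))" using a(2)[OF zero_in] by simp
    then have "\<alpha> (k (0, 0)) = \<one>\<^bsub>G\<^esub>" using z autoD(3)[OF a(1) z] by (simp only: G.l_cancel_one')
    then show ?thesis using G.auto_one[OF a(1)] autoD(5)[OF a(1) z G.one_closed] by (simp add: one_isdp)
  qed
  have p1: "(1, 0) [^]\<^bsub>B.G\<^esub> c = (int c mod M, 0)" for c :: nat using B.pow_fst[of 1 c] m_pos by simp
  have p2: "(0, 1) [^]\<^bsub>B.G\<^esub> c = (0, int c mod N)" for c :: nat using B.pow_gen[of 0 1 c] m_pos n_pos by simp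
  have km2: "k w = orbit_map \<theta> \<theta>' w" if w: "w \<in> S" for w
  proof -
    obtain a b where ab: "w = (a, b)" "0 \<le> a" "a < M" "0 \<le> b" "b < N" using w by auto
    have b: "(0, b) \<in> S" using ab m_pos by simp
    have "(T \<theta>' ^^ nat b) (k (0, 0)) = k (0, b)" using Tt'[OF zero_in, of "nat b"] ab by (simp add: p2 mult_isdp)
    then have "orbit_map \<theta> \<theta>' w = (T \<theta> ^^ nat a) (k (0, b))" by (simp add: orbit_map_def ab k0)
    also have "\<dots> = k w" using Tt[OF b, of "nat a"] ab by (simp add: p1 mult_isdp)
    finally show ?thesis by simp
  qed
  have one: "\<one>\<^bsub>B.G\<^esub> \<otimes>\<^bsub>B.G\<^esub> x = x" if "x \<in> S" for x using B.G.l_one that by (simp only: carrier_isdp)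
  have "(\<theta>, \<theta>') \<in> pairs"
    unfolding pairs_def
  proof (intro CollectI case_prodI conjI ballI SigmaI t(1) t'(1))
    show "(T \<theta> ^^ m) z = z" if zS: "z \<in> S" for z
    proof -
      obtain x where x: "x \<in> S" "z = k x" using k_surj[OF zS] by blast
      show ?thesis using Tt[OF x(1), of m] one[OF x(1)] x(2) by (simp add: p1 one_isdp)
    qed
    show "(T \<theta>' ^^ n) z = z" if zS: "z \<in> S" for z
    proof -
      obtain x where x: "x \<in> S" "z = k x" using k_surj[OF zS] by blast
      show ?thesis using Tt'[OF x(1), of n] one[OF x(1)] x(2) by (simp add: p2 one_isdp)
    qed
    show "T \<theta>' (T \<theta> z) = (T \<theta> ^^ r) (T \<theta>' z)" if zS: "z \<in> S" for z
    proof -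
      obtain x where x: "x \<in> S" "z = k x" using k_surj[OF zS] by blast
      have xc: "x \<in> carrier B.G" using x by (simp only: carrier_isdp)
      have "T \<theta>' (T \<theta> z) = k ((0, 1) \<otimes>\<^bsub>B.G\<^esub> ((1, 0) \<otimes>\<^bsub>B.G\<^esub> x))"
        using t(2)[OF x(1)] t'(2)[OF cl[OF E(1) x(1)]] x(2) by simp
      also have "(0, 1) \<otimes>\<^bsub>B.G\<^esub> ((1, 0) \<otimes>\<^bsub>B.G\<^esub> x) = ((0, 1) \<otimes>\<^bsub>B.G\<^esub> (1, 0)) \<otimes>\<^bsub>B.G\<^esub> x"
        using E' xc by (simp only: B.G.m_assoc)
      also have "(0, 1) \<otimes>\<^bsub>B.G\<^esub> (1, 0) = (1, 0) [^]\<^bsub>B.G\<^esub> r \<otimes>\<^bsub>B.G\<^esub> (0, 1)"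
        using m_pos n_pos by (simp add: p1 mult_isdp)
      also have "\<dots> \<otimes>\<^bsub>B.G\<^esub> x = (1, 0) [^]\<^bsub>B.G\<^esub> r \<otimes>\<^bsub>B.G\<^esub> ((0, 1) \<otimes>\<^bsub>B.G\<^esub> x)"
        using E' xc B.G.nat_pow_closed[OF E'(1)] by (simp only: B.G.m_assoc)
      also have "k \<dots> = (T \<theta> ^^ r) (k ((0, 1) \<otimes>\<^bsub>B.G\<^esub> x))" using Tt[OF cl[OF E(2) x(1)]] by simp
      finally show ?thesis using t'(2)[OF x(1)] x(2) by simp
    qed
    show "inj_on (orbit_map \<theta> \<theta>') S"
      using bij_betw_imp_inj_on[OF kb] km2 by (simp cong: inj_on_cong)
  qed
  moreover have "k = restrict (orbit_map \<theta> \<theta>') S"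
    by (rule extensionalityI[OF ke]) (use km2 in auto)
  ultimately show ?thesis using that by blast
qed

lemma card_left_hgs_maps: "card (left_hgs_maps B.G G) = card pairs"
proof -
  have "bij_betw (\<lambda>(\<theta>, \<theta>'). restrict (orbit_map \<theta> \<theta>') S) pairs (left_hgs_maps B.G G)"
    unfolding bij_betw_def
  proof
    show "inj_on (\<lambda>(\<theta>, \<theta>'). restrict (orbit_map \<theta> \<theta>') S) pairs"
      by (rule inj_onI) (use pairs_inj in \<open>clarsimp\<close>)
    show "(\<lambda>(\<theta>, \<theta>'). restrict (orbit_map \<theta> \<theta>') S) ` pairs = left_hgs_maps B.G G"
    proof (intro equalityI subsetI)
      fix k assume "k \<in> (\<lambda>(\<theta>, \<theta>'). restrict (orbit_map \<theta> \<theta>') S) ` pairs"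
      then show "k \<in> left_hgs_maps B.G G" using orbit_map_left_hgs by auto
    next
      fix k assume "k \<in> left_hgs_maps B.G G"
      then obtain \<theta> \<theta>' where "(\<theta>, \<theta>') \<in> pairs" "k = restrict (orbit_map \<theta> \<theta>') S" by (rule left_hgs_obtains)
      then show "k \<in> (\<lambda>(\<theta>, \<theta>'). restrict (orbit_map \<theta> \<theta>') S) ` pairs" by (intro rev_image_eqI[of "(\<theta>, \<theta>')"]) auto
    qed
  qed
  then show ?thesis by (simp add: bij_betw_same_card)
qed

end

section \<open>Iterates of affine maps and the equations between their parameters\<close>

lemma dvd_lin: "d dvd x \<Longrightarrow> d dvd y \<Longrightarrow> z = k * x + l * y \<Longrightarrow> d dvd z"
  for d x y z k l :: int
  by (metis dvd_add dvd_mult)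

text \<open>The left side is the k-th iterate of a |-> w + i a at y. The displacement in one step, w
  + (i - 1) y, factors out of the total displacement.\<close>

lemma gsum_affine: "w * gsum k i 1 + i ^ k * y = (w + (i - 1) * y) * gsum k i 1 + y"
proof -
  have "(w + (i - 1) * y) * gsum k i 1 + y = w * gsum k i 1 + y * ((i - 1) * gsum k i 1) + y"
    by (simp add: algebra_simps)
  then show ?thesis unfolding gsum_mult by (simp add: algebra_simps)
qed

text \<open>The order of x divides both k and \<open>totient d\<close>.\<close>

lemma cong_one_of_pow:
  fixes x :: int and d k :: nat
  assumes x: "[x ^ k = 1] (mod int d)" and k: "coprime k (totient d)" and "k > 0" "d > 1"
  shows "[x = 1] (mod int d)"
proof -
  define y where "y = nat (x mod int d)"
  have y: "[int y = x] (mod int d)" using \<open>d > 1\<close> by (simp add: y_def cong_def)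
  have "[int y ^ k = 1] (mod int d)" using cong_pow[OF y, of k] x by (rule cong_trans)
  then have yk: "[y ^ k = 1] (mod d)" by (metis cong_int_iff of_nat_1 of_nat_power)
  have "coprime (y ^ k) d" using yk by (metis cong_imp_coprime cong_sym coprime_1_left)
  then have "coprime d y" using \<open>k > 0\<close> by (simp add: coprime_commute)
  then have "ord d y dvd totient d" by (rule order_divides_totient)
  moreover have "ord d y dvd k" using yk ord_divides by blast
  ultimately have "ord d y = 1" using k by (metis coprime_common_divisor_nat nat_dvd_1_iff_1)
  then have "[y = 1] (mod d)" by (simp add: ord_eq_Suc_0_iff)
  then have "[int y = 1] (mod int d)" by (metis cong_int_iff of_nat_1)
  then show ?thesis using y cong_sym cong_trans by blast
qed

text \<open>For a at most b the two sums differ by i^a times the sum of length b - a. Since i is a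
  unit, \<open>dvd_gsum_iff\<close> makes b - a a multiple of N.\<close>

lemma gsum_inj:
  fixes P N :: nat
  assumes P: "Factorial_Ring.prime P" and N: "N = P \<or> N = P\<^sup>2 \<and> odd P" and i: "[i = 1] (mod int P)"
    and ab: "a < N" "b < N" and e: "[gsum a i 1 = gsum b i 1] (mod int N)"
  shows "a = b"
proof -
  have main: "a = b" if "a \<le> b" "b < N" and e: "[gsum a i 1 = gsum b i 1] (mod int N)" for a b
  proof -
    define d where "d = b - a"
    have b: "b = d + a" using that d_def by simp
    have "int N dvd i ^ a * gsum d i 1" using cong_sym[OF e] by (simp add: b gsum_add cong_iff_dvd_diff)
    moreover have "coprime i (int P)" using i by (metis cong_imp_coprime cong_sym coprime_1_left)
    then have "coprime (i ^ a) (int N)" using N by auto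
    ultimately have "int N dvd gsum d i 1" by (simp add: coprime_dvd_mult_right_iff coprime_commute)
    then have "N dvd d" using dvd_gsum_iff[OF P N i] by simp
    then have "d = 0" using that d_def by (metis diff_le_self dvd_imp_le le_less_trans neq0_conv not_le)
    then show ?thesis using b by simp
  qed
  show ?thesis
  proof (cases "a \<le> b")
    case True then show ?thesis using main ab e by blast
  next
    case False
    then have "b = a" using main[of b a] ab cong_sym[OF e] by simp
    then show ?thesis by simp
  qed
qed

context sd_data
begin

text \<open>As j lies in \<open>J\<close>, each step multiplies \<open>chi\<close> of the second
  coordinate by \<open>chi v\<close>; this turns the contribution of c into a geometric sum in i and
  \<open>chi v\<close>.\<close>

lemma T_iter:
  assumes th: "(u, i, c, v, j) \<in> \<Theta>" and ab: "(a, b) \<in> S"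
  shows "(T (u, i, c, v, j) ^^ k) (a, b) =
    ((u * gsum k i 1 + c * chi b * gsum k i (chi v) + i ^ k * a) mod M, (v * gsum k j 1 + j ^ k * b) mod N)"
    (is "_ = (?A k mod M, ?B k mod N)")
proof -
  have j: "j \<in> J" using th by (simp add: \<Theta>_def)
  have chiB: "[chi (?B k) = chi v ^ k * chi b] (mod M)" for k
  proof (induction k)
    case (Suc k)
    have "chi (?B (Suc k)) = chi (v + j * (?B k mod N))"
      by (rule chi_cong) (simp add: cong_def mod_nest distrib_left algebra_simps)
    also have "[chi (v + j * (?B k mod N)) = chi v * chi (j * (?B k mod N))] (mod M)" by (rule chi_add)
    also have "[chi v * chi (j * (?B k mod N)) = chi v * chi (?B k mod N)] (mod M)"
      using chi_J[OF j, of "?B k mod N"] mod_in(2)[of "?B k"] by (intro cong_mult cong_refl) simp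
    also have "chi (?B k mod N) = chi (?B k)" by (rule chi_cong) simp
    also have "[chi v * chi (?B k) = chi v * (chi v ^ k * chi b)] (mod M)" by (intro cong_mult cong_refl Suc)
    finally show ?case by (simp add: mult.assoc)
  qed simp
  show ?thesis
  proof (induction k)
    case 0
    then show ?case using ab by simp
  next
    case (Suc k)
    have "chi (?B k mod N) = chi (?B k)" by (rule chi_cong) simp
    then have "[u + i * ?A k + c * chi (?B k mod N) = u + i * ?A k + c * (chi v ^ k * chi b)] (mod M)"
      using chiB[of k] by (intro cong_add cong_mult cong_refl) simp
    also have "u + i * ?A k + c * (chi v ^ k * chi b) = ?A (Suc k)" by (simp add: algebra_simps)
    finally have "(u + i * ?A k + c * chi (?B k mod N)) mod M = ?A (Suc k) mod M" by (rule mod_m_eqI)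
    moreover have "v + j * ?B k = ?B (Suc k)" by (simp add: algebra_simps)
    ultimately show ?case using Suc by (simp only: funpow.simps comp_apply T_simp mod_nest)
  qed
qed

text \<open>This is what the assumption \<open>\<not> P dvd Q - 1\<close> is for:
  \<open>totient n\<close> is Q - 1 or Q (Q - 1).\<close>

lemma coprime_totient: "coprime m (totient n)" "coprime m (totient P)"
proof -
  have gP: "P > 1" "Q > 1" using prime_gt_1_nat primeP primeQ by auto
  have "\<not> P dvd totient n"
  proof
    assume "P dvd totient n"
    moreover have "totient n = Q - 1 \<or> totient n = Q * (Q - 1)"
      using n totient_prime[OF primeQ] totient_prime_power[OF primeQ, of 2] by auto
    ultimately have "P dvd Q \<or> P dvd Q - 1" using primeP by (auto simp: prime_dvd_mult_iff)
    then show False using PQ primes_dvd_imp_eq[OF primeP primeQ] by auto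
  qed
  then have "coprime P (totient n)" using primeP by (simp add: prime_imp_coprime)
  then show "coprime m (totient n)" using m by auto
  have "\<not> P dvd P - 1" using gP by (auto dest: dvd_imp_le)
  then have "coprime P (totient P)" using primeP totient_prime[OF primeP] by (simp add: prime_imp_coprime)
  then show "coprime m (totient P)" using m by auto
qed

lemma C_one: "c \<in> C \<Longrightarrow> s = 1 \<Longrightarrow> c = 0"
  unfolding C_def by simp

text \<open>The difference of the two assumptions is Bb times chi(1) - 1, which is a unit unless s =
  1.\<close>

lemma separate:
  assumes "s = 1 \<Longrightarrow> Bb = 0" and "M dvd A + Bb" "M dvd A + Bb * chi 1"
  shows "M dvd A" "M dvd Bb"
proof -
  have "M dvd Bb"
  proof (cases "s = 1")
    case False
    have "M dvd Bb * (chi 1 - 1)" by (rule dvd_lin[OF assms(3,2), of _ 1 "-1"]) (simp add: algebra_simps)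
    then show ?thesis using coprime_chi_minus_one[OF False, of 1] by (simp add: coprime_dvd_mult_left_iff coprime_commute)
  qed (use assms in simp)
  then show "M dvd Bb" "M dvd A" using assms(2) by (simp_all add: dvd_add_left_iff)
qed

end

context sd_pair
begin

text \<open>Of X^m = 1 only v = 0, j = 1 and i = 1 modulo P remain. The equations with r express Y X
  = X^r Y, those with n express Y^n = 1. The last line is regularity: X runs through each fibre over
  Z/n in one cycle, and Y permutes the fibres in one cycle.\<close>

definition sols where
  "sols = {((u, i, c, v, j), (u', i', c', v', j')) \<in> \<Theta> \<times> \<Theta>. v = 0 \<and> j = 1 \<and> int P dvd i - 1 \<and> M dvd i ^ r - i \<and>
     M dvd (i' - int r) * u - (i - 1) * u' \<and> M dvd (i' - int r * chi v') * c - (i - 1) * c' \<and>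
     M dvd i' ^ n - 1 \<and> M dvd u' * gsum n i' 1 \<and> M dvd c' * gsum n i' (chi v') \<and>
     (\<forall>b\<in>{0..<N}. \<not> int P dvd u + c * chi b) \<and> coprime v' N \<and> int Q dvd j' - 1}"

lemma r_pos: "r > 0"
proof (rule ccontr)
  assume "\<not> r > 0"
  then have "r ^ n = 0" using n_pos by simp
  then have "[0 = 1] (mod m)" using B.s_pow by metis
  then show False using m_pos by (simp add: cong_def)
qed

text \<open>Here i^(r-1) - 1 is i - 1 times a sum congruent to r - 1 modulo P, and for r different
  from 1 that sum is a unit.\<close>

lemma i_or_r:
  assumes i: "int P dvd i - 1" and ir: "M dvd i ^ r - i"
  shows "M dvd i - 1 \<or> r = 1"
proof (cases "r = 1")
  case False
  have ci: "[i = 1] (mod int P)" using i by (simp add: cong_iff_dvd_diff)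
  then have "coprime i (int P)" by (metis cong_imp_coprime cong_sym coprime_1_left)
  then have "coprime i M" using m by auto
  moreover have "i ^ r - i = i * (i ^ (r - 1) - 1)" using r_pos by (simp add: algebra_simps flip: power_Suc)
  ultimately have "M dvd i ^ (r - 1) - 1" using ir by (simp add: coprime_dvd_mult_right_iff coprime_commute)
  then have "M dvd (i - 1) * gsum (r - 1) i 1" by (simp add: gsum_mult)
  moreover have "coprime (gsum (r - 1) i 1) M"
  proof -
    have "[gsum (r - 1) i 1 = int (r - 1)] (mod int P)" using gsum_cong[OF ci cong_refl, of "r - 1" 1] by simp
    moreover have "\<not> int P dvd int (r - 1)"
    proof
      assume "int P dvd int (r - 1)"
      then have "P dvd r - 1" by simp
      then have "[r = 1] (mod P)" using r_pos by (metis One_nat_def Suc_leI cong_to_1_nat cong_altdef_nat cong_sym)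
      moreover have "\<not> Q dvd 1" using primeQ by (metis not_prime_unit)
      ultimately show False using B.s_cases False by (metis power_one_right)
    qed
    ultimately show ?thesis using coprime_m_iff cong_dvd_iff by blast
  qed
  ultimately have "M dvd i - 1" by (simp add: coprime_dvd_mult_left_iff coprime_commute)
  then show ?thesis ..
qed simp

lemma gsum_r:
  assumes i: "int P dvd i - 1" and ir: "M dvd i ^ r - i"
  shows "[gsum r i 1 = int r] (mod M)"
  using i_or_r[OF assms]
proof
  assume "M dvd i - 1"
  then have "[i = 1] (mod M)" by (simp add: cong_iff_dvd_diff)
  then show ?thesis using gsum_cong[of i 1 M 1 1 r] by simp
qed simp

text \<open>The equations come from evaluating the relations at the identity and at the generators;
  the regularity conditions come from points which the orbit would otherwise miss or meet
  twice.\<close>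

lemma pairs_sols:
  assumes p: "((u, i, c, v, j), (u', i', c', v', j')) \<in> pairs"
  shows "((u, i, c, v, j), (u', i', c', v', j')) \<in> sols"
proof -
  let ?X = "T (u, i, c, v, j)" and ?Y = "T (u', i', c', v', j')"
  note X = pr(1)[OF p] and Y = pr(2)[OF p]
  have E: "(0, 0) \<in> S" "(1, 0) \<in> S" "(0, 1) \<in> S" using m_pos n_pos by auto
  have Pm: "m > 0" "coprime m (totient n)" using m_pos coprime_totient by auto
  have iU: "coprime i M" "coprime i' M" "coprime j' N" and j'J: "j' \<in> J" and rng: "v \<in> {0..<N}" "j \<in> {0..<N}"
    and cC: "c \<in> C" "c' \<in> C"
    using X Y by (auto simp: \<Theta>_def U_def J_def)
  note sc = C_one[OF cC(1)] C_one[OF cC(2)]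
  \<comment> \<open>X^m = 1 at (0, 0) and (0, 1) gives j^m = 1 and v (1 + ... + j^(m-1)) = 0. Since
    m is prime to \<open>totient n\<close> and to n, first j = 1 and then v = 0.\<close>
  have "(j ^ m) mod N = 1 mod N \<and> (v * gsum m j 1) mod N = 0 \<and> [v * gsum m j 1 + j ^ m = 1] (mod N)"
    using pr(3)[OF p E(1)] pr(3)[OF p E(3)] T_iter[OF X E(1), of m] T_iter[OF X E(3), of m] n_pos
    by (simp add: cong_def) (metis add.commute add.right_neutral mod_add_right_eq)
  then have jm: "[j ^ m = 1] (mod N)" and vm: "N dvd v * gsum m j 1" by (auto simp: cong_def)
  have "[j = 1] (mod N)" using cong_one_of_pow[OF jm Pm(2,1) n_pos] .
  then have j: "j = 1" using rng n_pos by (intro lt_eq_mod_n) auto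
  then have "N dvd v * M" using vm by simp
  then have "N dvd v" using coprime_nm by (simp add: coprime_dvd_mult_left_iff)
  then have v: "v = 0" using rng zdvd_not_zless[of v N] by fastforce
  have Xk: "(?X ^^ k) (a, b) = (((u + c * chi b) * gsum k i 1 + i ^ k * a) mod M, b)" if "(a, b) \<in> S" for k a b
    using T_iter[OF X that, of k] that by (simp add: v j distrib_right)
  have "[(u + c * chi 0) * gsum m i 1 + i ^ m * 1 = 1] (mod M)" "[(u + c * chi 0) * gsum m i 1 + i ^ m * 0 = 0] (mod M)"
    using pr(3)[OF p E(1)] pr(3)[OF p E(2)] Xk[OF E(1), of m] Xk[OF E(2), of m] m_pos by (auto simp: cong_def)
  from cong_diff[OF this] have im: "[i ^ m = 1] (mod M)" by simp
  \<comment> \<open>The equation i^m = 1 determines i only modulo P: for m = P^2 it has P solutions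
    modulo m.\<close>
  have i1: "[i = 1] (mod int P)"
    by (rule cong_one_of_pow[OF P_cong[OF im] coprime_totient(2) Pm(1) prime_gt_1_nat[OF primeP]])
  then have i1': "int P dvd i - 1" by (simp add: cong_iff_dvd_diff)
  have rel: "M dvd (u' + i' * (u + c * chi b + i * a) + c' * chi b) -
      ((u + c * chi v' * chi b) * gsum r i 1 + i ^ r * (u' + i' * a + c' * chi b))" if ab: "(a, b) \<in> S" for a b
  proof -
    have b: "0 \<le> b" using ab by auto
    have "?Y (?X (a, b)) = ((u' + i' * (u + c * chi b + i * a) + c' * chi b) mod M, (v' + j' * b) mod N)"
      using ab by (simp add: T_simp v j mod_nest) (simp add: algebra_simps)
    moreover have "(?X ^^ r) (?Y (a, b)) = (((u + c * chi ((v' + j' * b) mod N)) * gsum r i 1 + i ^ r * ((u' + i' * a + c' * chi b) mod M)) mod M, (v' + j' * b) mod N)"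
      using Xk[of "(u' + i' * a + c' * chi b) mod M" "(v' + j' * b) mod N" r] mod_in by (simp add: T_simp)
    ultimately have "[u' + i' * (u + c * chi b + i * a) + c' * chi b =
       (u + c * chi ((v' + j' * b) mod N)) * gsum r i 1 + i ^ r * ((u' + i' * a + c' * chi b) mod M)] (mod M)"
      using pr(5)[OF p ab] by (simp add: cong_def)
    also have "[(u + c * chi ((v' + j' * b) mod N)) * gsum r i 1 + i ^ r * ((u' + i' * a + c' * chi b) mod M) =
       (u + c * (chi v' * chi b)) * gsum r i 1 + i ^ r * (u' + i' * a + c' * chi b)] (mod M)"
    proof (intro cong_add cong_mult cong_refl)
      have "chi ((v' + j' * b) mod N) = chi (v' + j' * b)" by (rule chi_cong) simp
      also have "[chi (v' + j' * b) = chi v' * chi (j' * b)] (mod M)" by (rule chi_add)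
      also have "[chi v' * chi (j' * b) = chi v' * chi b] (mod M)" by (intro cong_mult cong_refl chi_J[OF j'J b])
      finally show "[chi ((v' + j' * b) mod N) = chi v' * chi b] (mod M)" .
    qed simp
    finally show ?thesis by (simp add: cong_iff_dvd_diff mult.assoc)
  qed
  \<comment> \<open>Comparing \<open>rel\<close> at a = 0 and a = 1 isolates the coefficient of
    a.\<close>
  have "M dvd i' * (i ^ r - i)"
    by (rule dvd_lin[OF rel[OF E(1)] rel[OF E(2)], of _ 1 "-1"]) (simp add: algebra_simps)
  then have ir: "M dvd i ^ r - i" using iU by (simp add: coprime_dvd_mult_right_iff coprime_commute)
  have gr: "M dvd gsum r i 1 - int r" using gsum_r[OF i1' ir] by (simp add: cong_iff_dvd_diff)
  \<comment> \<open>Once \<open>gsum r i 1\<close> and i^r are replaced by r and i, the relation is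
    a combination of 1 and \<open>chi b\<close>, to which \<open>separate\<close> applies.\<close>
  have rel': "M dvd ((i' - int r) * u - (i - 1) * u') + ((i' - int r * chi v') * c - (i - 1) * c') * chi b" if "(0, b) \<in> S" for b
    by (rule dvd_lin[OF rel[OF that] dvd_lin[OF gr ir refl, of "u + c * chi v' * chi b" "u' + c' * chi b"], of _ 1 1])
       (simp add: algebra_simps)
  have sep1: "M dvd (i' - int r) * u - (i - 1) * u'" "M dvd (i' - int r * chi v') * c - (i - 1) * c'"
    using separate[of "(i' - int r * chi v') * c - (i - 1) * c'" "(i' - int r) * u - (i - 1) * u'"]
      rel'[OF E(1)] rel'[OF E(3)] sc by auto
  have Yn: "[u' * gsum n i' 1 + c' * chi b * gsum n i' (chi v') + i' ^ n * a = a] (mod M)"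
      "[v' * gsum n j' 1 + j' ^ n * b = b] (mod N)" if "(a, b) \<in> S" for a b
    using T_iter[OF Y that, of n] pr(4)[OF p that] that by (auto simp: cong_def)
  have in1: "M dvd i' ^ n - 1"
    using cong_diff[OF Yn(1)[OF E(2)] Yn(1)[OF E(1)]] by (simp add: cong_iff_dvd_diff)
  have sep2: "M dvd u' * gsum n i' 1" "M dvd c' * gsum n i' (chi v')"
  proof -
    have "M dvd u' * gsum n i' 1 + c' * gsum n i' (chi v')"
      using Yn(1)[OF E(1)] by (simp add: cong_iff_dvd_diff)
    moreover have "M dvd u' * gsum n i' 1 + c' * gsum n i' (chi v') * chi 1"
      using Yn(1)[OF E(3)] by (simp add: cong_iff_dvd_diff ac_simps)
    moreover have "s = 1 \<Longrightarrow> c' * gsum n i' (chi v') = 0" using sc(2) by simp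
    ultimately show "M dvd u' * gsum n i' 1" "M dvd c' * gsum n i' (chi v')"
      using separate[of "c' * gsum n i' (chi v')" "u' * gsum n i' 1"] by blast+
  qed
  define Orb where "Orb = orbit_map (u, i, c, v, j) (u', i', c', v', j')"
  have Oe: "Orb (a, b) = (((u + c * chi z) * gsum (nat a) i 1 + i ^ nat a * y) mod M, z)"
    if "z = (v' * gsum (nat b) j' 1) mod N" "y = (u' * gsum (nat b) i' 1 + c' * gsum (nat b) i' (chi v')) mod M" for a b y z
    using T_iter[OF Y E(1), of "nat b"] Xk[of y z] that mod_in by (simp add: Orb_def orbit_map_def)
  have Oi: "inj_on Orb S" unfolding Orb_def by (rule pr(6)[OF p])
  have Osurj: "\<exists>w\<in>S. z = Orb w" if "z \<in> S" for z
  proof -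
    have "Orb ` S = S" using Oi orbit_map_in unfolding Orb_def
      by (metis endo_inj_surj finite_SigmaI finite_atLeastLessThan_int image_subsetI)
    then have "z \<in> Orb ` S" using that by (simp only:)
    then show ?thesis by (rule imageE) (rule bexI)
  qed
  \<comment> \<open>X preserves second coordinates, so the powers of Y alone have to reach every
    fibre.\<close>
  have snd_surj: "\<exists>b. 0 \<le> b \<and> b < N \<and> z = (v' * gsum (nat b) j' 1) mod N" if "0 \<le> z" "z < N" for z
  proof -
    have "(0, z) \<in> S" using that m_pos by simp
    then obtain a b where ab: "(a, b) \<in> S" "(0, z) = Orb (a, b)" using Osurj[of "(0, z)"] by auto
    then have "z = (v' * gsum (nat b) j' 1) mod N" using Oe[OF refl refl, of a b] by simp
    then show ?thesis using ab by auto
  qed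
  have v'N: "coprime v' N"
  proof -
    obtain b where "1 = (v' * gsum (nat b) j' 1) mod N" using snd_surj[of 1] n_pos by auto
    then have "[v' * gsum (nat b) j' 1 = 1] (mod N)" using n_pos by (simp add: cong_def)
    then show ?thesis by (metis coprime_iff_invertible_int)
  qed
  \<comment> \<open>Otherwise b |-> v' + j' b has the fixed point -v' h, with h the inverse of j' -
    1. Reaching it from 0 would make a power of the unit j' vanish.\<close>
  have j'1: "int Q dvd j' - 1"
  proof (rule ccontr)
    assume "\<not> int Q dvd j' - 1"
    then have "coprime (j' - 1) N" by (simp add: coprime_n_iff)
    then obtain h where h: "[(j' - 1) * h = 1] (mod N)" by (metis coprime_iff_invertible_int)
    obtain b where b: "(- (v' * h)) mod N = (v' * gsum (nat b) j' 1) mod N" using snd_surj[of "(- (v' * h)) mod N"] mod_in(2)[of "- (v' * h)"] by auto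
    then have "N dvd - (v' * h) - v' * gsum (nat b) j' 1" by (simp only: mod_eq_dvd_iff)
    from dvd_lin[OF this dvd_0_right, of _ "-1" 0] have "N dvd v' * (gsum (nat b) j' 1 + h)" by (simp add: algebra_simps)
    then have "N dvd gsum (nat b) j' 1 + h" using v'N by (simp add: coprime_dvd_mult_right_iff coprime_commute)
    moreover have "N dvd (j' - 1) * h - 1" using h by (simp add: cong_iff_dvd_diff)
    ultimately have "N dvd (j' - 1) * gsum (nat b) j' 1 + 1"
      by (rule dvd_lin[of _ _ _ _ "j' - 1" "-1"]) (simp add: algebra_simps)
    then have "N dvd j' ^ nat b" by (simp add: gsum_mult)
    moreover have "coprime (j' ^ nat b) N" using iU by simp
    ultimately show False using coprime_common_divisor[of "j' ^ nat b" N N] n_pos by simp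
  qed
  \<comment> \<open>If P divided this displacement, X^(m/P) would fix the point (y, z) of the orbit:
    m/P divides the geometric sum of that length, and the displacement contributes the missing
    factor P.\<close>
  have unit: "\<not> int P dvd u + c * chi z" if z: "z \<in> {0..<N}" for z
  proof
    assume dv: "int P dvd u + c * chi z"
    obtain b where b: "0 \<le> b" "b < N" "z = (v' * gsum (nat b) j' 1) mod N" using snd_surj z by auto
    define y where "y = (u' * gsum (nat b) i' 1 + c' * gsum (nat b) i' (chi v')) mod M"
    define a0 where "a0 = m div P"
    have Ppos: "P > 1" using primeP by (rule prime_gt_1_nat)
    have a0: "m = P * a0" "a0 > 0" "a0 < m" "a0 = 1 \<or> a0 = P"
      using m Ppos by (auto simp: a0_def power2_eq_square)
    have "int a0 dvd gsum a0 i 1"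
      using a0(4) dvd_gsum_iff[OF primeP _ i1, of P P] by auto
    moreover have "int P dvd u + c * chi z + (i - 1) * y" using dv i1' by (simp add: dvd_add)
    ultimately have "M dvd (u + c * chi z + (i - 1) * y) * gsum a0 i 1" unfolding a0(1) of_nat_mult by (rule mult_dvd_mono[rotated])
    moreover have "(u + c * chi z + (i - 1) * y) * gsum a0 i 1 = (u + c * chi z) * gsum a0 i 1 + i ^ a0 * y - y"
      using gsum_affine[of "u + c * chi z" a0 i y] by simp
    ultimately have "[(u + c * chi z) * gsum a0 i 1 + i ^ a0 * y = y] (mod M)" by (simp add: cong_iff_dvd_diff)
    then have "Orb (int a0, b) = Orb (0, b)" using Oe[OF b(3) y_def] by (simp add: cong_def)
    from inj_onD[OF Oi this] have "(int a0, b) = (0, b)" using a0 b m_pos by auto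
    then show False using a0 by simp
  qed
  show ?thesis using X Y v j i1' ir sep1 in1 sep2 unit v'N j'1 by (simp add: sols_def)
qed

lemma sols_pairs:
  assumes q: "((u, i, c, v, j), (u', i', c', v', j')) \<in> sols"
  shows "((u, i, c, v, j), (u', i', c', v', j')) \<in> pairs"
proof -
  let ?X = "T (u, i, c, v, j)" and ?Y = "T (u', i', c', v', j')"
  have X: "(u, i, c, v, j) \<in> \<Theta>" and Y: "(u', i', c', v', j') \<in> \<Theta>" and v: "v = 0" and j: "j = 1"
    and i1: "int P dvd i - 1" and ir: "M dvd i ^ r - i"
    and e1: "M dvd (i' - int r) * u - (i - 1) * u'" and e2: "M dvd (i' - int r * chi v') * c - (i - 1) * c'"
    and in1: "M dvd i' ^ n - 1" and u1: "M dvd u' * gsum n i' 1" and c1: "M dvd c' * gsum n i' (chi v')"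
    and unit: "\<And>b. b \<in> {0..<N} \<Longrightarrow> \<not> int P dvd u + c * chi b" and v'N: "coprime v' N" and j'1: "int Q dvd j' - 1"
    using q by (auto simp: sols_def)
  have j'J: "j' \<in> J" using Y by (auto simp: \<Theta>_def)
  have ci: "[i = 1] (mod int P)" and cj: "[j' = 1] (mod int Q)" using i1 j'1 by (simp_all add: cong_iff_dvd_diff)
  have E: "(0, 0) \<in> S" using m_pos n_pos by auto
  have Xk: "(?X ^^ k) (a, b) = (((u + c * chi b) * gsum k i 1 + i ^ k * a) mod M, b)" if "(a, b) \<in> S" for k a b
    using T_iter[OF X that, of k] that by (simp add: v j distrib_right)
  \<comment> \<open>By lifting the exponent, i = 1 modulo P and j' = 1 modulo Q suffice for these
    sums to vanish; X^m and the second coordinate of Y^n are then trivial.\<close>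
  have gm: "M dvd gsum m i 1" using dvd_gsum_iff[OF primeP m ci, of m] by simp
  have gn: "N dvd gsum n j' 1" using dvd_gsum_iff[OF primeQ n cj, of n] by simp
  have Xm: "(?X ^^ m) z = z" if "z \<in> S" for z
  proof -
    obtain a b where z: "z = (a, b)" by (cases z)
    have "M dvd ((u + c * chi b) * gsum m i 1 + i ^ m * a) - a"
      unfolding gsum_affine using gm by simp
    then have "((u + c * chi b) * gsum m i 1 + i ^ m * a) mod M = a mod M" by (simp add: mod_eq_dvd_iff)
    then show ?thesis using that Xk[of a b m] by (simp add: z)
  qed
  have Yn: "(?Y ^^ n) z = z" if "z \<in> S" for z
  proof -
    obtain a b where z: "z = (a, b)" by (cases z)
    have "M dvd (u' * gsum n i' 1 + c' * chi b * gsum n i' (chi v') + i' ^ n * a) - a"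
      by (rule dvd_lin[OF u1 dvd_lin[OF c1 in1 refl, of "chi b" a], of _ 1 1]) (simp add: algebra_simps)
    then have "(u' * gsum n i' 1 + c' * chi b * gsum n i' (chi v') + i' ^ n * a) mod M = a mod M" by (simp add: mod_eq_dvd_iff)
    moreover have "N dvd (v' * gsum n j' 1 + j' ^ n * b) - b"
      unfolding gsum_affine using gn by simp
    then have "(v' * gsum n j' 1 + j' ^ n * b) mod N = b mod N" by (simp add: mod_eq_dvd_iff)
    ultimately show ?thesis using that T_iter[OF Y, of a b n] by (simp add: z)
  qed
  have rel: "?Y (?X z) = (?X ^^ r) (?Y z)" if "z \<in> S" for z
  proof -
    obtain a b where z: "z = (a, b)" by (cases z)
    then have z: "z = (a, b)" "(a, b) \<in> S" "0 \<le> b" using that by auto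
    have gr: "M dvd gsum r i 1 - int r" using gsum_r[OF i1 ir] by (simp add: cong_iff_dvd_diff)
    have cb: "[chi ((v' + j' * b) mod N) = chi v' * chi b] (mod M)"
    proof -
      have "chi ((v' + j' * b) mod N) = chi (v' + j' * b)" by (rule chi_cong) simp
      also have "[chi (v' + j' * b) = chi v' * chi (j' * b)] (mod M)" by (rule chi_add)
      also have "[chi v' * chi (j' * b) = chi v' * chi b] (mod M)" by (intro cong_mult cong_refl chi_J[OF j'J z(3)])
      finally show ?thesis .
    qed
    have "?Y (?X (a, b)) = ((u' + i' * (u + c * chi b + i * a) + c' * chi b) mod M, (v' + j' * b) mod N)"
      using z by (simp add: T_simp v j mod_nest) (simp add: algebra_simps)
    moreover have "(?X ^^ r) (?Y (a, b)) = (((u + c * chi ((v' + j' * b) mod N)) * gsum r i 1 + i ^ r * (u' + i' * a + c' * chi b)) mod M, (v' + j' * b) mod N)"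
      using Xk[of "(u' + i' * a + c' * chi b) mod M" "(v' + j' * b) mod N" r] mod_in by (simp add: T_simp mod_nest)
    moreover have "[u' + i' * (u + c * chi b + i * a) + c' * chi b = (u + c * (chi v' * chi b)) * gsum r i 1 + i ^ r * (u' + i' * a + c' * chi b)] (mod M)"
      unfolding cong_iff_dvd_diff
      by (rule dvd_lin[OF dvd_lin[OF e1 e2 refl, of 1 "chi b"] dvd_lin[OF gr ir refl, of "u + c * chi v' * chi b" "u' + i' * a + c' * chi b"], of _ 1 "-1"])
         (simp add: algebra_simps)
    moreover have "[(u + c * (chi v' * chi b)) * gsum r i 1 + i ^ r * (u' + i' * a + c' * chi b) =
        (u + c * chi ((v' + j' * b) mod N)) * gsum r i 1 + i ^ r * (u' + i' * a + c' * chi b)] (mod M)"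
      by (intro cong_add cong_mult cong_refl cong_sym[OF cb])
    ultimately show ?thesis using z by (simp add: cong_def)
  qed
  have inj: "inj_on (orbit_map (u, i, c, v, j) (u', i', c', v', j')) S"
  proof (rule inj_onI)
    fix w w' assume w: "w \<in> S" "w' \<in> S" and e: "orbit_map (u, i, c, v, j) (u', i', c', v', j') w = orbit_map (u, i, c, v, j) (u', i', c', v', j') w'"
    obtain a b where ab: "w = (a, b)" "0 \<le> a" "a < M" "0 \<le> b" "b < N" using w by auto
    obtain a2 b2 where ab2: "w' = (a2, b2)" "0 \<le> a2" "a2 < M" "0 \<le> b2" "b2 < N" using w by auto
    define z where "z b = (v' * gsum (nat b) j' 1) mod N" for b
    define y where "y b = (u' * gsum (nat b) i' 1 + c' * gsum (nat b) i' (chi v')) mod M" for b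
    have Oe: "orbit_map (u, i, c, v, j) (u', i', c', v', j') (a, b) = (((u + c * chi (z b)) * gsum (nat a) i 1 + i ^ nat a * y b) mod M, z b)" for a b
      using T_iter[OF Y E, of "nat b"] Xk[of "y b" "z b"] mod_in by (simp add: orbit_map_def z_def y_def)
    have "z b = z b2" using e by (simp add: ab ab2 Oe)
    then have "[v' * gsum (nat b) j' 1 = v' * gsum (nat b2) j' 1] (mod N)" by (simp add: z_def cong_def)
    then have "[gsum (nat b) j' 1 = gsum (nat b2) j' 1] (mod N)" using v'N by (simp add: cong_mult_lcancel)
    then have "nat b = nat b2" using ab ab2 by (intro gsum_inj[OF primeQ n cj]) auto
    then have bb: "b = b2" using ab ab2 by simp
    \<comment> \<open>\<open>W\<close> is the displacement of \<open>y b\<close> under one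
      application of X. It is a unit because i = 1 modulo P and u + c chi(z) is a unit.\<close>
    define W where "W = u + c * chi (z b) + (i - 1) * y b"
    have We: "(u + c * chi (z b)) * gsum k i 1 + i ^ k * y b = W * gsum k i 1 + y b" for k
      unfolding W_def by (rule gsum_affine)
    have "[W * gsum (nat a) i 1 + y b = W * gsum (nat a2) i 1 + y b] (mod M)"
      using e by (simp add: ab ab2 Oe bb[symmetric] We cong_def)
    then have *: "[W * gsum (nat a) i 1 = W * gsum (nat a2) i 1] (mod M)" by (simp add: cong_add_rcancel)
    have "\<not> int P dvd W"
      using unit[of "z b"] i1 mod_in(2) by (auto simp: W_def z_def dvd_add_left_iff)
    then have "coprime W M" by (simp add: coprime_m_iff)
    with * have "[gsum (nat a) i 1 = gsum (nat a2) i 1] (mod M)" by (simp add: cong_mult_lcancel)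
    then have "nat a = nat a2" using ab ab2 by (intro gsum_inj[OF primeP m ci]) auto
    then show "w = w'" using ab ab2 bb by simp
  qed
  show ?thesis using X Y Xm Yn rel inj by (simp add: pairs_def)
qed

lemma pairs_eq_sols: "pairs = sols"
  using pairs_sols sols_pairs by (auto simp: subset_iff) 

end

section \<open>Counting the pairs\<close>

context sd_data
begin

lemma root_coprime: "M dvd x ^ n - 1 \<Longrightarrow> coprime x M"
proof -
  assume "M dvd x ^ n - 1"
  then have "coprime (x ^ n) M" by (metis cong_iff_dvd_diff cong_imp_coprime cong_sym coprime_1_left)
  then show ?thesis using n_pos by simp
qed

text \<open>Since \<open>n\<close> is a unit modulo \<open>P\<close>, reduction modulo \<open>P\<close> is injective on the \<open>n\<close>-th roots of unity.\<close>

lemma roots_cong: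
  assumes x: "M dvd x ^ n - 1" and y: "M dvd y ^ n - 1" and xy: "int P dvd x - y"
  shows "M dvd x - y" "coprime (gsum n x y) M"
proof -
  have "[x = y] (mod int P)" using xy by (simp add: cong_iff_dvd_diff)
  then have "[gsum n x y = int n * y ^ (n - 1)] (mod int P)"
    using gsum_cong[of x y "int P" y y n] by (simp add: gsum_same)
  moreover have "coprime (int n * y ^ (n - 1)) M" using root_coprime[OF y] coprime_nm by simp
  ultimately show g: "coprime (gsum n x y) M" unfolding coprime_m_iff by (metis cong_dvd_iff)
  have "M dvd (x - y) * gsum n x y" unfolding gsum_mult by (rule dvd_lin[OF x y, of _ 1 "-1"]) simp
  then show "M dvd x - y" using g by (simp add: coprime_dvd_mult_left_iff coprime_commute)
qed

text \<open>Distinct roots already differ modulo P, so x - y is a unit and the vanishing of x^n -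
  y^n falls on the cofactor.\<close>

lemma roots_gsum:
  assumes x: "M dvd x ^ n - 1" and y: "M dvd y ^ n - 1" and xy: "\<not> M dvd x - y"
  shows "M dvd gsum n x y"
proof -
  have "\<not> int P dvd x - y" using roots_cong(1)[OF x y] xy by blast
  then have "coprime (x - y) M" by (simp add: coprime_m_iff)
  moreover have "M dvd (x - y) * gsum n x y" unfolding gsum_mult by (rule dvd_lin[OF x y, of _ 1 "-1"]) simp
  ultimately show ?thesis by (simp add: coprime_dvd_mult_right_iff coprime_commute)
qed

text \<open>These are the values of u' or c' compatible with Y^n = 1. For n-th roots of unity x and
  y the set is {0} if they agree modulo m and everything otherwise.\<close>

definition ann :: "int \<Rightarrow> int \<Rightarrow> int set" where
  "ann x y = {w \<in> {0..<M}. M dvd w * gsum n x y}"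

lemma ann_same:
  assumes x: "M dvd x ^ n - 1" and y: "M dvd y ^ n - 1" and xy: "M dvd x - y"
  shows "ann x y = {0}"
proof -
  have "int P dvd x - y" using xy P_dvd_m by (rule dvd_trans[rotated])
  then have "coprime (gsum n x y) M" using roots_cong[OF x y] by blast
  then have "M dvd w * gsum n x y \<longleftrightarrow> M dvd w" for w by (simp add: coprime_dvd_mult_left_iff coprime_commute)
  then show ?thesis using m_pos by (auto simp: ann_def zdvd_not_zless order_le_less)
qed

lemma card_ann:
  assumes x: "M dvd x ^ n - 1" and y: "M dvd y ^ n - 1"
  shows "card (ann x y) = (if M dvd x - y then 1 else m)"
proof (cases "M dvd x - y")
  case True
  then show ?thesis using ann_same[OF x y] by simp
next
  case False
  then have "ann x y = {0..<M}" using roots_gsum[OF x y] by (auto simp: ann_def)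
  then show ?thesis using False by simp
qed

lemma dvd_mod_iff_m: "M dvd x mod M - y \<longleftrightarrow> M dvd x - y"
  by (metis cong_iff_dvd_diff cong_mod_left)

lemma ann_cong: "M dvd x - x' \<Longrightarrow> ann x y = ann x' y"
proof -
  assume "M dvd x - x'"
  then have "[x = x'] (mod M)" by (simp add: cong_iff_dvd_diff)
  then have "[w * gsum n x y = w * gsum n x' y] (mod M)" for w by (intro cong_mult gsum_cong cong_refl)
  then show ?thesis unfolding ann_def by (metis cong_dvd_iff)
qed

text \<open>The solutions in which \<open>u\<close> is a unit, \<open>e\<close> being the linear coefficient of \<open>Y\<close>; exchanging the roles
  of \<open>(u, u')\<close> and \<open>(c, c')\<close> gives those in which \<open>c\<close> is a unit.\<close>

definition half :: "int \<Rightarrow> int \<Rightarrow> int \<Rightarrow> int \<Rightarrow> int \<Rightarrow> (int \<times> int \<times> int \<times> int \<times> int) set" where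
  "half i x1 x2 y1 y2 = {(e, u, c, u', c'). e \<in> {0..<M} \<and> u \<in> {0..<M} \<and> c \<in> {0..<M} \<and> u' \<in> {0..<M} \<and> c' \<in> {0..<M} \<and>
     M dvd (e - x1) * u - (i - 1) * u' \<and> M dvd (e - x2) * c - (i - 1) * c' \<and> M dvd e ^ n - 1 \<and>
     M dvd u' * gsum n e y1 \<and> M dvd c' * gsum n e y2 \<and> \<not> int P dvd u}"

text \<open>Modulo P the equation reads (e - x) u = 0 with u a unit, and a root of unity modulo m is
  determined by its residue modulo P.\<close>

lemma half_root:
  assumes i: "int P dvd i - 1" and x: "M dvd x ^ n - 1" "M dvd e ^ n - 1"
    and e: "M dvd (e - x) * u - (i - 1) * u'" and u: "\<not> int P dvd u" and "e \<in> {0..<M}"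
  shows "M dvd e - x" "e = x mod M"
proof -
  have "int P dvd (e - x) * u - (i - 1) * u'" using e P_dvd_m by (rule dvd_trans[rotated])
  then have "int P dvd (e - x) * u" by (rule dvd_lin[of _ _ "i - 1" _ 1 u']) (use i in auto)
  then have "int P dvd e - x" using u primeP by (simp add: prime_dvd_mult_iff)
  then show *: "M dvd e - x" using roots_cong(1) x by blast
  then have "[e = x] (mod M)" by (simp add: cong_iff_dvd_diff)
  then show "e = x mod M" using \<open>e \<in> {0..<M}\<close> by (simp add: cong_def)
qed

text \<open>With e = x1 the second equation becomes (x1 - x2) c = 0 modulo P.\<close>

lemma half_other:
  assumes i: "int P dvd i - 1" and e: "M dvd e - x1" and x12: "\<not> int P dvd x1 - x2"
    and c: "M dvd (e - x2) * c - (i - 1) * c'"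
  shows "int P dvd c"
proof -
  have "M dvd (x1 - x2) * c - (i - 1) * c'"
    by (rule dvd_lin[OF c e, of _ 1 "- c"]) (simp add: algebra_simps)
  then have "int P dvd (x1 - x2) * c - (i - 1) * c'" using P_dvd_m by (rule dvd_trans[rotated])
  then have "int P dvd (x1 - x2) * c" by (rule dvd_lin[of _ _ "i - 1" _ 1 c']) (use i in auto)
  then show ?thesis using x12 primeP by (simp add: prime_dvd_mult_iff)
qed

text \<open>The unit u and the annihilated u', c' can be chosen freely. Then e has to be x1, and c
  is (i - 1) c' / (x1 - x2).\<close>

lemma card_half:
  assumes i: "int P dvd i - 1" and x1: "M dvd x1 ^ n - 1" and y1: "M dvd y1 ^ n - 1"
    and x12: "\<not> int P dvd x1 - x2" and ix: "M dvd i - 1 \<or> M dvd x1 - y1"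
  shows "card (half i x1 x2 y1 y2) = card U * card (ann x1 y1) * card (ann x1 y2)"
proof -
  have "coprime (x1 - x2) M" using x12 by (simp add: coprime_m_iff)
  then obtain h where "[(x1 - x2) * h = 1] (mod M)" by (metis coprime_iff_invertible_int)
  then have h: "M dvd (x1 - x2) * h - 1" by (simp add: cong_iff_dvd_diff)
  define x where "x = x1 mod M"
  have xx: "M dvd x - x1" "x \<in> {0..<M}" using m_pos by (simp_all add: x_def dvd_mod_iff_m)
  have xn: "M dvd x ^ n - 1"
  proof -
    have "[x ^ n = x1 ^ n] (mod M)" by (intro cong_pow) (simp add: x_def)
    then have "M dvd x ^ n - x1 ^ n" by (simp add: cong_iff_dvd_diff)
    from dvd_lin[OF this x1, of _ 1 1] show ?thesis by simp
  qed
  have a1: "ann x y1 = ann x1 y1" "ann x y2 = ann x1 y2" using ann_cong[OF xx(1)] by auto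
  define f where "f = (\<lambda>(u::int, u'::int, c'). (x, u, ((i - 1) * c' * h) mod M, u', c'))"
  have "bij_betw f (U \<times> ann x1 y1 \<times> ann x1 y2) (half i x1 x2 y1 y2)"
  proof (rule bij_betwI[where g="\<lambda>(e, u, c, u', c'). (u, u', c')"])
    show "f \<in> U \<times> ann x1 y1 \<times> ann x1 y2 \<rightarrow> half i x1 x2 y1 y2"
    proof
      fix w assume "w \<in> U \<times> ann x1 y1 \<times> ann x1 y2"
      then obtain u u' c' where w: "w = (u, u', c')" "u \<in> U" "u' \<in> ann x y1" "c' \<in> ann x y2" using a1 by auto
      define c where "c = ((i - 1) * c' * h) mod M"
      have c: "M dvd c - (i - 1) * c' * h" by (simp add: c_def dvd_mod_iff_m)
      \<comment> \<open>The first equation with e = x1 asks for (i - 1) u' = 0. By \<open>ix\<close>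
        either i = 1, or x1 = y1 and then u' = 0.\<close>
      have z: "M dvd (i - 1) * u'"
        using ix
      proof
        assume "M dvd x1 - y1"
        then have "u' = 0" using w(3) ann_same[OF x1 y1] a1 by auto
        then show ?thesis by simp
      qed simp
      have "M dvd (x - x1) * u - (i - 1) * u'" by (rule dvd_lin[OF xx(1) z, of _ u "-1"]) (simp add: algebra_simps)
      moreover have "M dvd (x - x2) * c - (i - 1) * c'"
        by (rule dvd_lin[OF dvd_lin[OF xx(1) c refl, of c "x1 - x2"] h, of _ 1 "(i - 1) * c'"]) (simp add: algebra_simps)
      moreover have "\<not> int P dvd u" using w(2) by (simp add: U_def coprime_m_iff)
      ultimately show "f w \<in> half i x1 x2 y1 y2"
        using w xx xn m_pos by (simp add: f_def half_def U_def ann_def c_def)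
    qed
    fix w assume "w \<in> half i x1 x2 y1 y2"
    then obtain e u c u' c' where w: "w = (e, u, c, u', c')" "e \<in> {0..<M}" "u \<in> {0..<M}" "c \<in> {0..<M}" "u' \<in> {0..<M}" "c' \<in> {0..<M}"
      "M dvd (e - x1) * u - (i - 1) * u'" "M dvd (e - x2) * c - (i - 1) * c'" "M dvd e ^ n - 1"
      "M dvd u' * gsum n e y1" "M dvd c' * gsum n e y2" "\<not> int P dvd u"
      unfolding half_def by blast
    note e = half_root[OF i x1 w(9,7,12,2)]
    have "M dvd c - (i - 1) * c' * h"
      by (rule dvd_lin[OF dvd_lin[OF e(1) w(8) refl, of "- (c * h)" "h"] h, of _ 1 "- c"]) (simp add: algebra_simps)
    then have "c mod M = ((i - 1) * c' * h) mod M" by (simp add: mod_eq_dvd_iff)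
    then show "f (case w of (e, u, c, u', c') \<Rightarrow> (u, u', c')) = w" using w e by (simp add: f_def x_def)
  next
    show "(\<lambda>(e, u, c, u', c'). (u, u', c')) \<in> half i x1 x2 y1 y2 \<rightarrow> U \<times> ann x1 y1 \<times> ann x1 y2"
    proof
      fix w assume "w \<in> half i x1 x2 y1 y2"
      then obtain e u c u' c' where w: "w = (e, u, c, u', c')" "e \<in> {0..<M}" "u \<in> {0..<M}" "c \<in> {0..<M}" "u' \<in> {0..<M}" "c' \<in> {0..<M}"
        "M dvd (e - x1) * u - (i - 1) * u'" "M dvd (e - x2) * c - (i - 1) * c'" "M dvd e ^ n - 1"
        "M dvd u' * gsum n e y1" "M dvd c' * gsum n e y2" "\<not> int P dvd u"
        unfolding half_def by blast
      note e = half_root[OF i x1 w(9,7,12,2)]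
      have "u' \<in> ann e y1" "c' \<in> ann e y2" using w by (simp_all add: ann_def)
      then show "(case w of (e, u, c, u', c') \<Rightarrow> (u, u', c')) \<in> U \<times> ann x1 y1 \<times> ann x1 y2"
        using w ann_cong[OF e(1)] by (simp add: U_def coprime_m_iff)
    qed
  qed (auto simp: f_def)
  from bij_betw_same_card[OF this] show ?thesis by (simp add: card_cartesian_product)
qed

definition V :: "int set" where "V = {v \<in> {0..<N}. coprime v N}"
definition J1 :: "int set" where "J1 = {j \<in> J. int Q dvd j - 1}"

text \<open>From chi(j) = chi(1) one gets chi(j - 1) = 1, which is impossible for j - 1 prime to
  Q.\<close>

lemma J1_eq_J: assumes s: "s \<noteq> 1" shows "J1 = J"
proof -
  have "int Q dvd j - 1" if j: "j \<in> J" for j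
  proof (rule ccontr)
    assume "\<not> int Q dvd j - 1"
    then have cop: "coprime (chi (j - 1) - 1) M" using coprime_chi_minus_one[OF s] coprime_n_iff by blast
    have 1: "[chi j = chi (j - 1) * chi 1] (mod M)" using chi_add[of "j - 1" 1] by simp
    have 2: "[chi j = chi 1] (mod M)" using j chi_1 unfolding J_def by (blast intro: cong_trans cong_sym)
    have "[chi (j - 1) = 1] (mod M)"
      using cong_trans[OF cong_sym[OF 1] 2] cong_mult_rcancel[OF coprime_chi[of 1], of "chi (j - 1)" 1] by simp
    then have "M dvd chi (j - 1) - 1" by (simp add: cong_iff_dvd_diff)
    then have "M dvd 1" using cop by (metis coprime_common_divisor dvd_refl)
    then show False using m_pos by simp
  qed
  then show ?thesis by (auto simp: J1_def)
qed

lemma finite_VJ: "finite V" "finite J1"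
  using finite_sets(2) by (auto simp: V_def J1_def intro: finite_subset[of _ "{0..<N}"])

end

lemma card_coprime_int:
  assumes "n > 1"
  shows "card {v \<in> {0..<int n}. coprime v (int n)} = totient n"
proof -
  have "bij_betw int (totatives n) {v \<in> {0..<int n}. coprime v (int n)}"
  proof (rule bij_betwI[where g=nat])
    show "int \<in> totatives n \<rightarrow> {v \<in> {0..<int n}. coprime v (int n)}"
      using assms by (auto simp: totatives_def intro: totatives_less)
        (metis One_nat_def coprime_common_divisor_nat dvd_refl less_irrefl nat_dvd_1_iff_1 order_le_less)
    show "nat \<in> {v \<in> {0..<int n}. coprime v (int n)} \<rightarrow> totatives n"
    proof
      fix v assume "v \<in> {v \<in> {0..<int n}. coprime v (int n)}"
      then have v: "0 \<le> v" "v < int n" "coprime v (int n)" by auto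
      have "v \<noteq> 0" using v assms by auto
      have "int (nat v) = v" using v by simp
      then have "coprime (int (nat v)) (int n)" using v(3) by (simp only:)
      then have "coprime (nat v) n" by (simp only: coprime_int_iff)
      then show "nat v \<in> totatives n" using v \<open>v \<noteq> 0\<close> by (simp add: totatives_def)
    qed
  qed auto
  from bij_betw_same_card[OF this] show ?thesis by (simp only: totient_def)
qed

lemma card_residue_class:
  assumes "d > 0" "d dvd m"
  shows "card {i \<in> {0..<int m}. int d dvd i - x} = m div d"
proof -
  obtain k where k: "m = d * k" using assms by auto
  have mm: "int m = int d * int k" by (simp add: k)
  define y where "y = x mod int d"
  have y: "0 \<le> y" "y < int d" "int d dvd y - x" using assms by (simp_all add: y_def mod_eq_dvd_iff[symmetric])
  have lt: "y + int d * z < int m \<longleftrightarrow> z < int k" for z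
  proof
    assume "y + int d * z < int m"
    then have "int d * z < int d * int k" using y(1) mm by linarith
    then show "z < int k" using assms by simp
  next
    assume "z < int k"
    then have "int d * (z + 1) \<le> int d * int k" by (intro mult_left_mono) auto
    then have "int d * z + int d \<le> int d * int k" by (simp add: algebra_simps)
    then show "y + int d * z < int m" using y(2) mm by linarith
  qed
  have "bij_betw (\<lambda>z. y + int d * z) {0..<int k} {i \<in> {0..<int m}. int d dvd i - x}"
  proof (rule bij_betwI[where g="\<lambda>i. (i - y) div int d"])
    have "int d dvd y + int d * z - x" for z
      by (rule dvd_lin[OF y(3) dvd_triv_left, of _ 1 1 z]) simp
    then show "(\<lambda>z. y + int d * z) \<in> {0..<int k} \<rightarrow> {i \<in> {0..<int m}. int d dvd i - x}"
      using y lt by auto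
  next
    have ex: "\<exists>z. i = y + int d * z" if "int d dvd i - x" for i
    proof -
      have "int d dvd i - y" by (rule dvd_lin[OF that y(3), of _ 1 "-1"]) simp
      then obtain z where "i - y = int d * z" by (rule dvdE)
      then have "i = y + int d * z" by simp
      then show ?thesis ..
    qed
    show "(\<lambda>i. (i - y) div int d) \<in> {i \<in> {0..<int m}. int d dvd i - x} \<rightarrow> {0..<int k}"
    proof
      fix i assume i: "i \<in> {i \<in> {0..<int m}. int d dvd i - x}"
      then obtain z where z: "i = y + int d * z" using ex by blast
      have "\<not> z \<le> -1"
      proof
        assume "z \<le> -1"
        then have "int d * z \<le> int d * (-1)" by (intro mult_left_mono) auto
        then show False using z i y by simp
      qed
      then show "(i - y) div int d \<in> {0..<int k}" using i z lt assms by auto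
    qed
    fix i assume "i \<in> {i \<in> {0..<int m}. int d dvd i - x}"
    then obtain z where "i = y + int d * z" using ex by blast
    then show "y + int d * ((i - y) div int d) = i" using assms by simp
  qed (use assms in auto)
  from bij_betw_same_card[OF this] show ?thesis using assms by (simp add: k)
qed

context sd_pair
begin

definition I :: "int set" where "I = {i \<in> U. int P dvd i - 1 \<and> M dvd i ^ r - i}"

text \<open>For r = 1 the equation i^r = i is void and all residues 1 modulo P survive; otherwise it
  forces i = 1.\<close>

lemma card_I: "card I = (if r = 1 then m div P else 1)"
proof (cases "r = 1")
  case True
  have "I = {i \<in> {0..<M}. int P dvd i - 1}"
  proof -
    have "coprime i M" if "int P dvd i - 1" for i
      unfolding coprime_m_iff
    proof
      assume "int P dvd i"
      then have "int P dvd 1" using that by (metis dvd_diff_commute dvd_diff_left_iff)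
      then show False using prime_gt_1_nat[OF primeP] by simp
    qed
    moreover have "i ^ r - i = 0" for i :: int using True by simp
    ultimately show ?thesis by (auto simp: I_def U_def)
  qed
  then show ?thesis using True card_residue_class[of P m 1] prime_gt_0_nat[OF primeP] P_dvd_m by simp
next
  case False
  have "I = {1}"
  proof -
    have "i = 1" if "i \<in> I" for i
    proof -
      have "M dvd i - 1" using that i_or_r[of i] False by (auto simp: I_def)
      then have "[i = 1] (mod M)" by (simp add: cong_iff_dvd_diff)
      then show ?thesis using that m_pos by (intro lt_eq_mod_m) (auto simp: I_def U_def)
    qed
    moreover have "1 \<in> I" using m_pos by (simp add: I_def U_def)
    ultimately show ?thesis by auto
  qed
  then show ?thesis using False by simp
qed

text \<open>What is left to choose once i, v' and j' are fixed, with e written for i'. None of these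
  conditions involves j', which therefore contributes just the factor
  \<open>card J1\<close>.\<close>

definition fibre :: "int \<Rightarrow> int \<Rightarrow> (int \<times> int \<times> int \<times> int \<times> int) set" where
  "fibre i v = {(e, u, c, u', c'). e \<in> {0..<M} \<and> u \<in> {0..<M} \<and> c \<in> C \<and> u' \<in> {0..<M} \<and> c' \<in> C \<and>
     M dvd (e - int r) * u - (i - 1) * u' \<and> M dvd (e - int r * chi v) * c - (i - 1) * c' \<and> M dvd e ^ n - 1 \<and>
     M dvd u' * gsum n e 1 \<and> M dvd c' * gsum n e (chi v) \<and> (\<forall>b\<in>{0..<N}. \<not> int P dvd u + c * chi b)}"

lemma finite_fibre: "finite (fibre i v)"
  by (rule finite_subset[of _ "{0..<M} \<times> {0..<M} \<times> C \<times> {0..<M} \<times> C"]) (auto simp: fibre_def finite_sets)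

lemma card_sols: "card sols = (\<Sum>i\<in>I. \<Sum>v\<in>V. card J1 * card (fibre i v))"
proof -
  have "bij_betw (\<lambda>((i, v, j), (e, u, c, u', c')). ((u, i, c, 0, 1), (u', e, c', v, j)))
     (SIGMA x : I \<times> V \<times> J1. fibre (fst x) (fst (snd x))) sols"
  proof (rule bij_betwI[where g="\<lambda>((u, i, c, v, j), (u', e, c', v', j')). ((i, v', j'), (e, u, c, u', c'))"])
    have "(0::int) \<in> {0..<N}" "1 \<in> J" using id_in_\<Theta> by (auto simp: \<Theta>_def)
    then show "(\<lambda>((i, v, j), (e, u, c, u', c')). ((u, i, c, 0, 1), (u', e, c', v, j)))
        \<in> (SIGMA x : I \<times> V \<times> J1. fibre (fst x) (fst (snd x))) \<rightarrow> sols"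
      by (auto simp: sols_def fibre_def I_def V_def J1_def \<Theta>_def U_def root_coprime)
    show "(\<lambda>((u, i, c, v, j), (u', e, c', v', j')). ((i, v', j'), (e, u, c, u', c')))
        \<in> sols \<rightarrow> (SIGMA x : I \<times> V \<times> J1. fibre (fst x) (fst (snd x)))"
      by (auto simp: sols_def fibre_def I_def V_def J1_def \<Theta>_def U_def)
  qed (auto simp: sols_def)
  then have "card sols = card (SIGMA x : I \<times> V \<times> J1. fibre (fst x) (fst (snd x)))" by (simp add: bij_betw_same_card)
  also have "\<dots> = (\<Sum>x\<in>I \<times> V \<times> J1. card (fibre (fst x) (fst (snd x))))"
    by (rule card_SigmaI) (auto simp: finite_fibre finite_VJ I_def finite_sets)
  also have "\<dots> = (\<Sum>i\<in>I. \<Sum>w\<in>V \<times> J1. card (fibre i (fst w)))"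
    unfolding sum.cartesian_product split_beta ..
  also have "\<dots> = (\<Sum>i\<in>I. \<Sum>v\<in>V. \<Sum>j\<in>J1. card (fibre i v))"
    unfolding sum.cartesian_product split_beta ..
  finally show ?thesis by simp
qed

lemma r_root: "M dvd int r ^ n - 1"
proof -
  have "[int r ^ n = 1] (mod M)" using B.s_pow by (metis cong_int_iff of_nat_1 of_nat_power)
  then show ?thesis by (simp add: cong_iff_dvd_diff)
qed

lemma chi_root: "M dvd chi v ^ n - 1"
  using chi_pow_n[of v] by (simp add: cong_iff_dvd_diff)

lemma rchi_root: "M dvd (int r * chi v) ^ n - 1"
  by (rule dvd_lin[OF r_root[THEN dvd_mult2] chi_root, of _ 1 "chi v ^ n" 1]) (simp add: algebra_simps power_mult_distrib)

lemma one_root: "M dvd 1 ^ n - 1" by simp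

text \<open>By \<open>B.s_cases\<close> the value 1 is the only admissible r congruent to 1 modulo
  P.\<close>

lemma r_one: "M dvd int r - 1 \<longleftrightarrow> r = 1"
proof
  assume "M dvd int r - 1"
  then have "[int r = 1] (mod M)" by (simp add: cong_iff_dvd_diff)
  then have "[int r = int 1] (mod int P)" using P_cong by simp
  then have "[r = 1] (mod P)" by (simp only: cong_int_iff)
  moreover have "\<not> Q dvd 1" using primeQ by (metis not_prime_unit)
  ultimately show "r = 1" using B.s_cases by (metis power_one_right)
qed simp

lemma coprime_r: "coprime (int r) M" using r_root by (rule root_coprime)

lemma swap_half: "(\<lambda>(e, u, c, u', c'). (e, c, u, c', u')) ` half i x1 x2 y1 y2 =
  {(e, c, u, c', u'). (e, u, c, u', c') \<in> half i x1 x2 y1 y2}"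
  by (auto simp: image_iff) (rule bexI[rotated], assumption, simp)

lemma fibre_zero: "(e, u, c, u', c') \<in> fibre i v \<Longrightarrow> \<not> int P dvd u + c"
proof -
  assume "(e, u, c, u', c') \<in> fibre i v"
  then have "\<forall>b\<in>{0..<N}. \<not> int P dvd u + c * chi b" unfolding fibre_def by blast
  from bspec[OF this, of 0] show ?thesis using n_pos by simp
qed

text \<open>If u is a unit then e = r and P divides c; if c is a unit then e = r chi(v) and P
  divides u. These exclude each other, and in both cases u + c chi(b) is automatically a unit.
  Neither being a unit contradicts regularity at b = 0.\<close>

lemma card_fibre_halves:
  assumes s: "s \<noteq> 1" and i: "i \<in> I" and v: "v \<in> V"
  shows "card (fibre i v) = card (half i (int r) (int r * chi v) 1 (chi v)) + card (half i (int r * chi v) (int r) (chi v) 1)"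
proof -
  let ?x = "int r" and ?y = "int r * chi v"
  let ?sw = "(\<lambda>(e, u, c, u', c'). (e, c, u, c', u'))"
  have i1: "int P dvd i - 1" using i by (simp add: I_def)
  have "coprime (chi v - 1) M" using v coprime_chi_minus_one[OF s] by (simp add: V_def)
  then have "coprime (int r * (chi v - 1)) M" using coprime_r by simp
  then have "\<not> int P dvd int r * (chi v - 1)" by (simp add: coprime_m_iff)
  then have xy: "\<not> int P dvd ?y - ?x" "\<not> int P dvd ?x - ?y"
    by (simp_all add: algebra_simps) (simp add: dvd_diff_commute)
  have CC: "C = {0..<M}" using s by (simp add: C_def)
  have A: "half i ?x ?y 1 (chi v) \<subseteq> fibre i v"
  proof
    fix w assume w0: "w \<in> half i ?x ?y 1 (chi v)"
    then obtain e u c u' c' where w: "w = (e, u, c, u', c')" by (cases w)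
    from w0 have h: "e \<in> {0..<M}" "M dvd (e - ?x) * u - (i - 1) * u'" "M dvd (e - ?y) * c - (i - 1) * c'" "M dvd e ^ n - 1" "\<not> int P dvd u"
      by (simp_all add: half_def w)
    have "M dvd e - ?x" using half_root(1)[OF i1 r_root h(4,2,5,1)] .
    then have "int P dvd c" using half_other[OF i1 _ xy(2) h(3)] by blast
    then have "\<not> int P dvd u + c * chi b" for b using h(5) by (simp add: dvd_add_left_iff)
    then show "w \<in> fibre i v" using w0 by (simp add: w half_def fibre_def CC)
  qed
  have Bb: "?sw ` half i ?y ?x (chi v) 1 \<subseteq> fibre i v"
  proof
    fix w assume "w \<in> ?sw ` half i ?y ?x (chi v) 1"
    then obtain e u c u' c' where w: "w = (e, u, c, u', c')" and w0: "(e, c, u, c', u') \<in> half i ?y ?x (chi v) 1" by auto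
    from w0 have h: "e \<in> {0..<M}" "M dvd (e - ?y) * c - (i - 1) * c'" "M dvd (e - ?x) * u - (i - 1) * u'" "M dvd e ^ n - 1" "\<not> int P dvd c"
      by (simp_all add: half_def)
    have "M dvd e - ?y" using half_root(1)[OF i1 rchi_root h(4,2,5,1)] .
    then have pu: "int P dvd u" using half_other[OF i1 _ xy(1) h(3)] by blast
    have "\<not> int P dvd u + c * chi b" for b
    proof -
      have "\<not> int P dvd chi b" using coprime_chi[of b] by (simp add: coprime_m_iff)
      then show ?thesis using h(5) pu primeP by (simp add: dvd_add_right_iff prime_dvd_mult_iff)
    qed
    then show "w \<in> fibre i v" using w0 by (simp add: w half_def fibre_def CC)
  qed
  have U: "w \<in> half i ?x ?y 1 (chi v) \<union> ?sw ` half i ?y ?x (chi v) 1" if w0: "w \<in> fibre i v" for w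
  proof -
    obtain e u c u' c' where w: "w = (e, u, c, u', c')" by (cases w)
    have "\<not> int P dvd u + c" using w0 fibre_zero by (simp add: w)
    then consider "\<not> int P dvd u" | "\<not> int P dvd c" using dvd_add by blast
    then show ?thesis
    proof cases
      case 1
      then have "w \<in> half i ?x ?y 1 (chi v)" using w0 by (simp add: w half_def fibre_def CC)
      then show ?thesis ..
    next
      case 2
      then have "(e, c, u, c', u') \<in> half i ?y ?x (chi v) 1" using w0 by (simp add: w half_def fibre_def CC)
      then have "w \<in> ?sw ` half i ?y ?x (chi v) 1" unfolding swap_half w by simp
      then show ?thesis ..
    qed
  qed
  have D: "half i ?x ?y 1 (chi v) \<inter> ?sw ` half i ?y ?x (chi v) 1 = {}"
  proof (rule ccontr)
    assume "half i ?x ?y 1 (chi v) \<inter> ?sw ` half i ?y ?x (chi v) 1 \<noteq> {}"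
    then obtain w where ww: "w \<in> half i ?x ?y 1 (chi v)" "w \<in> ?sw ` half i ?y ?x (chi v) 1" by blast
    obtain e u c u' c' where w: "w = (e, u, c, u', c')" by (cases w)
    have h: "e \<in> {0..<M}" "M dvd (e - ?x) * u - (i - 1) * u'" "M dvd (e - ?y) * c - (i - 1) * c'" "M dvd e ^ n - 1" "\<not> int P dvd u"
      using ww(1) by (simp_all add: half_def w)
    have "M dvd e - ?x" using half_root(1)[OF i1 r_root h(4,2,5,1)] .
    then have "int P dvd c" using half_other[OF i1 _ xy(2) h(3)] by blast
    moreover have "\<not> int P dvd c" using ww(2) unfolding swap_half by (simp add: w half_def)
    ultimately show False by simp
  qed
  have "fibre i v = half i ?x ?y 1 (chi v) \<union> ?sw ` half i ?y ?x (chi v) 1" using A Bb U by blast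
  moreover have "finite (half i ?x ?y 1 (chi v))" "finite (?sw ` half i ?y ?x (chi v) 1)"
    using A Bb finite_fibre finite_subset by blast+
  ultimately have "card (fibre i v) = card (half i ?x ?y 1 (chi v)) + card (?sw ` half i ?y ?x (chi v) 1)"
    using D by (simp add: card_Un_disjoint)
  also have "card (?sw ` half i ?y ?x (chi v) 1) = card (half i ?y ?x (chi v) 1)"
    by (rule card_image) (auto simp: inj_on_def)
  finally show ?thesis .
qed

text \<open>In each half one annihilator compares e with its own partner, which amounts to r = 1.
  The other compares r with chi(v) in the first half, and r chi(v) with 1 in the second.\<close>

lemma card_fibre_nontriv:
  assumes s: "s \<noteq> 1" and i: "i \<in> I" and v: "v \<in> V"
  shows "card (fibre i v) = card U * (if r = 1 then 1 else m) *
    ((if M dvd int r - chi v then 1 else m) + (if M dvd int r * chi v - 1 then 1 else m))"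
proof -
  let ?x = "int r" and ?y = "int r * chi v"
  have i1: "int P dvd i - 1" "M dvd i ^ r - i" using i by (simp_all add: I_def)
  have "coprime (chi v - 1) M" using v coprime_chi_minus_one[OF s] by (simp add: V_def)
  then have "coprime (int r * (chi v - 1)) M" using coprime_r by simp
  then have "\<not> int P dvd int r * (chi v - 1)" by (simp add: coprime_m_iff)
  then have xy: "\<not> int P dvd ?y - ?x" "\<not> int P dvd ?x - ?y"
    by (simp_all add: algebra_simps) (simp add: dvd_diff_commute)
  have yr: "M dvd ?y - chi v \<longleftrightarrow> r = 1"
  proof -
    have "?y - chi v = (int r - 1) * chi v" by (simp add: algebra_simps)
    then have "M dvd ?y - chi v \<longleftrightarrow> M dvd int r - 1"
      using coprime_chi[of v] by (simp add: coprime_dvd_mult_left_iff coprime_commute)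
    then show ?thesis by (simp add: r_one)
  qed
  have ir: "M dvd i - 1 \<or> M dvd int r - 1" "M dvd i - 1 \<or> M dvd ?y - chi v"
    using i_or_r[OF i1] yr by auto
  have h1: "card (half i ?x ?y 1 (chi v)) = card U * (if r = 1 then 1 else m) * (if M dvd int r - chi v then 1 else m)"
    using card_half[OF i1(1) r_root one_root xy(2) ir(1), of "chi v"] by (simp add: card_ann r_root chi_root r_one)
  have h2: "card (half i ?y ?x (chi v) 1) = card U * (if r = 1 then 1 else m) * (if M dvd ?y - 1 then 1 else m)"
    using card_half[OF i1(1) rchi_root chi_root xy(1) ir(2), of 1] by (simp add: card_ann rchi_root chi_root yr)
  show ?thesis unfolding card_fibre_halves[OF s i v] h1 h2 by (simp add: algebra_simps)
qed

text \<open>With c = c' = 0 there is a single half: e is r, u is any unit, and u' ranges over one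
  annihilator.\<close>

lemma card_fibre_triv:
  assumes s: "s = 1" and i: "i \<in> I"
  shows "card (fibre i v) = card U * (if r = 1 then 1 else m)"
proof -
  have i1: "int P dvd i - 1" "M dvd i ^ r - i" using i by (simp_all add: I_def)
  have CC: "C = {0}" unfolding C_def using s by simp
  define x where "x = int r mod M"
  have xx: "M dvd x - int r" "x \<in> {0..<M}" using m_pos by (simp_all add: x_def dvd_mod_iff_m)
  have xn: "M dvd x ^ n - 1"
  proof -
    have "[x ^ n = int r ^ n] (mod M)" by (intro cong_pow) (simp add: x_def)
    then have "M dvd x ^ n - int r ^ n" by (simp add: cong_iff_dvd_diff)
    from dvd_lin[OF this r_root, of _ 1 1] show ?thesis by simp
  qed
  have a1: "ann x 1 = ann (int r) 1" using ann_cong[OF xx(1)] .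
  have "bij_betw (\<lambda>(u, u'). (x, u, 0, u', 0)) (U \<times> ann (int r) 1) (fibre i v)"
  proof (rule bij_betwI[where g="\<lambda>(e, u, c, u', c'). (u, u')"])
    show "(\<lambda>(u, u'). (x, u, 0, u', 0)) \<in> U \<times> ann (int r) 1 \<rightarrow> fibre i v"
    proof
      fix w assume "w \<in> U \<times> ann (int r) 1"
      then obtain u u' where w: "w = (u, u')" "u \<in> U" "u' \<in> ann x 1" using a1 by auto
      have z: "M dvd (i - 1) * u'"
        using i_or_r[OF i1]
      proof
        assume "r = 1"
        then have "u' = 0" using w(3) ann_same[OF r_root one_root] a1 by auto
        then show ?thesis by simp
      qed simp
      have "M dvd (x - int r) * u - (i - 1) * u'" by (rule dvd_lin[OF xx(1) z, of _ u "-1"]) (simp add: algebra_simps)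
      moreover have "\<not> int P dvd u" using w(2) by (simp add: U_def coprime_m_iff)
      ultimately show "(case w of (u, u') \<Rightarrow> (x, u, 0, u', 0)) \<in> fibre i v"
        using w xx xn by (simp add: fibre_def U_def ann_def CC)
    qed
    fix w assume w0: "w \<in> fibre i v"
    then obtain e u c u' c' where w: "w = (e, u, c, u', c')" by (cases w)
    have h: "e \<in> {0..<M}" "M dvd (e - int r) * u - (i - 1) * u'" "M dvd e ^ n - 1" "\<not> int P dvd u" "c = 0" "c' = 0"
      using w0 fibre_zero[of e u c u' c' i v] by (auto simp: w fibre_def CC)
    show "(case (case w of (e, u, c, u', c') \<Rightarrow> (u, u')) of (u, u') \<Rightarrow> (x, u, 0, u', 0)) = w"
      using half_root(2)[OF i1(1) r_root h(3,2,4,1)] h by (simp add: w x_def)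
  next
    show "(\<lambda>(e, u, c, u', c'). (u, u')) \<in> fibre i v \<rightarrow> U \<times> ann (int r) 1"
    proof
      fix w assume w0: "w \<in> fibre i v"
      then obtain e u c u' c' where w: "w = (e, u, c, u', c')" by (cases w)
      have h: "e \<in> {0..<M}" "M dvd (e - int r) * u - (i - 1) * u'" "M dvd e ^ n - 1" "\<not> int P dvd u" "u \<in> {0..<M}" "u' \<in> ann e 1"
        using w0 fibre_zero[of e u c u' c' i v] by (auto simp: w fibre_def CC ann_def)
      show "(case w of (e, u, c, u', c') \<Rightarrow> (u, u')) \<in> U \<times> ann (int r) 1"
        using half_root(1)[OF i1(1) r_root h(3,2,4,1)] h ann_cong[of e "int r" 1] by (simp add: w U_def coprime_m_iff)
    qed
  qed auto
  then have "card (fibre i v) = card (U \<times> ann (int r) 1)" by (simp add: bij_betw_same_card)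
  then show ?thesis by (simp add: card_cartesian_product card_ann[OF r_root one_root] r_one)
qed

definition D :: "int set" where "D = {v \<in> V. M dvd int r - chi v}"

text \<open>Negation of v modulo n exchanges chi(v) = r with r chi(v) = 1, so both halves have the
  same correction term.\<close>

lemma card_D_minus: "card {v \<in> V. M dvd int r * chi v - 1} = card D"
proof -
  have key: "M dvd int r * chi ((- v) mod N) - 1 \<longleftrightarrow> M dvd int r - chi v" for v
  proof -
    have c: "chi ((- v) mod N) = chi (- v)" by (rule chi_cong) simp
    have d: "M dvd chi v * chi (- v) - 1" using chi_minus(1)[of v] by (simp add: cong_iff_dvd_diff)
    have "M dvd int r * chi (- v) - 1 \<longleftrightarrow> M dvd chi v * (int r * chi (- v) - 1)"
      using coprime_chi[of v] by (simp add: coprime_dvd_mult_right_iff coprime_commute)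
    also have "chi v * (int r * chi (- v) - 1) = (int r - chi v) + int r * (chi v * chi (- v) - 1)" by (simp add: algebra_simps)
    also have "M dvd \<dots> \<longleftrightarrow> M dvd int r - chi v" using d by (simp add: dvd_add_left_iff)
    finally show ?thesis by (simp add: c)
  qed
  have inv: "(- ((- v) mod N)) mod N = v" "(- v) mod N \<in> V" if "v \<in> V" for v
  proof -
    show "(- ((- v) mod N)) mod N = v" using that by (simp add: V_def mod_simps)
    have "coprime (- v) N" using that by (simp add: V_def)
    then have "coprime ((- v) mod N) N" by (metis coprime_mod_left_iff of_nat_0_eq_iff n_pos less_numeral_extra(4) not_one_less_zero)
    then show "(- v) mod N \<in> V" using mod_in(2) by (simp add: V_def)
  qed
  have "bij_betw (\<lambda>v. (- v) mod N) D {v \<in> V. M dvd int r * chi v - 1}"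
    by (rule bij_betwI[where g="\<lambda>v. (- v) mod N"]) (use inv key in \<open>auto simp: D_def\<close>, metis inv(1) key)
  then show ?thesis by (simp add: bij_betw_same_card)
qed

lemma card_V: "card V = totient n"
  unfolding V_def by (rule card_coprime_int[OF n_pos])

lemma sum_ite: "finite A \<Longrightarrow> (\<Sum>v\<in>A. if B v then 1 else m) = card A * m - card {v\<in>A. B v} * (m - 1)"
proof -
  obtain k where k: "m = Suc k" using m_pos by (cases m) auto
  assume "finite A"
  then have "(\<Sum>v\<in>A. if B v then 1 else m) + card {v\<in>A. B v} * (m - 1) = card A * m"
  proof (induction A rule: finite_induct)
    case (insert x A)
    have "{v \<in> insert x A. B v} = (if B x then insert x {v \<in> A. B v} else {v \<in> A. B v})" by auto
    then show ?case using insert by (auto simp: k algebra_simps)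
  qed simp
  then show ?thesis by simp
qed

lemma sum_D: "(\<Sum>v\<in>V. if M dvd int r - chi v then 1 else m) = card V * m - card D * (m - 1)"
    "(\<Sum>v\<in>V. if M dvd int r * chi v - 1 then 1 else m) = card V * m - card D * (m - 1)"
  using sum_ite[OF finite_VJ(1), of "\<lambda>v. M dvd int r - chi v"] sum_ite[OF finite_VJ(1), of "\<lambda>v. M dvd int r * chi v - 1"]
  by (simp_all add: card_D_minus) (simp_all add: D_def)

text \<open>The group \<open>auto G\<close> has order m times \<open>card U\<close> times
  \<open>card J1\<close>. The factor m comes from the annihilators compared with r = 1 if r is
  nontrivial, and from the sum over \<open>V\<close>, where \<open>D\<close> is empty, if r =
  1.\<close>

lemma card_sols_nontriv:
  assumes s: "s \<noteq> 1"
  shows "card sols = card (auto G) * (card I * (2 * (if r = 1 then card V else card V * m - card D * (m - 1))))"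
proof -
  let ?a = "\<lambda>v. (if M dvd int r - chi v then 1 else m) + (if M dvd int r * chi v - 1 then 1 else m)"
  have "card sols = (\<Sum>i\<in>I. \<Sum>v\<in>V. card J1 * (card U * (if r = 1 then 1 else m) * ?a v))"
    unfolding card_sols by (intro sum.cong refl) (simp add: card_fibre_nontriv[OF s])
  also have "\<dots> = card I * (card J1 * (card U * (if r = 1 then 1 else m) * (\<Sum>v\<in>V. ?a v)))"
    by (simp add: sum_distrib_left mult.assoc)
  also have "(\<Sum>v\<in>V. ?a v) = 2 * (card V * m - card D * (m - 1))"
    unfolding sum.distrib sum_D by simp
  finally have 1: "card sols = card I * (card J1 * (card U * (if r = 1 then 1 else m) * (2 * (card V * m - card D * (m - 1)))))" .
  have "D = {}" if "r = 1"
  proof -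
    have "\<not> M dvd int r - chi v" if "v \<in> V" for v
    proof
      assume "M dvd int r - chi v"
      then have "M dvd chi v - 1" using \<open>r = 1\<close> by (simp add: dvd_diff_commute)
      moreover have "coprime (chi v - 1) M" using that coprime_chi_minus_one[OF s] by (simp add: V_def)
      ultimately have "M dvd 1" by (metis coprime_common_divisor dvd_refl)
      then show False using m_pos by simp
    qed
    then show ?thesis by (auto simp: D_def)
  qed
  moreover have "card (auto G) = m * card U * card J1" using card_auto s by (simp add: C_def J1_eq_J[OF s])
  ultimately show ?thesis using 1 by auto
qed

text \<open>For s = 1 every unit of Z/n lies in \<open>J\<close>. The free choice of v' over
  \<open>V\<close> thus accounts for the part of \<open>auto G\<close> acting on Z/n, and
  \<open>J1\<close> leaves the factor n / Q.\<close>

lemma card_sols_triv: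
  assumes s: "s = 1"
  shows "card sols = card (auto G) * (card I * (n div Q * (if r = 1 then 1 else m)))"
proof -
  have c1: "chi j = 1" for j by (rule s1_chi[OF s])
  have JV: "J = V"
  proof -
    have "[1 = int s] (mod M)" unfolding s by simp
    then show ?thesis unfolding J_def V_def c1 by simp
  qed
  have "J1 = {j \<in> {0..<N}. int Q dvd j - 1}"
  proof -
    have "coprime j N" if "int Q dvd j - 1" for j
      unfolding coprime_n_iff
    proof
      assume "int Q dvd j"
      then have "int Q dvd 1" using that by (metis dvd_diff_commute dvd_diff_left_iff)
      then show False using prime_gt_1_nat[OF primeQ] by simp
    qed
    then show ?thesis by (auto simp: J1_def JV V_def)
  qed
  then have J1: "card J1 = n div Q" using card_residue_class[of Q n 1] prime_gt_0_nat[OF primeQ] Q_dvd_n by simp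
  have "card sols = (\<Sum>i\<in>I. \<Sum>v\<in>V. card J1 * (card U * (if r = 1 then 1 else m)))"
    unfolding card_sols by (intro sum.cong refl) (simp add: card_fibre_triv[OF s])
  moreover have "C = {0}" unfolding C_def using s by simp
  then have "card (auto G) = card U * card V" using card_auto by (simp add: JV)
  ultimately show ?thesis using J1 by simp
qed

lemma auto_pos: "card (auto G) > 0"
proof -
  have "auto G \<noteq> {}" using G.id_in_auto by blast
  moreover have "auto G \<subseteq> S \<rightarrow>\<^sub>E S" by (auto simp: auto_def Bij_def PiE_def carrier_isdp bij_betwE)
  then have "finite (auto G)" by (rule finite_subset) (intro finite_PiE; simp)
  ultimately show ?thesis by (simp add: card_gt_0_iff)
qed

theorem hgs_count_value:
  fixes Gam :: "('a, 'c) monoid_scheme" and H :: "('b, 'd) monoid_scheme"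
  assumes Gam: "group Gam" "Gam \<cong> B.G" and H: "group H" "H \<cong> G"
  shows "hgs_count Gam H = card I * (if s = 1 then n div Q * (if r = 1 then 1 else m)
     else 2 * (if r = 1 then card V else card V * m - card D * (m - 1)))"
proof -
  have "B.G \<cong> Gam" by (rule group.iso_sym[OF Gam])
  then obtain \<psi> where psi: "\<psi> \<in> iso B.G Gam" by (auto simp: is_iso_def)
  have fin: "finite (carrier B.G)" "finite (carrier G)" by (simp_all add: carrier_isdp)
  have "finite (carrier Gam)" using psi fin by (auto simp: iso_def bij_betw_finite)
  then interpret tg: two_groups Gam G using Gam fin by (intro two_groups.intro two_groups_axioms.intro group_isdp)
  have "hgs_count Gam H = hgs_count Gam G" by (rule hgs_count_cong_iso[OF H(1) group_isdp H(2)])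
  moreover have "hgs_count Gam G * card (auto G) = card sols"
    unfolding tg.hgs_count_times_auto tg.card_hgs_maps_iso[OF B.group_isdp psi] card_left_hgs_maps pairs_eq_sols ..
  ultimately have "card (auto G) * hgs_count Gam H = card (auto G) * (card I * (if s = 1 then n div Q * (if r = 1 then 1 else m)
     else 2 * (if r = 1 then card V else card V * m - card D * (m - 1))))"
    using card_sols_triv card_sols_nontriv by (auto simp: mult.commute)
  then show ?thesis using auto_pos unfolding mult_cancel1 by linarith
qed

end

section \<open>Orders of units, and the number of v with chi(v) = r\<close>

context sd_data
begin

lemma nat_root: "[x ^ n = 1] (mod m) \<Longrightarrow> M dvd int x ^ n - 1"
  by (metis cong_iff_dvd_diff cong_int_iff of_nat_1 of_nat_power)

lemma nat_cong_dvd: "[x = y] (mod d) \<longleftrightarrow> int d dvd int x - int y"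
  by (metis cong_iff_dvd_diff cong_int_iff)

lemma coprime_m_s: "coprime m s"
  using root_coprime[OF nat_root[OF s_pow]] by (simp add: coprime_commute)

lemma ord_dvd_n: "ord m s dvd n"
  using s_pow by (rule ord_divides[THEN iffD1])

lemma Q_dvd_ord: "s \<noteq> 1 \<Longrightarrow> Q dvd ord m s"
proof (rule ccontr)
  assume s: "s \<noteq> 1" and nd: "\<not> Q dvd ord m s"
  have "[s ^ ord m s = 1] (mod m)" by (rule ord_divides[THEN iffD2, OF dvd_refl])
  then have "[s ^ ord m s = 1] (mod P)" using P_dvd_m cong_dvd_modulus_nat by auto
  then show False using nd s s_cases by blast
qed

lemma power_root: "[x ^ n = 1] (mod m) \<Longrightarrow> [(x ^ k) ^ n = 1] (mod m)"
  by (metis cong_pow mult.commute power_mult power_one)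

lemma cong_P_iff:
  assumes "[x ^ n = 1] (mod m)" "[y ^ n = 1] (mod m)"
  shows "[x = y] (mod P) \<longleftrightarrow> [x = y] (mod m)"
  using roots_cong(1)[OF nat_root nat_root, OF assms] P_dvd_m dvd_trans unfolding nat_cong_dvd by blast

text \<open>Powers of x are n-th roots of unity, so they agree with 1 modulo P only if they do so
  modulo m. Orders may therefore be computed in the field Z/P.\<close>

lemma ord_P: assumes "[x ^ n = 1] (mod m)" shows "ord P x = ord m x"
proof -
  have "[x ^ k = 1] (mod P) \<longleftrightarrow> [x ^ k = 1] (mod m)" for k
    using cong_P_iff[OF power_root[OF assms], of 1 k] by simp
  then have "ord P x dvd k \<longleftrightarrow> ord m x dvd k" for k unfolding ord_divides .
  from this[of "ord P x"] this[of "ord m x"] show ?thesis by (simp add: dvd_antisym)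
qed

text \<open>In the field Z/P an equation x^o = 1 has at most o solutions, and the powers of s, of
  order o, already are that many. The congruence found modulo P lifts to m.\<close>

lemma root_is_power:
  assumes r: "[r ^ n = 1] (mod m)" and o: "ord m r = ord m s"
  shows "\<exists>k. [s ^ k = r] (mod m)"
proof -
  let ?o = "ord P s"
  let ?A = "{x \<in> {..<P}. [x ^ ?o = 1] (mod P)}"
  have oo: "ord P r = ?o" using ord_P[OF r] ord_P[OF s_pow] o by simp
  have Ps: "coprime P s" using coprime_m_s m by auto
  then have o0: "?o > 0" by simp
  have P0: "P > 0" using primeP by (rule prime_gt_0_nat)
  have "card ?A \<le> ?o" by (rule roots_mod_prime_bound[OF primeP o0])
  moreover have sub: "(\<lambda>k. s ^ k mod P) ` {..<?o} \<subseteq> ?A"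
  proof
    fix x assume "x \<in> (\<lambda>k. s ^ k mod P) ` {..<?o}"
    then obtain k where x: "x = s ^ k mod P" by blast
    have "[s ^ ?o = 1] (mod P)" by (rule ord_divides[THEN iffD2, OF dvd_refl])
    then have "[(s ^ ?o) ^ k = 1 ^ k] (mod P)" by (rule cong_pow)
    then have "[(s ^ k) ^ ?o = 1] (mod P)" by (simp add: mult.commute flip: power_mult)
    moreover have "[x ^ ?o = (s ^ k) ^ ?o] (mod P)" unfolding x by (intro cong_pow) simp
    ultimately show "x \<in> ?A" using x P0 cong_trans by auto
  qed
  moreover have "card ((\<lambda>k. s ^ k mod P) ` {..<?o}) = ?o"
    using card_image[OF inj_power_mod[OF Ps]] by simp
  ultimately have eq: "(\<lambda>k. s ^ k mod P) ` {..<?o} = ?A" by (intro card_seteq) auto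
  have "[r ^ ?o = 1] (mod P)" unfolding oo[symmetric] by (rule ord_divides[THEN iffD2, OF dvd_refl])
  then have "[(r mod P) ^ ?o = 1] (mod P)" by (simp add: cong_def power_mod)
  then have "r mod P \<in> ?A" using P0 by simp
  then have "r mod P \<in> (\<lambda>k. s ^ k mod P) ` {..<?o}" using eq by simp
  then obtain k where "r mod P = s ^ k mod P" by blast
  then have "[s ^ k = r] (mod P)" by (simp add: cong_def)
  then show ?thesis using cong_P_iff[OF power_root[OF s_pow] r] by blast
qed

end

context sd_pair
begin

text \<open>If s^v = r with Q not dividing v, then r and s have the same order. Conversely, if the
  orders agree then r is a power s^k, and the solutions v form the residue class of k modulo that
  order.\<close>

lemma card_D:
  assumes s: "s \<noteq> 1"
  shows "card D = (if ord m r = ord m s then n div ord m s else 0)"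
proof -
  have De: "v \<in> D \<longleftrightarrow> v \<in> {0..<N} \<and> \<not> int Q dvd v \<and> [s ^ nat v = r] (mod m)" for v
  proof -
    have "M dvd int r - chi v \<longleftrightarrow> [s ^ nat v = r] (mod m)" if "v \<in> {0..<N}"
    proof -
      have "chi v = int (s ^ nat v)" using that by (simp add: chi_def)
      then show ?thesis using nat_cong_dvd[of r "s ^ nat v" m] by (metis cong_sym_eq)
    qed
    then show ?thesis unfolding D_def V_def by (auto simp: coprime_n_iff)
  qed
  \<comment> \<open>The order of s divides n and is a multiple of Q, so being prime to it is the
    same as being prime to Q.\<close>
  have ordpow: "ord m (s ^ k) = ord m s \<longleftrightarrow> \<not> Q dvd k" for k
  proof -
    have o: "ord m s > 0" using coprime_m_s by simp
    have "ord m (s ^ k) = ord m s div gcd k (ord m s)" using coprime_m_s by (rule ord_power)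
    then have "ord m (s ^ k) = ord m s \<longleftrightarrow> gcd k (ord m s) = 1"
      using o by (simp add: div_eq_dividend_iff)
    also have "\<dots> \<longleftrightarrow> \<not> Q dvd k"
    proof
      assume g: "gcd k (ord m s) = 1"
      show "\<not> Q dvd k"
      proof
        assume "Q dvd k"
        then have "Q dvd gcd k (ord m s)" using Q_dvd_ord[OF s] by simp
        then show False using g primeQ by auto
      qed
    next
      assume "\<not> Q dvd k"
      then have "coprime k Q" using primeQ by (metis coprime_commute prime_imp_coprime)
      then have "coprime k n" using n by auto
      then show "gcd k (ord m s) = 1"
        by (metis coprime_imp_gcd_eq_1 coprime_divisors ord_dvd_n dvd_refl)
    qed
    finally show ?thesis .
  qed
  show ?thesis
  proof (cases "ord m r = ord m s")
    case False
    have "D = {}"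
    proof (rule ccontr)
      assume "D \<noteq> {}"
      then obtain v where v: "v \<in> {0..<N}" "\<not> int Q dvd v" "[s ^ nat v = r] (mod m)" using De by blast
      have "\<not> Q dvd nat v" using v by (metis atLeastLessThan_iff int_nat_eq int_dvd_int_iff)
      then have "ord m (s ^ nat v) = ord m s" using ordpow by blast
      then show False using False ord_cong[OF v(3)] by simp
    qed
    then show ?thesis using False by simp
  next
    case True
    obtain k where k: "[s ^ k = r] (mod m)" using root_is_power[OF B.s_pow True] by blast
    have Qk: "\<not> Q dvd k" using ordpow[of k] ord_cong[OF k] True by simp
    \<comment> \<open>Coprimality with n comes for free on this class: its modulus is a multiple of
      Q, and Q does not divide k.\<close>
    have "D = {v \<in> {0..<int n}. int (ord m s) dvd v - int k}"
    proof (rule Set.set_eqI)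
      fix v
      have "[s ^ nat v = r] (mod m) \<longleftrightarrow> int (ord m s) dvd v - int k" if v: "v \<in> {0..<N}"
      proof -
        have "[s ^ nat v = r] (mod m) \<longleftrightarrow> [s ^ nat v = s ^ k] (mod m)" using k cong_sym cong_trans by blast
        also have "\<dots> \<longleftrightarrow> [nat v = k] (mod ord m s)" by (rule order_divides_expdiff[OF coprime_m_s])
        also have "\<dots> \<longleftrightarrow> int (ord m s) dvd v - int k" unfolding nat_cong_dvd using v by simp
        finally show ?thesis .
      qed
      moreover have "\<not> int Q dvd v" if "int (ord m s) dvd v - int k"
      proof
        assume "int Q dvd v"
        moreover have "int Q dvd v - int k" using that Q_dvd_ord[OF s] by (meson dvd_trans int_dvd_int_iff)
        ultimately have "int Q dvd int k" by (metis dvd_diff_right_iff)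
        then show False using Qk by simp
      qed
      ultimately show "v \<in> D \<longleftrightarrow> v \<in> {v \<in> {0..<int n}. int (ord m s) dvd v - int k}"
        using De by blast
    qed
    moreover have "ord m s > 0" using coprime_m_s by simp
    ultimately show ?thesis using True card_residue_class[OF _ ord_dvd_n] by simp
  qed
qed

end

section \<open>Specialisation to the four types\<close>

lemma sdp_commute_iso:
  assumes "m > 0" "n > 0"
  shows "sdp m n 1 \<cong> sdp n m 1"
proof -
  have "(\<lambda>(a, b). (b, a)) \<in> iso (sdp m n 1) (sdp n m 1)"
  proof (rule isoI)
    show "(\<lambda>(a, b). (b, a)) \<in> hom (sdp m n 1) (sdp n m 1)" using assms by (auto simp: hom_def sdp_def)
    show "bij_betw (\<lambda>(a, b). (b, a)) (carrier (sdp m n 1)) (carrier (sdp n m 1))"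
      by (rule bij_betwI[where g="\<lambda>(a, b). (b, a)"]) (auto simp: sdp_def)
  qed
  then show ?thesis by (auto simp: is_iso_def)
qed

lemma sd_data_type123:
  fixes p q s :: nat
  assumes p: "Factorial_Ring.prime p" and q: "Factorial_Ring.prime q" and pq: "p \<noteq> q" "p > 2" "\<not> q dvd p - 1"
    and s: "s = 1 \<or> ord q s = p \<or> ord q s = p\<^sup>2"
  shows "sd_data q p q (p\<^sup>2) s"
proof
  show "p\<^sup>2 = p \<or> p\<^sup>2 = p\<^sup>2 \<and> odd p" using p pq prime_odd_nat by auto
  show "[s ^ p\<^sup>2 = 1] (mod q)" using s ord_divides[of s "p\<^sup>2" q] by (auto simp: power2_eq_square)
  show "s = 1 \<or> (\<forall>v. \<not> p dvd v \<longrightarrow> \<not> [s ^ v = 1] (mod q))"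
    using s ord_divides[of s _ q] by (metis dvd_power dvd_refl dvd_trans pos2)
qed (use assms in auto)

text \<open>From q dividing p - 1 one has q < p, hence p does not divide q - 1.\<close>

lemma sd_data_type14:
  fixes p q s :: nat
  assumes p: "Factorial_Ring.prime p" and q: "Factorial_Ring.prime q" and pq: "p \<noteq> q" "p > 2" "q dvd p - 1"
    and s: "s = 1 \<or> ord (p\<^sup>2) s = q"
  shows "sd_data p q (p\<^sup>2) q s"
proof -
  have lt: "q < p" using pq by (auto dest!: dvd_imp_le)
  have np: "\<not> p dvd q - 1" using lt prime_gt_1_nat[OF q] by (auto dest!: dvd_imp_le)
  have odd: "odd p" using p pq prime_odd_nat by auto
  \<comment> \<open>The order is known modulo p^2 but \<open>s_cases\<close> speaks of p. The lemmas
    that pass between the two moduli do not depend on s, so they are taken from the instance with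
    trivial action.\<close>
  interpret T: sd_data p q "p\<^sup>2" q 1
    by standard (use assms odd np in auto)
  have sq: "[s ^ q = 1] (mod p\<^sup>2)" using s ord_divides[of s q "p\<^sup>2"] by auto
  have "q dvd v" if s1: "s \<noteq> 1" and v: "[s ^ v = 1] (mod p)" for v
  proof -
    have o: "ord (p\<^sup>2) s = q" using s s1 by simp
    have "[s ^ v = 1] (mod p\<^sup>2)" using v T.cong_P_iff[OF T.power_root[OF sq], of 1 v] by simp
    then show ?thesis using o ord_divides by metis
  qed
  then show ?thesis by (unfold_locales) (use assms odd np sq in auto)
qed

lemma iso_isdp: "H \<cong> sdp m n s \<Longrightarrow> H \<cong> isdp m n s"
  by (rule iso_trans[OF _ sdp_iso_isdp])

text \<open>Here m = P = q, which leaves only i = 1. If the orders agree, p^2 divided by the order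
  counts the v' with chi(v') = r: p of them for type 2, one for type 3.\<close>

lemma hgs_count_types_qnd:
  fixes p q :: nat and Gam :: "'a monoid" and G :: "'b monoid"
  assumes p: "Factorial_Ring.prime p" and q: "Factorial_Ring.prime q" and pq: "p \<noteq> q" "p > 2" "\<not> q dvd p - 1"
    and gr: "group Gam" "group G"
    and r: "r = 1 \<or> ord q r = p \<or> ord q r = p\<^sup>2" "Gam \<cong> sdp q (p\<^sup>2) r"
    and s: "s = 1 \<or> ord q s = p \<or> ord q s = p\<^sup>2" "G \<cong> sdp q (p\<^sup>2) s"
  shows "hgs_count Gam G = (if s = 1 then p * (if r = 1 then 1 else q)
     else if r = 1 then 2 * p * (p - 1)
     else 2 * (p * (p - 1) * q - (if ord q r = ord q s then p\<^sup>2 div ord q s else 0) * (q - 1)))"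
proof -
  interpret A: sd_data q p q "p\<^sup>2" s by (rule sd_data_type123[OF p q pq s(1)])
  interpret B: sd_data q p q "p\<^sup>2" r by (rule sd_data_type123[OF p q pq r(1)])
  interpret sd_pair q p q "p\<^sup>2" s r by unfold_locales
  have "q > 0" "p > 0" using p q prime_gt_0_nat by auto
  then have "card I = 1" using card_I by simp
  moreover have "card A.V = p * (p - 1)"
    using card_V totient_prime_power[OF p, of 2] by simp
  moreover have "p\<^sup>2 div p = p" by (simp add: power2_eq_square)
  ultimately show ?thesis
    using hgs_count_value[OF gr(1) iso_isdp[OF r(2)] gr(2) iso_isdp[OF s(2)]] card_D
    by (simp add: mult.assoc)
qed

text \<open>Here m = p^2, and for r = 1 there are p admissible values of i. Nontrivial r and s both
  have order q, so exactly one v' satisfies chi(v') = r; this accounts for the term p^2 - 1.\<close>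

lemma hgs_count_types_qd:
  fixes p q :: nat and Gam :: "'a monoid" and G :: "'b monoid"
  assumes p: "Factorial_Ring.prime p" and q: "Factorial_Ring.prime q" and pq: "p \<noteq> q" "p > 2" "q dvd p - 1"
    and gr: "group Gam" "group G"
    and r: "r = 1 \<or> ord (p\<^sup>2) r = q" "Gam \<cong> sdp (p\<^sup>2) q r"
    and s: "s = 1 \<or> ord (p\<^sup>2) s = q" "G \<cong> sdp (p\<^sup>2) q s"
  shows "hgs_count Gam G = (if s = 1 then (if r = 1 then p else p\<^sup>2)
     else if r = 1 then 2 * p * (q - 1)
     else 2 * ((q - 1) * p\<^sup>2 - (p\<^sup>2 - 1)))"
proof -
  interpret A: sd_data p q "p\<^sup>2" q s by (rule sd_data_type14[OF p q pq s(1)])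
  interpret B: sd_data p q "p\<^sup>2" q r by (rule sd_data_type14[OF p q pq r(1)])
  interpret sd_pair p q "p\<^sup>2" q s r by unfold_locales
  have "q > 0" "p > 0" using p q prime_gt_0_nat by auto
  moreover have "card I = (if r = 1 then p else 1)" using card_I \<open>p > 0\<close> by (simp add: power2_eq_square)
  moreover have "card A.V = q - 1"
    using card_V totient_prime[OF q] by simp
  moreover have "ord (p\<^sup>2) r = ord (p\<^sup>2) s" if "r \<noteq> 1" "s \<noteq> 1" using r s that by simp
  moreover have "q div ord (p\<^sup>2) s = 1" if "s \<noteq> 1" using s that \<open>q > 0\<close> by simp
  ultimately show ?thesis
    using hgs_count_value[OF gr(1) iso_isdp[OF r(2)] gr(2) iso_isdp[OF s(2)]] card_D
    by auto
qed

section \<open>Groups of order p squared\<close>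

text \<open>Orbits of a p-group have p-power length. If \<open>x0\<close> were the only fixed point,
  all other orbits would have length divisible by p, and the set would have 1 modulo p
  elements.\<close>

lemma (in group_action) second_fixed_point:
  fixes p :: nat
  assumes p: "Factorial_Ring.prime p" and o: "order G = p ^ k" and fin: "finite E" and dv: "p dvd card E"
    and x0: "x0 \<in> E" "\<And>g. g \<in> carrier G \<Longrightarrow> \<phi> g x0 = x0"
  obtains x where "x \<in> E" "x \<noteq> x0" "\<And>g. g \<in> carrier G \<Longrightarrow> \<phi> g x = x"
proof -
  interpret G: group G using group_hom group_hom.axioms(1) by blast
  have "\<exists>x. x \<in> E \<and> x \<noteq> x0 \<and> (\<forall>g\<in>carrier G. \<phi> g x = x)"
  proof (rule ccontr)
    assume none: "\<not> ?thesis"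
    have single: "orbit G \<phi> x0 = {x0}" using x0(2) x0(2)[OF G.one_closed, symmetric] G.one_closed
      by (force simp: orbit_def)
    have orb_in: "orbit G \<phi> x \<subseteq> E" if "x \<in> E" for x
      using element_image that by (auto simp: orbit_def)
    have big: "p dvd card (orbit G \<phi> x)" if x: "x \<in> E" "x \<noteq> x0" for x
    proof -
      have "card (orbit G \<phi> x) dvd p ^ k" using orbit_stabilizer_theorem[OF x(1)] o by (metis dvd_triv_left)
      then obtain j where j: "card (orbit G \<phi> x) = p ^ j" using p by (metis divides_primepow_nat)
      obtain g where g: "g \<in> carrier G" "\<phi> g x \<noteq> x" using none x by blast
      have "{x, \<phi> g x} \<subseteq> orbit G \<phi> x" using g orbit_refl[OF x(1)] by (auto simp: orbit_def)
      moreover have "finite (orbit G \<phi> x)" using orb_in[OF x(1)] fin by (rule finite_subset)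
      ultimately have "card {x, \<phi> g x} \<le> card (orbit G \<phi> x)" by (intro card_mono)
      then have "card (orbit G \<phi> x) \<ge> 2" using g by simp
      then have "j \<noteq> 0" using j by (metis numeral_le_one_iff power_0 semiring_norm(69))
      then show ?thesis using j by simp
    qed
    have cE: "card E = (\<Sum>orb\<in>orbits G E \<phi>. card orb)"
      using disjoint_sum[OF fin, of "\<lambda>_. 1::nat"] by (simp only: card_eq_sum)
    have x0o: "{x0} \<in> orbits G E \<phi>" using x0 single by (auto simp: orbits_def)
    have "finite (orbits G E \<phi>)"
      by (rule finite_subset[of _ "Pow E"]) (use orb_in fin in \<open>auto simp: orbits_def\<close>)
    then have "card E = 1 + (\<Sum>orb\<in>orbits G E \<phi> - {{x0}}. card orb)"
      using sum.remove[OF _ x0o, of card] cE by simp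
    moreover have "p dvd (\<Sum>orb\<in>orbits G E \<phi> - {{x0}}. card orb)"
    proof (rule dvd_sum)
      fix orb assume "orb \<in> orbits G E \<phi> - {{x0}}"
      then obtain x where "x \<in> E" "orb = orbit G \<phi> x" "x \<noteq> x0" using single by (auto simp: orbits_def)
      then show "p dvd card orb" using big by simp
    qed
    ultimately have "p dvd 1" using dv by (metis dvd_add_left_iff)
    then show False using p by auto
  qed
  then show ?thesis using that by blast
qed

context group
begin

text \<open>Multiplication by an element permutes the finite set, so some product is 1 and inverses
  exist.\<close>

lemma finite_closed_subgroup:
  assumes "finite H" "H \<subseteq> carrier G" "\<one> \<in> H" "\<And>x y. x \<in> H \<Longrightarrow> y \<in> H \<Longrightarrow> x \<otimes> y \<in> H"
  shows "subgroup H G"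
proof (rule subgroupI)
  fix a assume a: "a \<in> H"
  have "inj_on (\<lambda>x. a \<otimes> x) H" using a assms(2) by (auto simp: inj_on_def subset_iff)
  moreover have "(\<lambda>x. a \<otimes> x) ` H \<subseteq> H" using assms a by auto
  ultimately have "(\<lambda>x. a \<otimes> x) ` H = H" using assms(1) by (intro endo_inj_surj) auto
  then obtain b where b: "b \<in> H" "a \<otimes> b = \<one>" using assms(3) by (metis (no_types, lifting) imageE)
  have "inv a = b" using inv_equality[OF inv_comm[OF b(2)]] a b(1) assms(2) by auto
  then show "inv a \<in> H" using b by simp
qed (use assms in auto)

lemma card_subgroup_dvd: "subgroup H G \<Longrightarrow> card H dvd order G"
  using lagrange by (metis dvd_triv_right)

lemma subgroup_pow_card:
  assumes "subgroup H G" "x \<in> H"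
  shows "x [^] card H = \<one>"
proof -
  interpret H: group "G\<lparr>carrier := H\<rparr>" using assms(1) is_group by (rule subgroup.subgroup_is_group)
  have "x [^]\<^bsub>G\<lparr>carrier := H\<rparr>\<^esub> order (G\<lparr>carrier := H\<rparr>) = \<one>\<^bsub>G\<lparr>carrier := H\<rparr>\<^esub>"
    by (rule H.pow_order_eq_1) (use assms in simp)
  then show ?thesis by (simp add: order_def nat_pow_consistent[symmetric])
qed

lemma coprime_pow_one:
  assumes "x \<in> carrier G" "x [^] (a::nat) = \<one>" "x [^] (b::nat) = \<one>" "coprime a b"
  shows "x = \<one>"
proof -
  have "ord x dvd a" "ord x dvd b" using assms pow_eq_id by auto
  then have "ord x = 1" using assms(4) by (metis coprime_common_divisor_nat)
  then show ?thesis using assms(1) pow_ord_eq_1[of x] by simp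
qed

text \<open>Conjugation fixes some element besides 1, so the centre \<open>Z\<close> is nontrivial.
  The centraliser \<open>C\<close> of x contains it, and if \<open>C\<close> is not the whole group
  both have order p; then x, an element of \<open>C\<close>, is central.\<close>

lemma prime_square_comm:
  fixes p :: nat
  assumes p: "Factorial_Ring.prime p" and o: "order G = p\<^sup>2" and xy: "x \<in> carrier G" "y \<in> carrier G"
  shows "x \<otimes> y = y \<otimes> x"
proof -
  have p1: "p > 1" using p by (rule prime_gt_1_nat)
  have fin: "finite (carrier G)" using o p1 by (simp add: order_def card_ge_0_finite)
  define Z where "Z = {z \<in> carrier G. \<forall>g\<in>carrier G. g \<otimes> z = z \<otimes> g}"
  define C where "C = {z \<in> carrier G. x \<otimes> z = z \<otimes> x}"
  have m_swap: "g \<otimes> (a \<otimes> b) = (a \<otimes> b) \<otimes> g" if "g \<in> carrier G" "a \<in> carrier G" "b \<in> carrier G" "g \<otimes> a = a \<otimes> g" "g \<otimes> b = b \<otimes> g" for g a b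
    using that by (metis m_assoc)
  have Z: "subgroup Z G"
  proof (rule finite_closed_subgroup)
    fix a b assume ab: "a \<in> Z" "b \<in> Z"
    then have abG: "a \<in> carrier G" "b \<in> carrier G" by (simp_all add: Z_def)
    have "g \<otimes> (a \<otimes> b) = (a \<otimes> b) \<otimes> g" if g: "g \<in> carrier G" for g
    proof -
      have "g \<otimes> a = a \<otimes> g" "g \<otimes> b = b \<otimes> g" using ab g unfolding Z_def by blast+
      then show ?thesis by (rule m_swap[OF g abG])
    qed
    then show "a \<otimes> b \<in> Z" using abG m_closed unfolding Z_def by blast
  qed (use fin in \<open>auto simp: Z_def\<close>)
  have C: "subgroup C G"
  proof (rule finite_closed_subgroup)
    fix a b assume "a \<in> C" "b \<in> C"
    then show "a \<otimes> b \<in> C" using m_swap[OF xy(1), of a b] m_closed unfolding C_def by blast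
  qed (use fin xy in \<open>auto simp: C_def\<close>)
  interpret act: group_action G "carrier G" "\<lambda>g. \<lambda>h \<in> carrier G. g \<otimes> h \<otimes> inv g" by (rule action_by_conjugation)
  obtain z where z: "z \<in> carrier G" "z \<noteq> \<one>" "\<And>g. g \<in> carrier G \<Longrightarrow> (\<lambda>h \<in> carrier G. g \<otimes> h \<otimes> inv g) z = z"
    using act.second_fixed_point[OF p o fin, of \<one>] o p1 by (auto simp: order_def)
  have "g \<otimes> z = z \<otimes> g" if "g \<in> carrier G" for g
  proof -
    have "g \<otimes> z \<otimes> inv g = z" using z(1) z(3)[OF that] by simp
    then have "(g \<otimes> z \<otimes> inv g) \<otimes> g = z \<otimes> g" by simp
    then show ?thesis using z(1) that by (simp add: m_assoc)
  qed
  then have zZ: "z \<in> Z" using z by (simp add: Z_def)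
  have dv: "card Z dvd p\<^sup>2" "card C dvd p\<^sup>2" using card_subgroup_dvd Z C o by auto
  have ZC: "Z \<subseteq> C" using xy by (auto simp: Z_def C_def)
  have finC: "finite C" using fin by (simp add: C_def)
  have "card {\<one>, z} \<le> card Z" by (rule card_mono) (use zZ subgroup.one_closed[OF Z] finite_subset[OF ZC finC] in auto)
  then have Z2: "card Z \<ge> 2" using z(2) by simp
  obtain i where i: "card Z = p ^ i" "i \<le> 2" using dv(1) p divides_primepow_nat by blast
  obtain j where j: "card C = p ^ j" "j \<le> 2" using dv(2) p divides_primepow_nat by blast
  have ij: "card Z \<le> card C" by (rule card_mono[OF finC ZC])
  have i0: "i \<ge> 1" using i Z2 by (cases i) auto
  have xC: "x \<in> C" using xy by (simp add: C_def)
  show ?thesis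
  proof (cases "j = 2")
    case True
    then have "C = carrier G" using j o fin by (intro card_subset_eq) (auto simp: C_def order_def)
    then show ?thesis using xy by (auto simp: C_def)
  next
    case False
    then have "p ^ j \<le> p ^ i" using i0 j p1 by (intro power_increasing) auto
    then have "Z = C" using i j ij ZC finC by (intro card_subset_eq) auto
    then show ?thesis using xC xy by (auto simp: Z_def)
  qed
qed

lemma sdp_hom:
  assumes xy: "x \<in> carrier G" "y \<in> carrier G" "x \<otimes> y = y \<otimes> x" and e: "x [^] (m::nat) = \<one>" "y [^] (n::nat) = \<one>"
  shows "(\<lambda>(a, b). x [^] a \<otimes> y [^] b) \<in> hom (sdp m n 1) G"
proof -
  have md: "u [^] (k mod l) = u [^] k" if "u \<in> carrier G" "u [^] l = \<one>" for u and k l :: nat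
  proof -
    have "u [^] k = u [^] (k mod l + l * (k div l))" by simp
    also have "\<dots> = u [^] (k mod l) \<otimes> (u [^] l) [^] (k div l)"
      using that(1) by (simp only: nat_pow_mult[symmetric] nat_pow_pow)
    finally show ?thesis using that by simp
  qed
  have comm: "y [^] b \<otimes> x [^] c = x [^] c \<otimes> y [^] b" for b c :: nat
    using pow_mult_distrib xy by (metis group_commutes_pow nat_pow_closed)
  have "x [^] ((a + c) mod m) \<otimes> y [^] ((b + d) mod n) = x [^] a \<otimes> y [^] b \<otimes> (x [^] c \<otimes> y [^] d)" for a b c d :: nat
  proof -
    have "x [^] ((a + c) mod m) \<otimes> y [^] ((b + d) mod n) = (x [^] a \<otimes> x [^] c) \<otimes> (y [^] b \<otimes> y [^] d)"
      using xy e by (simp add: md nat_pow_mult)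
    also have "\<dots> = x [^] a \<otimes> (x [^] c \<otimes> y [^] b) \<otimes> y [^] d" using xy by (simp add: m_assoc)
    also have "\<dots> = x [^] a \<otimes> (y [^] b \<otimes> x [^] c) \<otimes> y [^] d" by (simp only: comm)
    also have "\<dots> = x [^] a \<otimes> y [^] b \<otimes> (x [^] c \<otimes> y [^] d)" using xy by (simp add: m_assoc)
    finally show ?thesis .
  qed
  then show ?thesis using xy by (auto simp: hom_def sdp_def)
qed

text \<open>The image is a subgroup containing x and y, hence everything; equality of orders then
  yields injectivity.\<close>

lemma sdp_iso:
  assumes xy: "x \<in> carrier G" "y \<in> carrier G" "x \<otimes> y = y \<otimes> x" and e: "x [^] (m::nat) = \<one>" "y [^] (n::nat) = \<one>"
    and mn: "m > 0" "n > 0" "order G = m * n"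
    and gen: "\<And>H. subgroup H G \<Longrightarrow> x \<in> H \<Longrightarrow> y \<in> H \<Longrightarrow> H = carrier G"
  shows "sdp m n 1 \<cong> G"
proof -
  let ?f = "\<lambda>(a, b). x [^] (a::nat) \<otimes> y [^] (b::nat)"
  let ?D = "{0..<m} \<times> {0..<n}"
  have h: "?f \<in> hom (sdp m n 1) G" by (rule sdp_hom[OF xy e])
  have cD: "carrier (sdp m n 1) = ?D" by (simp add: sdp_def)
  have sub: "?f ` ?D \<subseteq> carrier G" using xy by auto
  have one: "?f (0, 0) = \<one>" using xy by simp
  have "subgroup (?f ` ?D) G"
  proof (rule finite_closed_subgroup)
    show "\<one> \<in> ?f ` ?D" using one mn by (intro rev_image_eqI[of "(0, 0)"]) auto
    fix u v assume "u \<in> ?f ` ?D" "v \<in> ?f ` ?D"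
    then obtain w w' where w: "w \<in> ?D" "w' \<in> ?D" "u = ?f w" "v = ?f w'" by blast
    then have "u \<otimes> v = ?f (w \<otimes>\<^bsub>sdp m n 1\<^esub> w')" using hom_mult[OF h, of w w'] by (simp only: cD)
    moreover have "w \<otimes>\<^bsub>sdp m n 1\<^esub> w' \<in> ?D" using mn by (auto simp: sdp_def split: prod.splits)
    ultimately show "u \<otimes> v \<in> ?f ` ?D" by (rule image_eqI)
  qed (use sub in auto)
  moreover have "x \<in> ?f ` ?D"
  proof (cases "m = 1")
    case True then show ?thesis using one e xy mn by (intro rev_image_eqI[of "(0, 0)"]) auto
  qed (use xy mn in \<open>auto intro!: rev_image_eqI[of "(1, 0)"]\<close>)
  moreover have "y \<in> ?f ` ?D"
  proof (cases "n = 1")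
    case True then show ?thesis using one e xy mn by (intro rev_image_eqI[of "(0, 0)"]) auto
  qed (use xy mn in \<open>auto intro!: rev_image_eqI[of "(0, 1)"]\<close>)
  ultimately have im: "?f ` ?D = carrier G" by (rule gen)
  moreover have "card ?D = card (carrier G)" using mn by (simp add: order_def)
  ultimately have "inj_on ?f ?D" by (intro eq_card_imp_inj_on) auto
  then have "?f \<in> iso (sdp m n 1) G" using h im cD by (auto simp: iso_def bij_betw_def)
  then show ?thesis by (auto simp: is_iso_def)
qed

text \<open>The powers of x are at least p elements and y is a further one, so the order of
  \<open>H\<close> is a divisor of p^2 exceeding p.\<close>

lemma prime_square_generators:
  fixes p :: nat
  assumes p: "Factorial_Ring.prime p" and o: "order G = p\<^sup>2" and H: "subgroup H G"
    and x: "x \<in> H" "x \<noteq> \<one>" and y: "y \<in> H" "\<And>k::nat. y \<noteq> x [^] k"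
  shows "H = carrier G"
proof -
  have p1: "p > 1" using p by (rule prime_gt_1_nat)
  have fin: "finite (carrier G)" using o p1 by (simp add: order_def card_ge_0_finite)
  have HG: "H \<subseteq> carrier G" using H by (rule subgroup.subset)
  have finH: "finite H" using HG fin by (rule finite_subset)
  have xG: "x \<in> carrier G" using x HG by auto
  define A where "A = (\<lambda>k::nat. x [^] k) ` {0 .. ord x - 1}"
  have ordx: "ord x dvd p\<^sup>2" using ord_dvd_group_order[OF xG] o by simp
  have ox1: "ord x \<noteq> 1" using x xG ord_eq_1 by simp
  have oxp: "ord x \<ge> p"
  proof -
    obtain i where i: "ord x = p ^ i" using ordx p divides_primepow_nat by blast
    then have "i \<noteq> 0" using ox1 by auto
    then have "p ^ 1 \<le> p ^ i" using p1 by (intro power_increasing) auto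
    then show ?thesis using i by simp
  qed
  have "card A = ord x" unfolding A_def using card_image[OF ord_inj[OF xG]] oxp p1 by simp
  moreover have "A \<subseteq> H"
  proof -
    have "x [^] (k::nat) \<in> H" for k
      using x subgroup.one_closed[OF H] subgroup.m_closed[OF H] by (induction k) auto
    then show ?thesis by (auto simp: A_def)
  qed
  moreover have "y \<notin> A" using y(2) by (auto simp: A_def)
  ultimately have "Suc (ord x) \<le> card H"
    using y(1) finH by (metis card_insert_disjoint card_mono finite_subset insert_subset)
  then have lt: "card H > p" using oxp by simp
  obtain j where j: "card H = p ^ j" "j \<le> 2" using card_subgroup_dvd[OF H] o p divides_primepow_nat by metis
  have "j = 2"
  proof (rule ccontr)
    assume "j \<noteq> 2"
    then have "p ^ j \<le> p ^ 1" using j p1 by (intro power_increasing) auto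
    then show False using lt j by simp
  qed
  then show ?thesis using HG j o fin by (intro card_subset_eq) (auto simp: order_def)
qed

text \<open>The cyclic group is written as \<open>sdp (p\<^sup>2) 1 1\<close> so that
  \<open>sdp_iso\<close> serves for both groups of order p^2.\<close>

lemma prime_square_cyclic:
  fixes p :: nat
  assumes p: "Factorial_Ring.prime p" and o: "order G = p\<^sup>2" and x: "x \<in> carrier G" "x [^] p \<noteq> \<one>"
  shows "sdp (p\<^sup>2) 1 1 \<cong> G" "ord x = p\<^sup>2"
proof -
  have p1: "p > 1" using p by (rule prime_gt_1_nat)
  have fin: "finite (carrier G)" using o p1 by (simp add: order_def card_ge_0_finite)
  show ox: "ord x = p\<^sup>2"
  proof -
    obtain i where i: "ord x = p ^ i" "i \<le> 2" using ord_dvd_group_order[OF x(1)] o p divides_primepow_nat by metis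
    moreover have "\<not> i \<le> 1"
    proof
      assume "i \<le> 1"
      then have "p ^ i dvd p ^ 1" by (rule le_imp_power_dvd)
      then show False using x i pow_eq_id by simp
    qed
    ultimately show ?thesis by (metis One_nat_def Suc_1 le_SucE)
  qed
  show "sdp (p\<^sup>2) 1 1 \<cong> G"
  proof (rule sdp_iso[of x \<one>])
    fix H assume H: "subgroup H G" "x \<in> H"
    have "x [^] (k::nat) \<in> H" for k
      using H subgroup.one_closed[OF H(1)] subgroup.m_closed[OF H(1)] by (induction k) auto
    then have "(\<lambda>k::nat. x [^] k) ` {0 .. ord x - 1} \<subseteq> H" by auto
    moreover have "card ((\<lambda>k::nat. x [^] k) ` {0 .. ord x - 1}) = p\<^sup>2"
      using card_image[OF ord_inj[OF x(1)]] ox p1 by simp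
    moreover have HG: "H \<subseteq> carrier G" using H(1) by (rule subgroup.subset)
    moreover have "finite H" using HG fin by (rule finite_subset)
    ultimately have "p\<^sup>2 \<le> card H" by (metis card_mono)
    moreover have "card H \<le> p\<^sup>2" using card_mono[OF fin HG] o by (simp add: order_def)
    ultimately show "H = carrier G" using HG fin o by (intro card_subset_eq) (auto simp: order_def)
  next
    show "x [^] p\<^sup>2 = \<one>" using ox pow_ord_eq_1[OF x(1)] by simp
  qed (use x o p1 in \<open>auto intro: one_closed\<close>)
qed

lemma prime_square_elementary:
  fixes p :: nat
  assumes p: "Factorial_Ring.prime p" and o: "order G = p\<^sup>2" and e: "\<And>x. x \<in> carrier G \<Longrightarrow> x [^] p = \<one>"
  shows "sdp p p 1 \<cong> G"
proof -
  have p1: "p > 1" using p by (rule prime_gt_1_nat)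
  have pp: "p\<^sup>2 > p" using p1 by (simp add: power2_eq_square)
  have fin: "finite (carrier G)" using o p1 by (simp add: order_def card_ge_0_finite)
  have "carrier G \<noteq> {\<one>}"
  proof
    assume "carrier G = {\<one>}"
    then show False using o pp p1 by (simp add: order_def)
  qed
  then obtain x where x: "x \<in> carrier G" "x \<noteq> \<one>" by blast
  have "ord x dvd p" using e[OF x(1)] pow_eq_id[OF x(1)] by simp
  then have "ord x \<le> p" using p1 by (intro dvd_imp_le) auto
  moreover have "{x [^] k |k. k \<in> (UNIV :: nat set)} = (\<lambda>k::nat. x [^] k) ` {0 .. ord x - 1}"
    using ord_elems[OF fin x(1)] by auto
  moreover have "card ((\<lambda>k::nat. x [^] k) ` {0 .. ord x - 1}) \<le> card {0 .. ord x - 1}" by (rule card_image_le) simp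
  ultimately have "card {x [^] k |k. k \<in> (UNIV :: nat set)} < card (carrier G)"
    using ord_ge_1[OF fin x(1)] o pp by (simp add: order_def)
  then have "{x [^] k |k. k \<in> (UNIV :: nat set)} \<noteq> carrier G" by auto
  moreover have "{x [^] k |k. k \<in> (UNIV :: nat set)} \<subseteq> carrier G" using x by auto
  ultimately obtain y where y: "y \<in> carrier G" "y \<notin> {x [^] k |k. k \<in> (UNIV :: nat set)}"
    by blast
  show ?thesis
  proof (rule sdp_iso[OF x(1) y(1) prime_square_comm[OF p o x(1) y(1)] e[OF x(1)] e[OF y(1)]])
    fix H assume "subgroup H G" "x \<in> H" "y \<in> H"
    then show "H = carrier G" using prime_square_generators[OF p o _ _ x(2)] y(2) by blast
  qed (use p1 o in \<open>auto simp: power2_eq_square\<close>)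
qed

end

section \<open>Groups of order p^2 connected by a bijective crossed homomorphism\<close>

lemma group_sdp_one:
  assumes "m > 0" "n > 0"
  shows "group (sdp m n 1)"
proof (rule groupI)
  fix x assume "x \<in> carrier (sdp m n 1)"
  then obtain a b where x: "x = (a, b)" "a < m" "b < n" by (auto simp: sdp_def)
  have "((m - a) mod m, (n - b) mod n) \<otimes>\<^bsub>sdp m n 1\<^esub> x = \<one>\<^bsub>sdp m n 1\<^esub>"
    using x assms by (simp add: sdp_def mod_simps)
  moreover have "((m - a) mod m, (n - b) mod n) \<in> carrier (sdp m n 1)" using assms by (simp add: sdp_def)
  ultimately show "\<exists>y\<in>carrier (sdp m n 1). y \<otimes>\<^bsub>sdp m n 1\<^esub> x = \<one>\<^bsub>sdp m n 1\<^esub>" by blast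
qed (use assms in \<open>auto simp: sdp_def mod_simps ac_simps\<close>)

text \<open>\<open>A\<close> is any choice of automorphisms for the crossed homomorphism k; that it
  is an action of \<open>R\<close> on \<open>H\<close> is a consequence, not an assumption.\<close>

locale prime_square_pair = two_groups R H for R :: "('a, 'c) monoid_scheme" and H :: "('b, 'd) monoid_scheme" (structure) +
  fixes p :: nat and k :: "'a \<Rightarrow> 'b" and A :: "'a \<Rightarrow> 'b \<Rightarrow> 'b"
  assumes p: "Factorial_Ring.prime p" "odd p" and oR: "order R = p\<^sup>2" and oH: "order H = p\<^sup>2"
    and k: "bij_betw k (carrier R) (carrier H)"
    and A: "\<And>g. g \<in> carrier R \<Longrightarrow> A g \<in> auto H"
    and kA: "\<And>g x. g \<in> carrier R \<Longrightarrow> x \<in> carrier R \<Longrightarrow> k (g \<otimes>\<^bsub>R\<^esub> x) = k g \<otimes> A g (k x)"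
begin

lemma p1: "p > 1" using p(1) by (rule prime_gt_1_nat)

lemma k_closed: "x \<in> carrier R \<Longrightarrow> k x \<in> carrier H" using k by (auto dest: bij_betwE)

lemma k_inj: "x \<in> carrier R \<Longrightarrow> y \<in> carrier R \<Longrightarrow> k x = k y \<Longrightarrow> x = y"
  using k by (auto simp: bij_betw_def inj_on_def)

lemma k_surj: "w \<in> carrier H \<Longrightarrow> \<exists>x\<in>carrier R. w = k x"
  using k unfolding bij_betw_def by blast

lemma k_one: "k \<one>\<^bsub>R\<^esub> = \<one>"
proof -
  have "k \<one>\<^bsub>R\<^esub> = k \<one>\<^bsub>R\<^esub> \<otimes> A \<one>\<^bsub>R\<^esub> (k \<one>\<^bsub>R\<^esub>)"
    using kA[OF Ga.one_closed Ga.one_closed] by simp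
  moreover have c: "k \<one>\<^bsub>R\<^esub> \<in> carrier H" using k_closed by simp
  ultimately have "A \<one>\<^bsub>R\<^esub> (k \<one>\<^bsub>R\<^esub>) = \<one>"
    using autoD(3)[OF A[OF Ga.one_closed] c] by (simp only: G.l_cancel_one')
  then show ?thesis using G.auto_one[OF A[OF Ga.one_closed]] autoD(5)[OF A[OF Ga.one_closed] c G.one_closed] by simp
qed

text \<open>Expand k at the product g h x for both bracketings and cancel the common factor.\<close>

lemma A_mult:
  assumes "g \<in> carrier R" "h \<in> carrier R" "w \<in> carrier H"
  shows "A (g \<otimes>\<^bsub>R\<^esub> h) w = A g (A h w)"
proof -
  obtain x where x: "x \<in> carrier R" "w = k x" using k_surj[OF assms(3)] by blast
  note gh = autoD(3)[OF A[OF assms(1)]] autoD(3)[OF A[OF assms(2)]] autoD(3)[OF A[OF Ga.m_closed[OF assms(1,2)]]]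
  have "k g \<otimes> A g (k h) \<otimes> A (g \<otimes>\<^bsub>R\<^esub> h) (k x) = k (g \<otimes>\<^bsub>R\<^esub> h \<otimes>\<^bsub>R\<^esub> x)"
    using assms x by (simp add: kA)
  also have "\<dots> = k (g \<otimes>\<^bsub>R\<^esub> (h \<otimes>\<^bsub>R\<^esub> x))" using assms x by (simp add: Ga.m_assoc)
  also have "\<dots> = k g \<otimes> A g (k h \<otimes> A h (k x))" using assms x by (simp add: kA)
  also have "\<dots> = k g \<otimes> A g (k h) \<otimes> A g (A h (k x))"
    using assms x gh autoD(4)[OF A[OF assms(1)], of "k h" "A h (k x)"] by (simp add: k_closed G.m_assoc)
  finally show ?thesis using assms x gh by (simp add: k_closed)
qed

lemma A_one: "w \<in> carrier H \<Longrightarrow> A \<one>\<^bsub>R\<^esub> w = w"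
proof -
  assume "w \<in> carrier H"
  then obtain x where x: "x \<in> carrier R" "w = k x" using k_surj by blast
  show ?thesis using kA[OF Ga.one_closed x(1)] x k_closed autoD(3)[OF A[OF Ga.one_closed]] by (simp add: k_one)
qed

lemma A_pow:
  assumes g: "g \<in> carrier R" and w: "w \<in> carrier H"
  shows "A (g [^]\<^bsub>R\<^esub> (n::nat)) w = (A g ^^ n) w"
proof (induction n)
  case 0 then show ?case using w by (simp add: A_one)
next
  case (Suc n)
  have "A (g \<otimes>\<^bsub>R\<^esub> g [^]\<^bsub>R\<^esub> n) w = A g (A (g [^]\<^bsub>R\<^esub> n) w)" using g w by (intro A_mult) auto
  then show ?case using Suc g by (simp add: Ga.nat_pow_Suc2[symmetric])
qed

lemma k_pow_Suc: "g \<in> carrier R \<Longrightarrow> k (g [^]\<^bsub>R\<^esub> Suc n) = k g \<otimes> A g (k (g [^]\<^bsub>R\<^esub> n))"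
  unfolding Ga.nat_pow_Suc2 by (rule kA) auto

lemma action: "group_action R (carrier H) A"
proof -
  have "A \<in> hom R (BijGroup (carrier H))"
  proof (rule homI)
    show "A g \<in> carrier (BijGroup (carrier H))" if "g \<in> carrier R" for g
      using A[OF that] by (simp add: carrier_BijGroup auto_def)
    fix g h assume gh: "g \<in> carrier R" "h \<in> carrier R"
    have "A (g \<otimes>\<^bsub>R\<^esub> h) = compose (carrier H) (A g) (A h)"
    proof (rule extensionalityI[of _ "carrier H"])
      show "A (g \<otimes>\<^bsub>R\<^esub> h) \<in> extensional (carrier H)" using autoD(1)[OF A[OF Ga.m_closed[OF gh]]] .
      show "A (g \<otimes>\<^bsub>R\<^esub> h) w = compose (carrier H) (A g) (A h) w" if "w \<in> carrier H" for w
        using A_mult[OF gh that] that by (simp add: compose_def)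
    qed simp
    then show "A (g \<otimes>\<^bsub>R\<^esub> h) = A g \<otimes>\<^bsub>BijGroup (carrier H)\<^esub> A h"
      using A gh by (simp add: BijGroup_mult auto_def)
  qed
  then show ?thesis
    by (intro group_action.intro group_hom.intro group_hom_axioms.intro Ga.is_group group_BijGroup)
qed

lemma comm: "x \<in> carrier H \<Longrightarrow> y \<in> carrier H \<Longrightarrow> x \<otimes> y = y \<otimes> x"
  using G.prime_square_comm[OF p(1) oH] .

text \<open>Take \<open>z\<close> fixed by all \<open>A h\<close> and write \<open>A g\<close> on \<open>v = k g\<close> as \<open>v \<mapsto> z\<^sup>a v\<^sup>b\<close>. Here \<open>b \<equiv> 1\<close> modulo \<open>p\<close> because
  the order of \<open>A g\<close> is a power of \<open>p\<close>, so \<open>k (g\<^sup>p)\<close> is \<open>z\<close> to the power \<open>a p (p - 1) / 2\<close> times \<open>v\<^sup>p\<close>,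
  which is trivial for odd \<open>p\<close>.\<close>

lemma elementary_transfer:
  assumes e: "\<And>x. x \<in> carrier H \<Longrightarrow> x [^] p = \<one>" and g: "g \<in> carrier R"
  shows "g [^]\<^bsub>R\<^esub> p = \<one>\<^bsub>R\<^esub>"
proof -
  interpret act: group_action R "carrier H" A by (rule action)
  have "p dvd card (carrier H)" using oH by (simp add: order_def)
  \<comment> \<open>The p-group \<open>R\<close> acts on \<open>H\<close>, a set of p^2 points, and
    fixes the identity; so it fixes a second point.\<close>
  then obtain z where z: "z \<in> carrier H" "z \<noteq> \<one>" and zf: "\<And>h. h \<in> carrier R \<Longrightarrow> A h z = z"
    using act.second_fixed_point[OF p(1) oR finG _ G.one_closed G.auto_one[OF A]] by blast
  define v where "v = k g"
  define \<alpha> where "\<alpha> = A g"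
  have v: "v \<in> carrier H" using g k_closed by (simp add: v_def)
  have a: "\<alpha> \<in> auto H" "\<alpha> z = z" using A zf g by (simp_all add: \<alpha>_def)
  have apow: "\<alpha> (x [^] (n::nat)) = \<alpha> x [^] n" if "x \<in> carrier H" for x n using G.auto_pow[OF a(1) that] .
  have ks: "k (g [^]\<^bsub>R\<^esub> Suc n) = v \<otimes> \<alpha> (k (g [^]\<^bsub>R\<^esub> n))" for n
    using k_pow_Suc[OF g] by (simp add: v_def \<alpha>_def)
  have "k (g [^]\<^bsub>R\<^esub> p) = \<one>"
  \<comment> \<open>If v is a power of z, it is fixed by \<alpha> and k(g^n) = v^n. Otherwise z and
    v generate \<open>H\<close>.\<close>
  proof (cases "\<exists>c::nat. v = z [^] c")
    case True
    then obtain c :: nat where c: "v = z [^] c" by blast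
    have av: "\<alpha> v = v" using apow[OF z(1)] a(2) by (simp add: c)
    have "k (g [^]\<^bsub>R\<^esub> n) = v [^] n" for n :: nat
    proof (induction n)
      case (Suc n)
      then show ?case unfolding ks using v av by (simp add: apow G.nat_pow_Suc2[symmetric])
    qed (simp add: k_one)
    then show ?thesis using e[OF v] by simp
  next
    case False
    define K where "K = {z [^] a \<otimes> v [^] b |a b. a \<in> (UNIV::nat set) \<and> b \<in> (UNIV::nat set)}"
    have KH: "K \<subseteq> carrier H" using z v by (auto simp: K_def)
    have mm: "(z [^] a \<otimes> v [^] b) \<otimes> (z [^] c \<otimes> v [^] d) = z [^] (a + c) \<otimes> v [^] (b + d)" for a b c d :: nat
    proof -
      have "(z [^] a \<otimes> v [^] b) \<otimes> (z [^] c \<otimes> v [^] d) = z [^] a \<otimes> (v [^] b \<otimes> z [^] c) \<otimes> v [^] d"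
        using z v by (simp add: G.m_assoc)
      also have "v [^] b \<otimes> z [^] c = z [^] c \<otimes> v [^] b" using z v by (intro comm) auto
      also have "z [^] a \<otimes> (z [^] c \<otimes> v [^] b) \<otimes> v [^] d = (z [^] a \<otimes> z [^] c) \<otimes> (v [^] b \<otimes> v [^] d)"
        using z v by (simp add: G.m_assoc)
      finally show ?thesis using z v by (simp add: G.nat_pow_mult)
    qed
    have "subgroup K H"
    proof (rule G.finite_closed_subgroup)
      show "finite K" using KH finG by (rule finite_subset)
      have "\<one> = z [^] (0::nat) \<otimes> v [^] (0::nat)" by simp
      then show "\<one> \<in> K" unfolding K_def by blast
      show "x \<otimes> y \<in> K" if xy: "x \<in> K" "y \<in> K" for x y
      proof -
        obtain a b c d where "x = z [^] (a::nat) \<otimes> v [^] (b::nat)" "y = z [^] (c::nat) \<otimes> v [^] (d::nat)"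
          using xy unfolding K_def by blast
        then have "x \<otimes> y = z [^] (a + c) \<otimes> v [^] (b + d)" by (simp only: mm)
        then show ?thesis unfolding K_def by blast
      qed
    qed (rule KH)
    moreover have "z \<in> K"
    proof -
      have "z = z [^] (1::nat) \<otimes> v [^] (0::nat)" using z by simp
      then show ?thesis unfolding K_def by blast
    qed
    moreover have "v \<in> K"
    proof -
      have "v = z [^] (0::nat) \<otimes> v [^] (1::nat)" using v by simp
      then show ?thesis unfolding K_def by blast
    qed
    ultimately have K: "K = carrier H"
      using G.prime_square_generators[OF p(1) oH _ _ z(2)] False by blast
    have "\<alpha> v \<in> K" unfolding K by (rule autoD(3)[OF a(1) v])
    then obtain a b :: nat where ab: "\<alpha> v = z [^] a \<otimes> v [^] b" unfolding K_def by blast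
    \<comment> \<open>Iterating \<alpha> raises the exponent of v to powers of b; the accumulated
      power of z is irrelevant.\<close>
    have it: "\<exists>c::nat. (\<alpha> ^^ n) v = z [^] c \<otimes> v [^] (b ^ n)" for n
    proof (induction n)
      case 0
      have "v = z [^] (0::nat) \<otimes> v [^] (1::nat)" using v by simp
      then show ?case by (intro exI[of _ 0]) simp
    next
      case (Suc n)
      then obtain c :: nat where c: "(\<alpha> ^^ n) v = z [^] c \<otimes> v [^] (b ^ n)" by blast
      have "(\<alpha> ^^ Suc n) v = \<alpha> (z [^] c \<otimes> v [^] (b ^ n))" using c by simp
      also have "\<dots> = z [^] c \<otimes> (z [^] a \<otimes> v [^] b) [^] (b ^ n)"
        using z v a(2) ab by (simp add: autoD(4)[OF a(1)] apow)
      also have "(z [^] a \<otimes> v [^] b) [^] (b ^ n) = z [^] (a * b ^ n) \<otimes> v [^] (b ^ Suc n)"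
        using z v G.pow_mult_distrib[OF comm, of "z [^] a" "v [^] b" "b ^ n"] by (simp add: G.nat_pow_pow)
      also have "z [^] c \<otimes> \<dots> = z [^] (c + a * b ^ n) \<otimes> v [^] (b ^ Suc n)"
        using z v by (simp add: G.m_assoc[symmetric] G.nat_pow_mult)
      finally show ?case by blast
    qed
    have "g [^]\<^bsub>R\<^esub> p\<^sup>2 = \<one>\<^bsub>R\<^esub>" using Ga.pow_order_eq_1[OF g] oR by simp
    then have "(\<alpha> ^^ p\<^sup>2) v = v" using A_pow[OF g v, of "p\<^sup>2"] A_one[OF v] by (simp add: \<alpha>_def)
    then obtain c :: nat where c: "v = z [^] c \<otimes> v [^] (b ^ p\<^sup>2)" using it[of "p\<^sup>2"] by auto
    \<comment> \<open>This is b^(p^2) - 1 modulo p, written without subtraction. The equation for v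
      gives z^c v^d = 1, so v would be a power of z if d were a unit modulo p.\<close>
    define d where "d = b ^ p\<^sup>2 + (p - 1)"
    have "p dvd d"
    proof (rule ccontr)
      assume "\<not> p dvd d"
      then have "coprime d p" using p(1) by (metis coprime_commute prime_imp_coprime)
      then obtain d' where d': "[d * d' = 1] (mod p)" using cong_solve_coprime_nat by auto
      have pw: "x [^] n = x [^] n'" if x: "x \<in> carrier H" and "[n = n'] (mod p)" for x and n n' :: nat
      proof -
        have red: "x [^] n = x [^] (n mod p)" for n :: nat
        proof -
          have "x [^] n = x [^] (p * (n div p) + n mod p)" by simp
          also have "\<dots> = (x [^] p) [^] (n div p) \<otimes> x [^] (n mod p)"
            using x by (simp only: G.nat_pow_mult[symmetric] G.nat_pow_pow)
          finally show ?thesis using e[OF x] x by simp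
        qed
        show ?thesis using red[of n] red[of n'] that(2) by (simp add: cong_def)
      qed
      have "v [^] p = v [^] Suc (p - 1)" using p1 by simp
      also have "\<dots> = v \<otimes> v [^] (p - 1)" using v by (rule G.nat_pow_Suc2)
      also have "\<dots> = z [^] c \<otimes> v [^] (b ^ p\<^sup>2) \<otimes> v [^] (p - 1)" using c by simp
      also have "\<dots> = z [^] c \<otimes> v [^] d" using z v by (simp add: G.m_assoc G.nat_pow_mult d_def)
      finally have 1: "z [^] c \<otimes> v [^] d = \<one>" using e[OF v] by simp
      have "v [^] d = (z [^] p) [^] c \<otimes> v [^] d" using e z v by simp
      also have "\<dots> = z [^] (c * (p - 1) + c) \<otimes> v [^] d"
        using z p1 by (simp add: G.nat_pow_pow algebra_simps)
      also have "\<dots> = z [^] (c * (p - 1)) \<otimes> (z [^] c \<otimes> v [^] d)"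
        using z v by (simp add: G.nat_pow_mult[symmetric] G.m_assoc)
      finally have "v [^] d = z [^] (c * (p - 1))" using 1 z by simp
      then have "v [^] (d * d') = z [^] (c * (p - 1) * d')" using v z by (simp add: G.nat_pow_pow[symmetric])
      moreover have "v [^] (d * d') = v" using pw[OF v d'] v by simp
      ultimately show False using False by metis
    qed
    then have "[b ^ p\<^sup>2 = 1] (mod p)"
    proof -
      have "d = b ^ p\<^sup>2 + p - 1" using p1 by (simp add: d_def)
      then have "b ^ p\<^sup>2 + p = d + 1" using p1 by simp
      moreover have "[d + 1 = 0 + 1] (mod p)" using \<open>p dvd d\<close> by (intro cong_add) (simp_all add: cong_0_iff)
      ultimately have "[b ^ p\<^sup>2 + p = 1] (mod p)" by simp
      then show ?thesis by (simp add: cong_def)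
    qed
    then have "[int b ^ p\<^sup>2 = 1] (mod int p)" by (metis cong_int_iff of_nat_1 of_nat_power)
    moreover have "coprime (p\<^sup>2) (totient p)"
    proof -
      have "\<not> p dvd p - 1" using p1 by (auto dest: dvd_imp_le)
      then show ?thesis using p(1) by (simp add: totient_prime prime_imp_coprime)
    qed
    ultimately have "[int b = 1] (mod int p)" using p1 cong_one_of_pow by simp
    then have b1: "[b = 1] (mod p)" by (metis cong_int_iff of_nat_1)
    have vb: "v [^] b = v"
    proof -
      have "v [^] b = v [^] (p * (b div p) + b mod p)" by simp
      also have "\<dots> = (v [^] p) [^] (b div p) \<otimes> v [^] (b mod p)"
        using v by (simp only: G.nat_pow_mult[symmetric] G.nat_pow_pow)
      finally show ?thesis using e[OF v] v b1 p1 by (simp add: cong_def)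
    qed
    have "k (g [^]\<^bsub>R\<^esub> n) = z [^] (a * (\<Sum>i<n. i)) \<otimes> v [^] n" for n :: nat
    proof (induction n)
      case (Suc n)
      have "k (g [^]\<^bsub>R\<^esub> Suc n) = v \<otimes> (z [^] (a * (\<Sum>i<n. i)) \<otimes> (z [^] a \<otimes> v) [^] n)"
        unfolding ks Suc using z v a(2) ab vb by (simp add: autoD(4)[OF a(1)] apow)
      also have "(z [^] a \<otimes> v) [^] n = z [^] (a * n) \<otimes> v [^] n"
        using z v G.pow_mult_distrib[OF comm, of "z [^] a" v n] by (simp add: G.nat_pow_pow)
      also have "v \<otimes> (z [^] (a * (\<Sum>i<n. i)) \<otimes> (z [^] (a * n) \<otimes> v [^] n)) = v \<otimes> (z [^] (a * (\<Sum>i<Suc n. i)) \<otimes> v [^] n)"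
        using z v by (simp add: G.m_assoc[symmetric] G.nat_pow_mult algebra_simps)
      also have "\<dots> = (v \<otimes> z [^] (a * (\<Sum>i<Suc n. i))) \<otimes> v [^] n"
        using z v by (simp only: G.m_assoc[symmetric] G.nat_pow_closed)
      also have "v \<otimes> z [^] (a * (\<Sum>i<Suc n. i)) = z [^] (a * (\<Sum>i<Suc n. i)) \<otimes> v" using z v by (intro comm) auto
      also have "\<dots> \<otimes> v [^] n = z [^] (a * (\<Sum>i<Suc n. i)) \<otimes> v [^] Suc n"
        using z v by (simp add: G.m_assoc G.nat_pow_Suc2[symmetric])
      finally show ?case .
    qed (simp add: k_one)
    moreover have "p dvd (\<Sum>i<p. i)"
    proof -
      obtain q where q: "p = 2 * q + 1" using p(2) by (auto elim: oddE)
      have "2 * (\<Sum>i<n. i) + n = n * n" for n :: nat by (induction n) auto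
      then have "2 * (\<Sum>i<p. i) + p = p * p" .
      then have "2 * (\<Sum>i<p. i) = p * (2 * q)" using q by (simp add: algebra_simps)
      then show ?thesis by simp
    qed
    then obtain l where "(\<Sum>i<p. i) = p * l" by (rule dvdE)
    then have "z [^] (a * (\<Sum>i<p. i)) = (z [^] p) [^] (l * a)" using z by (simp add: G.nat_pow_pow ac_simps)
    then have "z [^] (a * (\<Sum>i<p. i)) = \<one>" using e z by simp
    ultimately show ?thesis using e[OF v] by simp
  qed
  then show ?thesis using k_inj[of "g [^]\<^bsub>R\<^esub> p" "\<one>\<^bsub>R\<^esub>"] g by (simp add: k_one)
qed

text \<open>Let x = k(g) generate \<open>H\<close> and suppose g^p = 1. Then \<alpha> raises x to
  some power a' with (a')^p = 1 modulo p^2, so a' = 1 modulo p. But k(g^p) is x to the power 1 + a'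
  + ... + (a')^(p-1), which by lifting the exponent is not divisible by p^2.\<close>

lemma cyclic_transfer:
  assumes x: "x \<in> carrier H" "x [^] p \<noteq> \<one>"
  shows "\<exists>g\<in>carrier R. g [^]\<^bsub>R\<^esub> p \<noteq> \<one>\<^bsub>R\<^esub>"
proof -
  obtain g where g: "g \<in> carrier R" "x = k g" using k_surj[OF x(1)] by blast
  have ox: "G.ord x = p\<^sup>2" by (rule G.prime_square_cyclic(2)[OF p(1) oH x])
  have "g [^]\<^bsub>R\<^esub> p \<noteq> \<one>\<^bsub>R\<^esub>"
  proof
    assume gp: "g [^]\<^bsub>R\<^esub> p = \<one>\<^bsub>R\<^esub>"
    define \<alpha> where "\<alpha> = A g"
    have a: "\<alpha> \<in> auto H" using A g by (simp add: \<alpha>_def)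
    have "x [^] (n::nat) \<in> carrier H" for n using x by simp
    then have "(\<lambda>n::nat. x [^] n) ` {0 .. G.ord x - 1} = carrier H"
      using card_image[OF G.ord_inj[OF x(1)]] ox p1 oH finG by (intro card_subset_eq) (auto simp: order_def)
    then obtain a' :: nat where a': "\<alpha> x = x [^] a'" using autoD(3)[OF a x(1)] by blast
    have apow: "\<alpha> (x [^] (n::nat)) = x [^] (a' * n)" for n
      using G.auto_pow[OF a x(1)] a' x by (simp add: G.nat_pow_pow)
    have "(\<alpha> ^^ n) x = x [^] (a' ^ n)" for n by (induction n) (use x apow in auto)
    moreover have "(\<alpha> ^^ p) x = x" using A_pow[OF g(1) x(1), of p] A_one[OF x(1)] gp by (simp add: \<alpha>_def)
    ultimately have xa: "x [^] (a' ^ p) = x" by simp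
    have "a' ^ p \<noteq> 0"
    proof
      assume "a' ^ p = 0"
      then have "x [^] (0::nat) = x" using xa by metis
      then have "x = \<one>" by simp
      then show False using x(2) by simp
    qed
    then have sa: "a' ^ p = Suc (a' ^ p - 1)" by simp
    have "x [^] (a' ^ p - 1) \<otimes> x = x"
      using xa by (subst (asm) sa) (simp only: G.nat_pow_Suc)
    then have "x [^] (a' ^ p - 1) = \<one>" using x(1) by simp
    then have "p\<^sup>2 dvd a' ^ p - 1" using G.pow_eq_id[OF x(1)] ox by simp
    then have "p dvd a' ^ p - 1" by (rule dvd_trans[rotated]) simp
    then have "[a' ^ p - 1 + 1 = 0 + 1] (mod p)" by (intro cong_add) (simp_all add: cong_0_iff)
    then have "[a' ^ p = 1] (mod p)" using sa by simp
    then have "[int a' ^ p = 1] (mod int p)" by (metis cong_int_iff of_nat_1 of_nat_power)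
    moreover have "coprime p (totient p)"
    proof -
      have "\<not> p dvd p - 1" using p1 by (auto dest: dvd_imp_le)
      then show ?thesis using p(1) by (simp add: totient_prime prime_imp_coprime)
    qed
    ultimately have a1: "[int a' = 1] (mod int p)" using p1 cong_one_of_pow by simp
    define s where "s n = (\<Sum>i<n. a' ^ i)" for n
    have sS: "s (Suc n) = 1 + a' * s n" for n
      by (simp add: s_def sum_distrib_left sum.lessThan_Suc_shift del: sum.lessThan_Suc)
    have sg: "int (s n) = gsum n (int a') 1" for n
    proof (induction n)
      case (Suc n)
      then show ?case by (simp add: sS)
    qed (simp add: s_def)
    have "k (g [^]\<^bsub>R\<^esub> n) = x [^] s n" for n :: nat
    proof (induction n)
      case (Suc n)
      have "k (g [^]\<^bsub>R\<^esub> Suc n) = x \<otimes> \<alpha> (x [^] s n)" using k_pow_Suc[OF g(1), of n] Suc g(2) by (simp add: \<alpha>_def)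
      also have "\<dots> = x [^] s (Suc n)" using x by (simp add: apow sS G.nat_pow_Suc2[symmetric])
      finally show ?case .
    qed (simp add: k_one s_def)
    then have "x [^] s p = \<one>" using gp k_one by metis
    then have "p\<^sup>2 dvd s p" using G.pow_eq_id[OF x(1)] ox by simp
    then have "int (p\<^sup>2) dvd gsum p (int a') 1" unfolding sg[symmetric] by (simp only: int_dvd_int_iff)
    then have "p\<^sup>2 dvd p" using dvd_gsum_iff[OF p(1) _ a1, of "p\<^sup>2" p] p(2) by simp
    then show False using p1 by (auto dest!: dvd_imp_le simp: power2_eq_square)
  qed
  then show ?thesis using g by blast
qed

text \<open>A group of order p^2 is determined by whether all p-th powers are trivial, and the two
  transfer lemmas carry this property across k.\<close>

lemma iso_RH: "R \<cong> H"
proof -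
  have p0: "p > 0" "p\<^sup>2 > 0" using p1 by auto
  show ?thesis
  proof (cases "\<forall>x\<in>carrier H. x [^] p = \<one>")
    case True
    then have "sdp p p 1 \<cong> H" by (intro G.prime_square_elementary[OF p(1) oH]) auto
    moreover have "sdp p p 1 \<cong> R" using elementary_transfer True by (intro Ga.prime_square_elementary[OF p(1) oR]) auto
    ultimately show ?thesis using group.iso_sym[OF group_sdp_one[OF p0(1) p0(1)]] iso_trans by blast
  next
    case False
    then obtain x where x: "x \<in> carrier H" "x [^] p \<noteq> \<one>" by blast
    obtain g where g: "g \<in> carrier R" "g [^]\<^bsub>R\<^esub> p \<noteq> \<one>\<^bsub>R\<^esub>" using cyclic_transfer[OF x] by blast
    have "sdp (p\<^sup>2) 1 1 \<cong> H" by (rule G.prime_square_cyclic(1)[OF p(1) oH x])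
    moreover have "sdp (p\<^sup>2) 1 1 \<cong> R" by (rule Ga.prime_square_cyclic(1)[OF p(1) oR g])
    ultimately show ?thesis using group.iso_sym[OF group_sdp_one[OF p0(2) zero_less_one]] iso_trans by blast
  qed
qed

end

lemma prime_square_iso:
  fixes R :: "('a, 'c) monoid_scheme" and H :: "('b, 'd) monoid_scheme" and p :: nat
  assumes "group R" "group H" and p: "Factorial_Ring.prime p" "odd p"
    and oR: "order R = p\<^sup>2" and oH: "order H = p\<^sup>2"
    and k: "bij_betw k (carrier R) (carrier H)"
    and A: "\<And>g. g \<in> carrier R \<Longrightarrow> \<exists>\<alpha>\<in>auto H. \<forall>x\<in>carrier R. k (g \<otimes>\<^bsub>R\<^esub> x) = k g \<otimes>\<^bsub>H\<^esub> \<alpha> (k x)"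
  shows "R \<cong> H"
proof -
  have "p > 0" using p(1) by (rule prime_gt_0_nat)
  then have fin: "finite (carrier R)" "finite (carrier H)" using oR oH by (simp_all add: order_def card_ge_0_finite)
  obtain A' where "\<forall>g\<in>carrier R. A' g \<in> auto H \<and> (\<forall>x\<in>carrier R. k (g \<otimes>\<^bsub>R\<^esub> x) = k g \<otimes>\<^bsub>H\<^esub> A' g (k x))"
    using A by metis
  then interpret prime_square_pair R H p k A'
    using assms fin by (intro prime_square_pair.intro two_groups.intro two_groups_axioms.intro prime_square_pair_axioms.intro) auto
  show ?thesis by (rule iso_RH)
qed

section \<open>Normal Sylow subgroups\<close>

text \<open>An orbit of the p-group \<open>L\<close> has p-power length; confined to fewer than p
  points it is a single point.\<close>

lemma (in group_action) fixed_if_orbit_small: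
  fixes p :: nat
  assumes p: "Factorial_Ring.prime p" and L: "subgroup L G" and cL: "card L = p ^ k"
    and Y: "orbit G \<phi> x \<subseteq> Y" "finite Y" "card Y < p" and x: "x \<in> E" and g: "g \<in> L"
  shows "\<phi> g x = x"
proof -
  interpret LA: group_action "G\<lparr>carrier := L\<rparr>" E \<phi> by (rule induced_action[OF L])
  let ?O = "orbit (G\<lparr>carrier := L\<rparr>) \<phi> x"
  have LG: "L \<subseteq> carrier G" using L by (rule subgroup.subset)
  have "?O \<subseteq> Y" using Y(1) LG by (auto simp: orbit_def)
  then have "card ?O < p" "finite ?O" using Y card_mono[of Y ?O] finite_subset by auto
  moreover have "card ?O dvd p ^ k"
    using LA.orbit_stabilizer_theorem[OF x] cL by (simp add: order_def) (metis dvd_triv_left)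
  then obtain j where "card ?O = p ^ j" using p by (metis divides_primepow_nat)
  ultimately have "card ?O = 1" using prime_gt_1_nat[OF p] by (cases j) auto
  then obtain y where "?O = {y}" by (metis card_1_singletonE)
  moreover have "x \<in> ?O" using LA.orbit_refl[OF x] .
  moreover have "\<phi> g x \<in> ?O" using g by (auto simp: orbit_def)
  ultimately show ?thesis by simp
qed

context group
begin

definition conj_act :: "'a \<Rightarrow> 'a set \<Rightarrow> 'a set" where
  "conj_act = (\<lambda>g. \<lambda>H \<in> {H. subgroup H G}. g <# H #> inv g)"

lemma conj_action: "group_action G {H. subgroup H G} conj_act"
  unfolding conj_act_def by (rule action_by_conjugation_on_subgroups_set)

lemma conj_act_eq: "subgroup H G \<Longrightarrow> g \<in> carrier G \<Longrightarrow> conj_act g H = (\<lambda>h. g \<otimes> h \<otimes> inv g) ` H"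
  using subgroup.subset[of H G] by (auto simp: conj_act_def l_coset_def r_coset_def)

lemma conj_act_subgroup: "subgroup H G \<Longrightarrow> g \<in> carrier G \<Longrightarrow> subgroup (conj_act g H) G"
  using subgroup_conjugation_is_surj2 by (simp add: conj_act_def)

lemma card_conj_act:
  assumes H: "subgroup H G" and g: "g \<in> carrier G" shows "card (conj_act g H) = card H"
  unfolding conj_act_eq[OF H g]
  using subgroup.subset[OF H] g by (intro card_image inj_onI) (auto simp: subset_iff)

lemma conj_act_self:
  assumes fin: "finite (carrier G)" and H: "subgroup H G" and g: "g \<in> H"
  shows "conj_act g H = H"
proof -
  have gG: "g \<in> carrier G" using g subgroup.subset[OF H] by auto
  have "conj_act g H \<subseteq> H" unfolding conj_act_eq[OF H gG]
    using g H by (auto intro!: subgroup.m_closed[OF H] subgroup.m_inv_closed[OF H])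
  moreover have "finite H" using subgroup.subset[OF H] fin by (rule finite_subset)
  ultimately show ?thesis using card_conj_act[OF H gG] by (intro card_subset_eq) auto
qed

definition conjugates :: "'a set \<Rightarrow> 'a set set" where
  "conjugates H = orbit G conj_act H"

lemma conjugates_subgroup:
  assumes "subgroup H G" "K \<in> conjugates H" shows "subgroup K G" "card K = card H"
  using assms conj_act_subgroup card_conj_act by (auto simp: conjugates_def orbit_def)

lemma finite_conjugates: "finite (carrier G) \<Longrightarrow> subgroup H G \<Longrightarrow> finite (conjugates H)"
proof -
  assume fin: "finite (carrier G)" and H: "subgroup H G"
  have "conjugates H \<subseteq> Pow (carrier G)"
  proof
    fix K assume "K \<in> conjugates H"
    then show "K \<in> Pow (carrier G)" using subgroup.subset[OF conjugates_subgroup(1)[OF H]] by blast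
  qed
  then show ?thesis using fin by (simp add: finite_subset)
qed

lemma conjugates_eq:
  assumes H: "subgroup H G" and K: "K \<in> conjugates H" shows "conjugates K = conjugates H"
proof -
  interpret act: group_action G "{H. subgroup H G}" conj_act by (rule conj_action)
  have KK: "subgroup K G" using conjugates_subgroup[OF H K] by simp
  have "K \<in> conjugates K" using act.orbit_refl[of K] KK by (simp add: conjugates_def)
  moreover have "conjugates H \<in> orbits G {H. subgroup H G} conj_act" "conjugates K \<in> orbits G {H. subgroup H G} conj_act"
    using H KK unfolding orbits_def conjugates_def by blast+
  ultimately show ?thesis using act.disjoint_union K by blast
qed

text \<open>The witness is the normaliser of \<open>K\<close>, whose index is the number of
  conjugates.\<close>

lemma conjugates_stabilizer:
  assumes fin: "finite (carrier G)" and H: "subgroup H G" and K: "K \<in> conjugates H"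
  shows "\<exists>N. subgroup N G \<and> K \<subseteq> N \<and> card (conjugates H) * card N = order G \<and>
    (\<forall>g\<in>carrier G. conj_act g K = K \<longrightarrow> g \<in> N)"
proof -
  interpret act: group_action G "{H. subgroup H G}" conj_act by (rule conj_action)
  have KK: "subgroup K G" using conjugates_subgroup[OF H K] by simp
  let ?N = "stabilizer G conj_act K"
  have "subgroup ?N G" using act.stabilizer_subgroup KK by simp
  moreover have "K \<subseteq> ?N" using conj_act_self[OF fin KK] subgroup.subset[OF KK] by (auto simp: stabilizer_def)
  moreover have "card (conjugates H) * card ?N = order G"
    using act.orbit_stabilizer_theorem[of K] KK conjugates_eq[OF H K] by (simp add: conjugates_def)
  moreover have "g \<in> ?N" if "g \<in> carrier G" "conj_act g K = K" for g using that by (simp add: stabilizer_def)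
  ultimately show ?thesis by blast
qed

lemma normal_if_conj_act_fixed:
  assumes H: "subgroup H G" and e: "\<And>g. g \<in> carrier G \<Longrightarrow> conj_act g H = H"
  shows "H \<lhd> G"
  unfolding normal_inv_iff using H e conj_act_eq[OF H] by blast

lemma normal_if_conjugates_singleton:
  assumes H: "subgroup H G" and e: "\<And>K. K \<in> conjugates H \<Longrightarrow> K = H" shows "H \<lhd> G"
  using H by (rule normal_if_conj_act_fixed) (rule e, auto simp: conjugates_def orbit_def)

lemma conj_fixed_if_few:
  fixes p :: nat
  assumes fin: "finite (carrier G)" and p: "Factorial_Ring.prime p" and L: "subgroup L G" "card L = p ^ k"
    and H: "subgroup H G" "K \<in> conjugates H" and c: "card (conjugates H) < p" and g: "g \<in> L"
  shows "conj_act g K = K"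
proof -
  interpret act: group_action G "{H. subgroup H G}" conj_act by (rule conj_action)
  have "orbit G conj_act K \<subseteq> conjugates H" using conjugates_eq[OF H] by (simp add: conjugates_def)
  then show ?thesis
    using act.fixed_if_orbit_small[OF p L _ finite_conjugates[OF fin H(1)] c _ g] conjugates_subgroup[OF H] by simp
qed

lemma card_subgroup_dvd_subgroup:
  assumes "subgroup I G" "subgroup J G" "I \<subseteq> J"
  shows "card I dvd card J"
proof -
  interpret J: group "G\<lparr>carrier := J\<rparr>" using assms(2) is_group by (rule subgroup.subgroup_is_group)
  show ?thesis using J.card_subgroup_dvd[OF subgroup_incl[OF assms]] by (simp add: order_def)
qed

lemma prime_subgroups_inter:
  fixes q :: nat
  assumes fin: "finite (carrier G)" and q: "Factorial_Ring.prime q" and A: "subgroup A G" "card A = q"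
    and B: "subgroup B G" "card B = q" and ne: "A \<noteq> B"
  shows "A \<inter> B = {\<one>}"
proof -
  have AB: "subgroup (A \<inter> B) G" using A B subgroups_Inter_pair by blast
  have finA: "finite A" "finite B" using fin A B subgroup.subset finite_subset by blast+
  have "card (A \<inter> B) dvd q" using card_subgroup_dvd_subgroup[OF AB A(1)] A(2) by simp
  moreover have "card (A \<inter> B) \<noteq> q"
  proof
    assume c: "card (A \<inter> B) = q"
    have "A \<inter> B = A" by (rule card_subset_eq) (use c finA A in auto)
    moreover have "A \<inter> B = B" by (rule card_subset_eq) (use c finA B in auto)
    ultimately show False using ne by simp
  qed
  ultimately have "card (A \<inter> B) = 1" using q by (metis prime_nat_iff)
  then obtain y where "A \<inter> B = {y}" by (metis card_1_singletonE)
  then show ?thesis using subgroup.one_closed[OF AB] by auto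
qed

text \<open>Because \<open>A\<close> and \<open>B\<close> meet trivially, the products a b are
  pairwise distinct.\<close>

lemma card_product_le:
  assumes fin: "finite N" and N: "subgroup N G" and A: "subgroup A G" "A \<subseteq> N" and B: "subgroup B G" "B \<subseteq> N" and AB: "A \<inter> B = {\<one>}"
  shows "card A * card B \<le> card N"
proof -
  have "inj_on (\<lambda>(a, b). a \<otimes> b) (A \<times> B)"
  proof (rule inj_onI, clarify)
    fix a b a' b' assume ab: "a \<in> A" "b \<in> B" "a' \<in> A" "b' \<in> B" and e: "a \<otimes> b = a' \<otimes> b'"
    have G: "a \<in> carrier G" "b \<in> carrier G" "a' \<in> carrier G" "b' \<in> carrier G"
      using ab A B subgroup.subset by blast+
    have "inv a' \<otimes> a \<otimes> b = inv a' \<otimes> (a' \<otimes> b')" using e G by (simp add: m_assoc)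
    then have "inv a' \<otimes> a \<otimes> b = b'" using G by (simp add: m_assoc[symmetric])
    then have "inv a' \<otimes> a = b' \<otimes> inv b" using G by (metis inv_solve_right m_closed inv_closed)
    moreover have "inv a' \<otimes> a \<in> A" using ab A by (simp add: subgroup.m_closed subgroup.m_inv_closed)
    moreover have "b' \<otimes> inv b \<in> B" using ab B by (simp add: subgroup.m_closed subgroup.m_inv_closed)
    ultimately have 1: "inv a' \<otimes> a = \<one>" "b' \<otimes> inv b = \<one>" using AB by auto
    show "a = a' \<and> b = b'"
    proof
      have "a' \<otimes> (inv a' \<otimes> a) = a'" using 1(1) G by simp
      then show "a = a'" using G by (simp add: m_assoc[symmetric])
      have "(b' \<otimes> inv b) \<otimes> b = b" using 1(2) G by simp
      then show "b = b'" using G by (simp add: m_assoc)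
    qed
  qed
  then have "card ((\<lambda>(a, b). a \<otimes> b) ` (A \<times> B)) = card A * card B" by (simp add: card_image card_cartesian_product)
  moreover have "(\<lambda>(a, b). a \<otimes> b) ` (A \<times> B) \<subseteq> N" using A B N by (auto intro: subgroup.m_closed)
  ultimately show ?thesis using fin by (metis card_mono)
qed

text \<open>The number of conjugates of a Sylow subgroup is bounded by its index. For q < p this
  makes the Sylow p-subgroup normal; for p < q the Sylow q-subgroup is normal unless it has p^2
  conjugates, and these leave room for just one subgroup of order p^2.\<close>

lemma normal_sylow_exists:
  fixes p q :: nat
  assumes p: "Factorial_Ring.prime p" and q: "Factorial_Ring.prime q" and pq: "p \<noteq> q"
    and fin: "finite (carrier G)" and o: "order G = p\<^sup>2 * q"
  shows "(\<exists>P. P \<lhd> G \<and> card P = p\<^sup>2) \<or> (\<exists>Q. Q \<lhd> G \<and> card Q = q)"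
proof -
  have p1: "p > 1" "q > 1" using p q prime_gt_1_nat by auto
  obtain P where P: "subgroup P G" "card P = p\<^sup>2" using sylow_thm[OF p is_group o fin] by blast
  have o': "order G = q ^ 1 * p\<^sup>2" using o by simp
  obtain Q where Q: "subgroup Q G" "card Q = q" using sylow_thm[OF q is_group o' fin] by auto
  have finsub: "finite H" if "subgroup H G" for H using subgroup.subset[OF that] fin by (rule finite_subset)
  show ?thesis
  proof (cases "q < p")
    case True
    \<comment> \<open>There are at most q < p conjugates, so \<open>P\<close> fixes each of them and
      lies in the normaliser \<open>N\<close> of \<open>K\<close>. A conjugate other than
      \<open>P\<close> would make their number q and the order of \<open>N\<close> equal to p^2, so
      that \<open>N\<close> equals both.\<close>
    have "K = P" if K: "K \<in> conjugates P" for K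
    proof (rule ccontr)
      assume ne: "K \<noteq> P"
      note KK = conjugates_subgroup[OF P(1) K]
      obtain N where N: "subgroup N G" "K \<subseteq> N" "card (conjugates P) * card N = order G"
        "\<And>g. g \<in> carrier G \<Longrightarrow> conj_act g K = K \<Longrightarrow> g \<in> N"
        using conjugates_stabilizer[OF fin P(1) K] by blast
      obtain l where l: "card N = p\<^sup>2 * l" using card_subgroup_dvd_subgroup[OF KK(1) N(1,2)] KK(2) P(2) by (auto elim: dvdE)
      then have "card (conjugates P) * l = q" using N(3) o p1 by (simp add: ac_simps)
      then have cx: "card (conjugates P) dvd q" by (metis dvd_triv_left)
      then have "card (conjugates P) \<le> q" using p1 by (intro dvd_imp_le) auto
      then have lt: "card (conjugates P) < p" using True by simp
      have "P \<subseteq> N" using conj_fixed_if_few[OF fin p P(1) P(2) P(1) K lt] N(4) subgroup.subset[OF P(1)] by blast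
      have "card (conjugates P) \<noteq> 1"
      proof
        assume "card (conjugates P) = 1"
        then obtain Y where Y: "conjugates P = {Y}" by (metis card_1_singletonE)
        interpret act: group_action G "{H. subgroup H G}" conj_act by (rule conj_action)
        have "P \<in> conjugates P" using act.orbit_refl[of P] P by (simp add: conjugates_def)
        then show False using Y K ne by auto
      qed
      then have "card (conjugates P) = q" using cx q by (metis prime_nat_iff)
      then have "l = 1" using \<open>card (conjugates P) * l = q\<close> p1 by simp
      then have cN: "card N = p\<^sup>2" using l by simp
      have "K = N" by (rule card_subset_eq[OF finsub[OF N(1)] N(2)]) (use cN KK P in simp)
      moreover have "P = N" by (rule card_subset_eq[OF finsub[OF N(1)] \<open>P \<subseteq> N\<close>]) (use cN P in simp)
      ultimately show False using ne by simp
    qed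
    then have "P \<lhd> G" by (rule normal_if_conjugates_singleton[OF P(1)])
    then show ?thesis using P by blast
  next
    case False
    then have qp: "p < q" using pq by simp
    let ?X = "conjugates Q"
    interpret act: group_action G "{H. subgroup H G}" conj_act by (rule conj_action)
    have QX: "Q \<in> ?X" using act.orbit_refl[of Q] Q by (simp add: conjugates_def)
    have cN: "card ?X * card N = p\<^sup>2 * q \<Longrightarrow> q dvd card N \<Longrightarrow> card ?X dvd p\<^sup>2" for N :: "'a set"
    proof -
      assume a: "card ?X * card N = p\<^sup>2 * q" "q dvd card N"
      then obtain l where "card N = q * l" by (auto elim: dvdE)
      then have "card ?X * l = p\<^sup>2" using a(1) p1 by (simp add: ac_simps)
      then show ?thesis by (metis dvd_triv_left)
    qed
    obtain N where N: "subgroup N G" "Q \<subseteq> N" "card ?X * card N = order G" using conjugates_stabilizer[OF fin Q(1) QX] by blast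
    have "card ?X dvd p\<^sup>2" using cN[of N] N o card_subgroup_dvd_subgroup[OF Q(1) N(1,2)] Q(2) by simp
    then obtain j where j: "card ?X = p ^ j" "j \<le> 2" using p divides_primepow_nat by blast
    have finX: "finite ?X" by (rule finite_conjugates[OF fin Q(1)])
    consider "j = 0" | "j = 1" | "j = 2" using j(2) by linarith
    then show ?thesis
    proof cases
      case 1
      then obtain Y where "?X = {Y}" using j by (metis card_1_singletonE power_0)
      then have "Q \<lhd> G" using QX by (intro normal_if_conjugates_singleton[OF Q(1)]) auto
      then show ?thesis using Q by blast
    next
      case 2
      have lt: "card ?X < q" using j 2 qp by simp
      \<comment> \<open>With p < q conjugates, \<open>Q\<close> normalises \<open>K\<close>. If the
        two differed, their products would be q^2 elements of a normaliser of order p q.\<close>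
      have "K = Q" if K: "K \<in> ?X" for K
      proof (rule ccontr)
        assume ne: "K \<noteq> Q"
        note KK = conjugates_subgroup[OF Q(1) K]
        obtain N where N: "subgroup N G" "K \<subseteq> N" "card ?X * card N = order G"
          "\<And>g. g \<in> carrier G \<Longrightarrow> conj_act g K = K \<Longrightarrow> g \<in> N"
          using conjugates_stabilizer[OF fin Q(1) K] by blast
        have "p * card N = p * (p * q)" using N(3) o j 2 by (simp add: power2_eq_square ac_simps)
        then have cN: "card N = p * q" using p1 by simp
        have Q1: "card Q = q ^ 1" using Q by simp
        have "Q \<subseteq> N" using conj_fixed_if_few[OF fin q Q(1) Q1 Q(1) K lt] N(4) subgroup.subset[OF Q(1)] by blast
        then have "card K * card Q \<le> card N"
          using prime_subgroups_inter[OF fin q KK(1) _ Q ne] KK Q by (intro card_product_le[OF finsub[OF N(1)] N(1) KK(1) N(2) Q(1)]) auto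
        then show False using KK Q cN qp p1 by simp
      qed
      then have "Q \<lhd> G" by (rule normal_if_conjugates_singleton[OF Q(1)])
      then show ?thesis using Q by blast
    next
      case 3
      \<comment> \<open>The p^2 conjugates meet only in 1 and account for p^2 (q - 1) elements. A
        subgroup of order p^2 avoids all of these, so it is the complement.\<close>
      define W where "W = (\<Union>K\<in>?X. K - {\<one>})"
      have "card W = (\<Sum>K\<in>?X. card (K - {\<one>}))"
        unfolding W_def
      proof (rule card_UN_disjoint[OF finX])
        show "\<forall>K\<in>?X. finite (K - {\<one>})" using conjugates_subgroup[OF Q(1)] finsub by blast
        show "\<forall>K\<in>?X. \<forall>L\<in>?X. K \<noteq> L \<longrightarrow> (K - {\<one>}) \<inter> (L - {\<one>}) = {}"
        proof (intro ballI impI)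
          fix K L assume "K \<in> ?X" "L \<in> ?X" "K \<noteq> L"
          then have "K \<inter> L = {\<one>}" using conjugates_subgroup[OF Q(1)] Q(2) by (intro prime_subgroups_inter[OF fin q]) auto
          then show "(K - {\<one>}) \<inter> (L - {\<one>}) = {}" by blast
        qed
      qed
      also have "\<dots> = (\<Sum>K\<in>?X. q - 1)"
      proof (rule sum.cong[OF refl])
        fix K assume K: "K \<in> ?X"
        then show "card (K - {\<one>}) = q - 1"
          using conjugates_subgroup[OF Q(1) K] Q(2) subgroup.one_closed[of K G] by (simp add: card_Diff_singleton)
      qed
      also have "\<dots> = p\<^sup>2 * (q - 1)" using j 3 by simp
      finally have cW: "card W = p\<^sup>2 * (q - 1)" .
      have WG: "W \<subseteq> carrier G" 
      proof
        fix x assume "x \<in> W"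
        then obtain K where "K \<in> ?X" "x \<in> K" by (auto simp: W_def)
        then show "x \<in> carrier G" using subgroup.subset[OF conjugates_subgroup(1)[OF Q(1)]] by blast
      qed
      have "card (carrier G - W) = p\<^sup>2 * q - p\<^sup>2 * (q - 1)"
        using card_Diff_subset[OF finite_subset[OF WG fin] WG] cW o by (simp add: order_def)
      also have "\<dots> = p\<^sup>2" using p1 by (simp add: diff_mult_distrib2[symmetric])
      finally have cC: "card (carrier G - W) = p\<^sup>2" .
      have compl: "H = carrier G - W" if H: "subgroup H G" "card H = p\<^sup>2" for H
      proof (rule card_subset_eq)
        show "H \<subseteq> carrier G - W"
        proof
          fix x assume x: "x \<in> H"
          then have xG: "x \<in> carrier G" using subgroup.subset[OF H(1)] by auto
          have "x \<notin> W"
          proof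
            assume "x \<in> W"
            then obtain K where K: "K \<in> ?X" "x \<in> K" "x \<noteq> \<one>" by (auto simp: W_def)
            have "x [^] q = \<one>" using subgroup_pow_card[OF conjugates_subgroup(1)[OF Q(1) K(1)] K(2)]
              conjugates_subgroup(2)[OF Q(1) K(1)] Q(2) by simp
            moreover have "x [^] p\<^sup>2 = \<one>" using subgroup_pow_card[OF H(1) x] H(2) by simp
            moreover have "coprime (p\<^sup>2) q" using p q pq by (simp add: primes_coprime)
            ultimately have "x = \<one>" using coprime_pow_one[OF xG] by blast
            then show False using K by simp
          qed
          then show "x \<in> carrier G - W" using xG by simp
        qed
      qed (use fin H cC in auto)
      have "P \<lhd> G"
      proof (rule normal_if_conj_act_fixed[OF P(1)])
        fix g assume g: "g \<in> carrier G"
        show "conj_act g P = P"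
          using compl[OF P] compl[OF conj_act_subgroup[OF P(1) g]] card_conj_act[OF P(1) g] P(2) by simp
      qed
      then show ?thesis using P by blast
    qed
  qed
qed

text \<open>An x killed by \<open>card N\<close> has a coset killed by both \<open>card N\<close>
  and the index, so the coset is trivial. This description shows that \<open>N\<close> is preserved
  by all automorphisms.\<close>

lemma normal_hall_eq:
  assumes N: "N \<lhd> G" and fin: "finite (carrier G)" and o: "order G = card N * b" and c: "coprime (card N) b"
  shows "N = {x \<in> carrier G. x [^] card N = \<one>}"
proof -
  interpret N: normal N G by (rule N)
  interpret Q: group "G Mod N" by (rule N.factorgroup_is_group)
  have sN: "subgroup N G" using N by (rule normal_imp_subgroup)
  have "N \<noteq> {}" using subgroup.one_closed[OF sN] by blast
  then have "card N > 0" using finite_subset[OF subgroup.subset[OF sN] fin] by (simp add: card_gt_0_iff)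
  then have "order (G Mod N) = b" using lagrange[OF sN] o by (simp add: order_def FactGroup_def)
  interpret h: group_hom G "G Mod N" "\<lambda>x. N #> x"
    by (intro group_hom.intro group_hom_axioms.intro is_group Q.is_group N.r_coset_hom_Mod)
  have "x \<in> N" if x: "x \<in> carrier G" "x [^] card N = \<one>" for x
  proof -
    have cx: "N #> x \<in> carrier (G Mod N)" using x by simp
    have "(N #> x) [^]\<^bsub>G Mod N\<^esub> card N = \<one>\<^bsub>G Mod N\<^esub>" using h.hom_nat_pow[OF x(1), of "card N"] x(2) by simp
    moreover have "(N #> x) [^]\<^bsub>G Mod N\<^esub> b = \<one>\<^bsub>G Mod N\<^esub>"
      using Q.pow_order_eq_1[OF cx] \<open>order (G Mod N) = b\<close> by simp
    ultimately have "N #> x = \<one>\<^bsub>G Mod N\<^esub>" using Q.coprime_pow_one[OF cx] c by blast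
    then have "N #> x = N" by simp
    then show ?thesis using coset_join1[of N x] x sN subgroup.subset[OF sN] by blast
  qed
  then show ?thesis using subgroup_pow_card[OF sN] subgroup.subset[OF sN] by blast
qed

end

section \<open>Crossed homomorphisms restricted to, or taken modulo, a characteristic
  subgroup\<close>

lemma (in group) coprime_subgroups_inter:
  assumes "subgroup A G" "subgroup B G" "coprime (card A) (card B)" "x \<in> A" "x \<in> B"
  shows "x = \<one>"
  using coprime_pow_one[OF _ subgroup_pow_card[OF assms(1,4)] subgroup_pow_card[OF assms(2,5)] assms(3)]
    subgroup.subset[OF assms(1)] assms(4) by blast

context two_groups
begin

context
  fixes k N a
  assumes k: "k \<in> left_hgs_maps Gam G" and N: "N \<lhd> G" "N = {x \<in> carrier G. x [^] (a::nat) = \<one>}"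
begin

lemma lk_bij: "bij_betw k S (carrier G)"
  and lk_mult: "g \<in> S \<Longrightarrow> \<exists>\<alpha>\<in>auto G. \<forall>x\<in>S. k (g \<otimes>\<^bsub>Gam\<^esub> x) = k g \<otimes> \<alpha> (k x)"
  using k unfolding left_hgs_maps_def by blast+

lemma auto_N:
  assumes \<alpha>: "\<alpha> \<in> auto G" and x: "x \<in> carrier G" shows "\<alpha> x \<in> N \<longleftrightarrow> x \<in> N"
proof -
  have "\<alpha> x [^] a = \<alpha> (x [^] a)" using G.auto_pow[OF \<alpha> x] by simp
  moreover have "\<alpha> (x [^] a) = \<one> \<longleftrightarrow> x [^] a = \<one>"
    using autoD(5)[OF \<alpha>, of "x [^] a" \<one>] G.auto_one[OF \<alpha>] x by auto
  ultimately show ?thesis using x autoD(3)[OF \<alpha> x] unfolding N(2) by simp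
qed

text \<open>The product g x is sent to k(g) \<alpha>(k(x)), and \<alpha> preserves \<open>N\<close>,
  so the preimage is closed under multiplication.\<close>

lemma preimage_subgroup: "subgroup {g \<in> S. k g \<in> N} Gam" "card {g \<in> S. k g \<in> N} = card N"
proof -
  have sN: "subgroup N G" using N(1) by (rule normal_imp_subgroup)
  show c: "card {g \<in> S. k g \<in> N} = card N"
  proof (rule bij_betw_same_card[of k])
    show "bij_betw k {g \<in> S. k g \<in> N} N"
      unfolding bij_betw_def
    proof
      show "inj_on k {g \<in> S. k g \<in> N}" using bij_betw_imp_inj_on[OF lk_bij] by (rule inj_on_subset) auto
      show "k ` {g \<in> S. k g \<in> N} = N"
      proof (intro equalityI subsetI)
        fix y assume y: "y \<in> N"
        then have "y \<in> k ` S" using subgroup.subset[OF sN] bij_betw_imp_surj_on[OF lk_bij] by blast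
        then show "y \<in> k ` {g \<in> S. k g \<in> N}" using y by blast
      qed auto
    qed
  qed
  have mc: "g \<otimes>\<^bsub>Gam\<^esub> x \<in> {g \<in> S. k g \<in> N}" if g: "g \<in> {g \<in> S. k g \<in> N}" and x: "x \<in> {g \<in> S. k g \<in> N}" for g x
  proof -
    obtain \<alpha> where \<alpha>: "\<alpha> \<in> auto G" "\<forall>x\<in>S. k (g \<otimes>\<^bsub>Gam\<^esub> x) = k g \<otimes> \<alpha> (k x)" using lk_mult g by blast
    have "\<alpha> (k x) \<in> N" using auto_N[OF \<alpha>(1), of "k x"] x map_closed[OF lk_bij] by simp
    then have "k g \<otimes> \<alpha> (k x) \<in> N" using g subgroup.m_closed[OF sN] by simp
    then show ?thesis using \<alpha>(2) g x by simp
  qed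
  have "k \<one>\<^bsub>Gam\<^esub> = \<one>"
  proof -
    obtain \<alpha> where \<alpha>: "\<alpha> \<in> auto G" "\<forall>x\<in>S. k (\<one>\<^bsub>Gam\<^esub> \<otimes>\<^bsub>Gam\<^esub> x) = k \<one>\<^bsub>Gam\<^esub> \<otimes> \<alpha> (k x)" using lk_mult by blast
    have k1: "k \<one>\<^bsub>Gam\<^esub> \<in> carrier G" using map_closed[OF lk_bij] by simp
    have "k \<one>\<^bsub>Gam\<^esub> = k \<one>\<^bsub>Gam\<^esub> \<otimes> \<alpha> (k \<one>\<^bsub>Gam\<^esub>)" using \<alpha>(2) by (metis Ga.one_closed Ga.l_one)
    then have "\<alpha> (k \<one>\<^bsub>Gam\<^esub>) = \<one>" using k1 autoD(3)[OF \<alpha>(1) k1] by (simp only: G.l_cancel_one')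
    then show ?thesis using autoD(5)[OF \<alpha>(1) k1 G.one_closed] G.auto_one[OF \<alpha>(1)] by simp
  qed
  then show "subgroup {g \<in> S. k g \<in> N} Gam"
    using finS mc subgroup.one_closed[OF sN] by (intro Ga.finite_closed_subgroup) auto
qed

text \<open>Restricted to the preimage of \<open>N\<close>, the map k is a crossed homomorphism
  between groups of order p^2, with the automorphisms restricted to \<open>N\<close>.\<close>

lemma iso_of_normal_sylow_p:
  fixes p :: nat
  assumes p: "Factorial_Ring.prime p" "odd p" and cN: "card N = p\<^sup>2"
  shows "sylow_iso p Gam G"
proof -
  let ?R = "{g \<in> S. k g \<in> N}"
  have sN: "subgroup N G" using N(1) by (rule normal_imp_subgroup)
  have NG: "N \<subseteq> carrier G" using sN by (rule subgroup.subset)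
  have "Gam\<lparr>carrier := ?R\<rparr> \<cong> G\<lparr>carrier := N\<rparr>"
  proof (rule prime_square_iso[OF _ _ p])
    show "group (Gam\<lparr>carrier := ?R\<rparr>)" using preimage_subgroup(1) Ga.is_group by (rule subgroup.subgroup_is_group)
    show "group (G\<lparr>carrier := N\<rparr>)" using sN G.is_group by (rule subgroup.subgroup_is_group)
    show "order (Gam\<lparr>carrier := ?R\<rparr>) = p\<^sup>2" "order (G\<lparr>carrier := N\<rparr>) = p\<^sup>2"
      using preimage_subgroup(2) cN by (simp_all add: order_def)
    have fin: "finite N" using NG finG by (rule finite_subset)
    have "k ` ?R \<subseteq> N" by auto
    moreover have inj: "inj_on k ?R" using bij_betw_imp_inj_on[OF lk_bij] by (rule inj_on_subset) auto
    ultimately have "k ` ?R = N" using fin preimage_subgroup(2) by (intro card_subset_eq) (auto simp: card_image)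
    then show "bij_betw k (carrier (Gam\<lparr>carrier := ?R\<rparr>)) (carrier (G\<lparr>carrier := N\<rparr>))"
      using inj by (simp add: bij_betw_def)
    fix g assume "g \<in> carrier (Gam\<lparr>carrier := ?R\<rparr>)"
    then have g: "g \<in> S" by simp
    obtain \<alpha> where \<alpha>: "\<alpha> \<in> auto G" "\<forall>x\<in>S. k (g \<otimes>\<^bsub>Gam\<^esub> x) = k g \<otimes> \<alpha> (k x)" using lk_mult[OF g] by blast
    have "restrict \<alpha> N \<in> auto (G\<lparr>carrier := N\<rparr>)"
    proof -
      have sub: "\<alpha> ` N \<subseteq> N" using auto_N[OF \<alpha>(1)] NG by blast
      have i: "inj_on \<alpha> N" using autoD(5)[OF \<alpha>(1)] NG by (intro inj_onI) blast
      have "\<alpha> ` N = N" using endo_inj_surj[OF fin sub i] .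
      then have "bij_betw (restrict \<alpha> N) N N" using i by (simp add: bij_betw_def cong: bij_betw_cong)
      moreover have "\<alpha> (x \<otimes> y) = \<alpha> x \<otimes> \<alpha> y" if "x \<in> N" "y \<in> N" for x y
        using autoD(4)[OF \<alpha>(1)] that NG by blast
      ultimately show ?thesis using sub subgroup.m_closed[OF sN] by (auto simp: auto_def Bij_def hom_def)
    qed
    then show "\<exists>\<alpha>\<in>auto (G\<lparr>carrier := N\<rparr>). \<forall>x\<in>carrier (Gam\<lparr>carrier := ?R\<rparr>).
        k (g \<otimes>\<^bsub>Gam\<lparr>carrier := ?R\<rparr>\<^esub> x) = k g \<otimes>\<^bsub>G\<lparr>carrier := N\<rparr>\<^esub> \<alpha> (k x)"
      using \<alpha>(2) by (intro bexI[of _ "restrict \<alpha> N"]) auto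
  qed
  then show ?thesis unfolding sylow_iso_def
    using preimage_subgroup sN cN by (intro exI[of _ ?R] exI[of _ N] conjI) simp_all
qed

text \<open>On a Sylow p-subgroup \<open>R\<close> of \<open>Gam\<close> the map g |-> N k(g) is
  injective: if g and h agree, then g^-1 h lies both in \<open>R\<close> and in the preimage of
  \<open>N\<close>, which has order q. So \<open>R\<close> is isomorphic to the quotient by
  \<open>N\<close>, and this in turn to a Sylow p-subgroup of \<open>G\<close>.\<close>

lemma iso_of_normal_sylow_q:
  fixes p q :: nat
  assumes p: "Factorial_Ring.prime p" "odd p" and q: "Factorial_Ring.prime q" "p \<noteq> q"
    and cN: "card N = q" and oG: "order G = p\<^sup>2 * q" and oGam: "order Gam = p\<^sup>2 * q"
  shows "sylow_iso p Gam G"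
proof -
  interpret N: normal N G by (rule N(1))
  interpret Q: group "G Mod N" by (rule N.factorgroup_is_group)
  have sN: "subgroup N G" using N(1) by (rule normal_imp_subgroup)
  have NG: "N \<subseteq> carrier G" using sN by (rule subgroup.subset)
  have q0: "q > 0" using q(1) by (rule prime_gt_0_nat)
  have cop: "coprime (p\<^sup>2) q" using p q by (simp add: primes_coprime)
  obtain R where R: "subgroup R Gam" "card R = p\<^sup>2" using sylow_thm[OF p(1) Ga.is_group oGam finS] by blast
  obtain P where P: "subgroup P G" "card P = p\<^sup>2" using sylow_thm[OF p(1) G.is_group oG finG] by blast
  have RS: "R \<subseteq> S" using R(1) by (rule subgroup.subset)
  have PG: "P \<subseteq> carrier G" using P(1) by (rule subgroup.subset)
  have oQ: "order (G Mod N) = p\<^sup>2" using G.lagrange[OF sN] oG cN q0 by (simp add: order_def FactGroup_def)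
  have finQ: "finite (carrier (G Mod N))" using oQ p(1) prime_gt_0_nat[OF p(1)] by (simp add: order_def card_ge_0_finite)
  have r_eq: "inv x \<otimes> y \<in> N" if xy: "x \<in> carrier G" "y \<in> carrier G" "N #> x = N #> y" for x y
  proof -
    have "y \<in> N #> x" using G.rcos_self[OF xy(2) sN] xy(3) by simp
    then obtain h where h: "h \<in> N" "y = h \<otimes> x" by (auto simp: r_coset_def)
    then have "inv x \<otimes> y = inv x \<otimes> h \<otimes> x" using xy NG by (simp add: G.m_assoc subset_iff)
    then show ?thesis using N.inv_op_closed1[OF xy(1) h(1)] by simp
  qed
  have cM: "N #> x \<in> carrier (G Mod N)" if "x \<in> carrier G" for x
    unfolding carrier_FactGroup using that by (rule imageI)
  have i1: "Gam\<lparr>carrier := R\<rparr> \<cong> G Mod N"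
  proof (rule prime_square_iso[OF _ _ p])
    let ?t = "\<lambda>g. N #> k g"
    show "group (Gam\<lparr>carrier := R\<rparr>)" using R(1) Ga.is_group by (rule subgroup.subgroup_is_group)
    show "group (G Mod N)" by (rule Q.is_group)
    show "order (Gam\<lparr>carrier := R\<rparr>) = p\<^sup>2" using R(2) by (simp add: order_def)
    show "order (G Mod N) = p\<^sup>2" by (rule oQ)
    have kin: "k g \<in> carrier G" if "g \<in> R" for g using that RS map_closed[OF lk_bij] by blast
    have inj: "inj_on ?t R"
    proof (rule inj_onI)
      fix g h assume gh: "g \<in> R" "h \<in> R" and e: "N #> k g = N #> k h"
      define x where "x = inv\<^bsub>Gam\<^esub> g \<otimes>\<^bsub>Gam\<^esub> h"
      have x: "x \<in> R" using gh R(1) by (simp add: x_def subgroup.m_closed subgroup.m_inv_closed)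
      have gS: "g \<in> S" "h \<in> S" "x \<in> S" using gh x RS by auto
      have hx: "h = g \<otimes>\<^bsub>Gam\<^esub> x" using gS by (simp add: x_def Ga.m_assoc[symmetric])
      obtain \<alpha> where \<alpha>: "\<alpha> \<in> auto G" "\<forall>x\<in>S. k (g \<otimes>\<^bsub>Gam\<^esub> x) = k g \<otimes> \<alpha> (k x)" using lk_mult[OF gS(1)] by blast
      have "k h = k g \<otimes> \<alpha> (k x)" using \<alpha>(2) gS hx by simp
      then have "inv (k g) \<otimes> k h = \<alpha> (k x)"
        using kin[OF gh(1)] autoD(3)[OF \<alpha>(1) kin[OF x]] by (simp add: G.m_assoc[symmetric])
      then have "\<alpha> (k x) \<in> N" using r_eq[OF kin[OF gh(1)] kin[OF gh(2)] e] by simp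
      then have "x \<in> {g \<in> S. k g \<in> N}" using auto_N[OF \<alpha>(1) kin[OF x]] gS by simp
      then have "x = \<one>\<^bsub>Gam\<^esub>"
        using Ga.coprime_subgroups_inter[OF R(1) preimage_subgroup(1) _ x] preimage_subgroup(2) R(2) cN cop by simp
      then show "g = h" using hx gS by simp
    qed
    have "?t ` R \<subseteq> carrier (G Mod N)" by (rule image_subsetI) (rule cM[OF kin])
    then have "?t ` R = carrier (G Mod N)"
      using finQ R(2) oQ by (intro card_subset_eq) (auto simp: card_image[OF inj] order_def)
    then show "bij_betw ?t (carrier (Gam\<lparr>carrier := R\<rparr>)) (carrier (G Mod N))"
      using inj by (simp add: bij_betw_def)
    fix g assume "g \<in> carrier (Gam\<lparr>carrier := R\<rparr>)"
    then have g: "g \<in> R" "g \<in> S" using RS by auto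
    obtain \<alpha> where \<alpha>: "\<alpha> \<in> auto G" "\<forall>x\<in>S. k (g \<otimes>\<^bsub>Gam\<^esub> x) = k g \<otimes> \<alpha> (k x)" using lk_mult[OF g(2)] by blast
    have aN: "\<alpha> ` N = N"
    proof (rule endo_inj_surj)
      show "finite N" using NG finG by (rule finite_subset)
      show "\<alpha> ` N \<subseteq> N" using auto_N[OF \<alpha>(1)] NG by blast
      show "inj_on \<alpha> N" using autoD(5)[OF \<alpha>(1)] NG by (intro inj_onI) blast
    qed
    have ac: "\<alpha> ` (N #> x) = N #> \<alpha> x" if x: "x \<in> carrier G" for x
    proof -
      have "\<alpha> ` (N #> x) = (\<lambda>h. \<alpha> h \<otimes> \<alpha> x) ` N"
        using autoD(4)[OF \<alpha>(1)] NG x by (force simp: r_coset_def)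
      also have "\<dots> = (\<lambda>h. h \<otimes> \<alpha> x) ` (\<alpha> ` N)" by (simp add: image_image)
      also have "\<dots> = N #> \<alpha> x" unfolding aN by (auto simp: r_coset_def)
      finally show ?thesis .
    qed
    \<comment> \<open>\<alpha> preserves \<open>N\<close> and so permutes its cosets.\<close>
    define \<beta> where "\<beta> = (\<lambda>D\<in>carrier (G Mod N). \<alpha> ` D)"
    have be: "\<beta> (N #> x) = N #> \<alpha> x" if "x \<in> carrier G" for x using cM[OF that] ac[OF that] by (simp only: \<beta>_def restrict_apply if_True)
    have rep: "\<exists>x\<in>carrier G. D = N #> x" if "D \<in> carrier (G Mod N)" for D
      using that unfolding carrier_FactGroup by (rule imageE) (rule bexI)
    have "\<beta> \<in> auto (G Mod N)"
    proof -
      have "inj_on \<beta> (carrier (G Mod N))"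
      proof (rule inj_onI)
        fix D E assume D: "D \<in> carrier (G Mod N)" "E \<in> carrier (G Mod N)" "\<beta> D = \<beta> E"
        have "D \<subseteq> carrier G" "E \<subseteq> carrier G" using rep D(1,2) G.r_coset_subset_G[OF NG] by blast+
        moreover have "inj_on \<alpha> (carrier G)" using autoD(2)[OF \<alpha>(1)] by (simp add: bij_betw_def)
        moreover have "\<alpha> ` D = \<alpha> ` E" using D by (simp add: \<beta>_def)
        ultimately show "D = E" by (simp add: inj_on_image_eq_iff)
      qed
      moreover have cl: "\<beta> D \<in> carrier (G Mod N)" if D: "D \<in> carrier (G Mod N)" for D
      proof -
        obtain x where x: "x \<in> carrier G" "D = N #> x" using rep[OF D] by blast
        then have "\<beta> D = N #> \<alpha> x" by (simp add: be)
        then show ?thesis using cM[OF autoD(3)[OF \<alpha>(1) x(1)]] by simp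
      qed
      ultimately have "bij_betw \<beta> (carrier (G Mod N)) (carrier (G Mod N))"
        using finQ unfolding bij_betw_def by (metis endo_inj_surj image_subsetI)
      moreover have "\<beta> (D <#> E) = \<beta> D <#> \<beta> E" if DE: "D \<in> carrier (G Mod N)" "E \<in> carrier (G Mod N)" for D E
      proof -
        obtain x where x: "x \<in> carrier G" "D = N #> x" using rep[OF DE(1)] by blast
        obtain y where y: "y \<in> carrier G" "E = N #> y" using rep[OF DE(2)] by blast
        show ?thesis using x y autoD(3,4)[OF \<alpha>(1)] by (simp add: be N.rcos_sum)
      qed
      ultimately show ?thesis using cl unfolding auto_def Bij_def hom_def by (simp add: \<beta>_def)
    qed
    moreover have "N #> k (g \<otimes>\<^bsub>Gam\<^esub> x) = (N #> k g) <#> \<beta> (N #> k x)" if "x \<in> R" for x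
      using that RS \<alpha>(2) kin[OF that] kin[OF g(1)] autoD(3)[OF \<alpha>(1) kin[OF that]] by (simp add: be N.rcos_sum subset_iff)
    ultimately show "\<exists>\<beta>\<in>auto (G Mod N). \<forall>x\<in>carrier (Gam\<lparr>carrier := R\<rparr>).
        N #> k (g \<otimes>\<^bsub>Gam\<lparr>carrier := R\<rparr>\<^esub> x) = (N #> k g) \<otimes>\<^bsub>G Mod N\<^esub> \<beta> (N #> k x)"
      by (intro bexI[of _ \<beta>]) auto
  qed
  have "G\<lparr>carrier := P\<rparr> \<cong> G Mod N"
  proof -
    let ?f = "\<lambda>x. N #> x"
    have inj: "inj_on ?f P"
    proof (rule inj_onI)
      fix x y assume xy: "x \<in> P" "y \<in> P" and e: "N #> x = N #> y"
      have G: "x \<in> carrier G" "y \<in> carrier G" using xy PG by auto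
      have "inv x \<otimes> y \<in> P" using xy P(1) by (simp add: subgroup.m_closed subgroup.m_inv_closed)
      then have "inv x \<otimes> y = \<one>"
        using G.coprime_subgroups_inter[OF P(1) sN] r_eq[OF G e] P(2) cN cop by simp
      then have "x \<otimes> (inv x \<otimes> y) = x" using G by simp
      then show "x = y" using G by (simp add: G.m_assoc[symmetric])
    qed
    have "?f ` P \<subseteq> carrier (G Mod N)" using PG cM by blast
    then have "?f ` P = carrier (G Mod N)"
      using finQ P(2) oQ by (intro card_subset_eq) (auto simp: card_image[OF inj] order_def)
    moreover have "?f \<in> hom (G\<lparr>carrier := P\<rparr>) (G Mod N)"
      using PG cM by (auto simp: hom_def N.rcos_sum subset_iff simp del: carrier_FactGroup)
    ultimately have "?f \<in> iso (G\<lparr>carrier := P\<rparr>) (G Mod N)" using inj by (simp add: iso_def bij_betw_def)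
    then show ?thesis by (auto simp: is_iso_def)
  qed
  then have "G Mod N \<cong> G\<lparr>carrier := P\<rparr>"
    using group.iso_sym[OF subgroup.subgroup_is_group[OF P(1) G.is_group]] by blast
  then have "Gam\<lparr>carrier := R\<rparr> \<cong> G\<lparr>carrier := P\<rparr>" using i1 iso_trans by blast
  then show ?thesis unfolding sylow_iso_def using R P by (intro exI[of _ R] exI[of _ P] conjI)
qed

end

lemma sylow_iso_if_left_hgs_map:
  fixes p q :: nat
  assumes p: "Factorial_Ring.prime p" "odd p" and q: "Factorial_Ring.prime q" "p \<noteq> q"
    and oG: "order G = p\<^sup>2 * q" and oGam: "order Gam = p\<^sup>2 * q" and k: "k \<in> left_hgs_maps Gam G"
  shows "sylow_iso p Gam G"
proof -
  have cop: "coprime (p\<^sup>2) q" using p q by (simp add: primes_coprime)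
  consider N where "N \<lhd> G" "card N = p\<^sup>2" | N where "N \<lhd> G" "card N = q"
    using G.normal_sylow_exists[OF p(1) q(1) q(2) finG oG] by blast
  then show ?thesis
  proof cases
    case 1
    have "N = {x \<in> carrier G. x [^] card N = \<one>}"
      by (rule G.normal_hall_eq[OF 1(1) finG, of q]) (use 1 oG cop in simp_all)
    then show ?thesis by (rule iso_of_normal_sylow_p[OF k 1(1) _ p 1(2)])
  next
    case 2
    have "N = {x \<in> carrier G. x [^] card N = \<one>}"
      by (rule G.normal_hall_eq[OF 2(1) finG, of "p\<^sup>2"]) (use 2 oG cop in \<open>simp_all add: coprime_commute\<close>)
    then show ?thesis by (rule iso_of_normal_sylow_q[OF k 2(1) _ p q 2(2) oG oGam])
  qed
qed

lemma hgs_count_zero_if_not_sylow_iso: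
  fixes p q :: nat
  assumes p: "Factorial_Ring.prime p" "odd p" and q: "Factorial_Ring.prime q" "p \<noteq> q"
    and oG: "order G = p\<^sup>2 * q" and oGam: "order Gam = p\<^sup>2 * q" and ni: "\<not> sylow_iso p Gam G"
  shows "hgs_count Gam G = 0"
proof -
  have "left_hgs_maps Gam G = {}" using sylow_iso_if_left_hgs_map[OF p q oG oGam] ni by blast
  then have "hgs_count Gam G * card (auto G) = 0"
    unfolding hgs_count_times_auto card_hgs_maps_iso[OF Ga.is_group iso_set_refl] by simp
  moreover have "card (auto G) \<noteq> 0"
  proof -
    have "auto G \<noteq> {}" using G.id_in_auto by blast
    moreover have "auto G \<subseteq> carrier G \<rightarrow>\<^sub>E carrier G" by (auto simp: auto_def Bij_def PiE_def bij_betwE)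
    then have "finite (auto G)" by (rule finite_subset) (use finG in \<open>blast intro: finite_PiE\<close>)
    ultimately show ?thesis by simp
  qed
  ultimately show ?thesis by simp
qed

end

theorem theorem1:
  fixes p q :: nat and Gam :: "'a monoid" and G :: "'b monoid"
  assumes "Factorial_Ring.prime p" and "Factorial_Ring.prime q" and "p \<noteq> q" and "p > 2"
    and "group Gam" and "finite (carrier Gam)" and "card (carrier Gam) = p^2 * q"
    and "group G" and "finite (carrier G)" and "card (carrier G) = p^2 * q"
  shows
    "(\<not> sylow_iso p Gam G \<longrightarrow> hgs_count Gam G = 0)
   \<and> (\<not> q dvd p - 1 \<longrightarrow>
        (type1 p q Gam \<and> type1 p q G \<longrightarrow> hgs_count Gam G = p)
      \<and> (type1 p q Gam \<and> type2 p q G \<longrightarrow> hgs_count Gam G = 2*p*(p-1))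
      \<and> (type1 p q Gam \<and> type3 p q G \<longrightarrow> hgs_count Gam G = 2*p*(p-1))
      \<and> (type2 p q Gam \<and> type1 p q G \<longrightarrow> hgs_count Gam G = p*q)
      \<and> (type2 p q Gam \<and> type2 p q G \<longrightarrow> hgs_count Gam G = 2*p*(p*q-2*q+1))
      \<and> (type2 p q Gam \<and> type3 p q G \<longrightarrow> hgs_count Gam G = 2*p*q*(p-1))
      \<and> (type3 p q Gam \<and> type1 p q G \<longrightarrow> hgs_count Gam G = p*q)
      \<and> (type3 p q Gam \<and> type2 p q G \<longrightarrow> hgs_count Gam G = 2*p*q*(p-1))
      \<and> (type3 p q Gam \<and> type3 p q G \<longrightarrow> hgs_count Gam G = 2*(p^2*q-p*q-q+1)))
   \<and> (q dvd p - 1 \<longrightarrow>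
        (type1 p q Gam \<and> type1 p q G \<longrightarrow> hgs_count Gam G = p)
      \<and> (type1 p q Gam \<and> type4 p q G \<longrightarrow> hgs_count Gam G = 2*p*(q-1))
      \<and> (type4 p q Gam \<and> type1 p q G \<longrightarrow> hgs_count Gam G = p^2)
      \<and> (type4 p q Gam \<and> type4 p q G \<longrightarrow> hgs_count Gam G = 2*(p^2*q-2*p^2+1)))"
proof -
  note pr = assms(1-4) and gr = assms(5,8)
  have odd: "odd p" using assms(1,4) prime_odd_nat by auto
  have p3: "p \<ge> 3" and q2: "q \<ge> 2" using assms(4) prime_ge_2_nat[OF assms(2)] by auto
  have pp: "p \<noteq> 1" "q \<noteq> 1" "p\<^sup>2 \<noteq> 1" "p\<^sup>2 \<noteq> p" using p3 q2 by (auto simp: power2_eq_square)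
  have ord1: "ord l 1 = 1" for l :: nat by simp
  interpret two_groups Gam G
    by (intro two_groups.intro two_groups_axioms.intro assms)
  have a: "\<not> sylow_iso p Gam G \<longrightarrow> hgs_count Gam G = 0"
    using hgs_count_zero_if_not_sylow_iso[OF assms(1) odd assms(2,3)] assms(7,10) by (simp add: order_def)
  \<comment> \<open>Substituting p = x + 3 and q = y + 2 removes the truncated subtractions from the
    identities that follow.\<close>
  obtain x y where x: "p = x + 3" and y: "q = y + 2" using p3 q2 by (metis add.commute le_Suc_ex)
  have e22: "2 * (p * (p - 1) * q - p * (q - 1)) = 2*p*(p*q-2*q+1)"
    unfolding x y by (simp add: algebra_simps)
  have e33: "2 * (p * (p - 1) * q - (q - 1)) = 2*(p^2*q-p*q-q+1)"
    unfolding x y by (simp add: algebra_simps power2_eq_square)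
  have e44: "2 * ((q - 1) * p\<^sup>2 - (p\<^sup>2 - 1)) = 2*(p^2*q-2*p^2+1)"
    unfolding x y by (simp add: algebra_simps power2_eq_square)
  have b: "(type1 p q Gam \<and> type1 p q G \<longrightarrow> hgs_count Gam G = p)
      \<and> (type1 p q Gam \<and> type2 p q G \<longrightarrow> hgs_count Gam G = 2*p*(p-1))
      \<and> (type1 p q Gam \<and> type3 p q G \<longrightarrow> hgs_count Gam G = 2*p*(p-1))
      \<and> (type2 p q Gam \<and> type1 p q G \<longrightarrow> hgs_count Gam G = p*q)
      \<and> (type2 p q Gam \<and> type2 p q G \<longrightarrow> hgs_count Gam G = 2*p*(p*q-2*q+1))
      \<and> (type2 p q Gam \<and> type3 p q G \<longrightarrow> hgs_count Gam G = 2*p*q*(p-1))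
      \<and> (type3 p q Gam \<and> type1 p q G \<longrightarrow> hgs_count Gam G = p*q)
      \<and> (type3 p q Gam \<and> type2 p q G \<longrightarrow> hgs_count Gam G = 2*p*q*(p-1))
      \<and> (type3 p q Gam \<and> type3 p q G \<longrightarrow> hgs_count Gam G = 2*(p^2*q-p*q-q+1))"
    if nd: "\<not> q dvd p - 1"
  proof -
    note val = hgs_count_types_qnd[OF pr nd gr]
    have s: "p\<^sup>2 div p = p" "p\<^sup>2 div p\<^sup>2 = 1" using p3 by (simp_all add: power2_eq_square)
    \<comment> \<open>The order of 1 is 1, so a parameter of order p or p^2 differs from 1 and
      selects the nontrivial branch of \<open>val\<close>.\<close>
    have ne: "r \<noteq> 1" if "ord q r = p \<or> ord q r = p\<^sup>2" for r
      using that pp(1,3) ord1[of q] by metis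
    have e23: "2 * (p * (p - 1) * q) = 2*p*q*(p-1)" by simp
    show ?thesis
    proof (intro conjI impI; elim conjE)
      assume t: "type1 p q Gam" "type1 p q G"
      have r: "Gam \<cong> sdp q (p\<^sup>2) 1" using t(1) by (simp add: type1_def)
      have u: "G \<cong> sdp q (p\<^sup>2) 1" using t(2) by (simp add: type1_def)
      show "hgs_count Gam G = p" using val[of 1 1] r u s pp by simp
    next
      assume t: "type1 p q Gam" "type2 p q G"
      have r: "Gam \<cong> sdp q (p\<^sup>2) 1" using t(1) by (simp add: type1_def)
      obtain u where u: "ord q u = p" "G \<cong> sdp q (p\<^sup>2) u" using t(2) by (auto simp: type2_def)
      show "hgs_count Gam G = 2*p*(p-1)" using val[of 1 u] r u s pp ne[of u] by simp
    next
      assume t: "type1 p q Gam" "type3 p q G"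
      have r: "Gam \<cong> sdp q (p\<^sup>2) 1" using t(1) by (simp add: type1_def)
      obtain u where u: "ord q u = p\<^sup>2" "G \<cong> sdp q (p\<^sup>2) u" using t(2) by (auto simp: type3_def)
      show "hgs_count Gam G = 2*p*(p-1)" using val[of 1 u] r u s pp ne[of u] by simp
    next
      assume t: "type2 p q Gam" "type1 p q G"
      obtain r where r: "ord q r = p" "Gam \<cong> sdp q (p\<^sup>2) r" using t(1) by (auto simp: type2_def)
      have u: "G \<cong> sdp q (p\<^sup>2) 1" using t(2) by (simp add: type1_def)
      show "hgs_count Gam G = p*q" using val[of r 1] r u s pp ne[of r] by simp
    next
      assume t: "type2 p q Gam" "type2 p q G"
      obtain r where r: "ord q r = p" "Gam \<cong> sdp q (p\<^sup>2) r" using t(1) by (auto simp: type2_def)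
      obtain u where u: "ord q u = p" "G \<cong> sdp q (p\<^sup>2) u" using t(2) by (auto simp: type2_def)
      show "hgs_count Gam G = 2*p*(p*q-2*q+1)" using val[of r u] r u s pp ne[of r] ne[of u] e22 by simp
    next
      assume t: "type2 p q Gam" "type3 p q G"
      obtain r where r: "ord q r = p" "Gam \<cong> sdp q (p\<^sup>2) r" using t(1) by (auto simp: type2_def)
      obtain u where u: "ord q u = p\<^sup>2" "G \<cong> sdp q (p\<^sup>2) u" using t(2) by (auto simp: type3_def)
      show "hgs_count Gam G = 2*p*q*(p-1)" using val[of r u] r u s pp ne[of r] ne[of u] e23 by simp
    next
      assume t: "type3 p q Gam" "type1 p q G"
      obtain r where r: "ord q r = p\<^sup>2" "Gam \<cong> sdp q (p\<^sup>2) r" using t(1) by (auto simp: type3_def)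
      have u: "G \<cong> sdp q (p\<^sup>2) 1" using t(2) by (simp add: type1_def)
      show "hgs_count Gam G = p*q" using val[of r 1] r u s pp ne[of r] by simp
    next
      assume t: "type3 p q Gam" "type2 p q G"
      obtain r where r: "ord q r = p\<^sup>2" "Gam \<cong> sdp q (p\<^sup>2) r" using t(1) by (auto simp: type3_def)
      obtain u where u: "ord q u = p" "G \<cong> sdp q (p\<^sup>2) u" using t(2) by (auto simp: type2_def)
      show "hgs_count Gam G = 2*p*q*(p-1)" using val[of r u] r u s pp ne[of r] ne[of u] e23 by simp
    next
      assume t: "type3 p q Gam" "type3 p q G"
      obtain r where r: "ord q r = p\<^sup>2" "Gam \<cong> sdp q (p\<^sup>2) r" using t(1) by (auto simp: type3_def)
      obtain u where u: "ord q u = p\<^sup>2" "G \<cong> sdp q (p\<^sup>2) u" using t(2) by (auto simp: type3_def)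
      show "hgs_count Gam G = 2*(p^2*q-p*q-q+1)" using val[of r u] r u s pp ne[of r] ne[of u] e33 by simp
    qed
  qed
  have c: "(type1 p q Gam \<and> type1 p q G \<longrightarrow> hgs_count Gam G = p)
      \<and> (type1 p q Gam \<and> type4 p q G \<longrightarrow> hgs_count Gam G = 2*p*(q-1))
      \<and> (type4 p q Gam \<and> type1 p q G \<longrightarrow> hgs_count Gam G = p^2)
      \<and> (type4 p q Gam \<and> type4 p q G \<longrightarrow> hgs_count Gam G = 2*(p^2*q-2*p^2+1))"
    if dv: "q dvd p - 1"
  proof -
    note val = hgs_count_types_qd[OF pr dv gr]
    \<comment> \<open>Type 1 is written with the q-part as first coordinate, whereas here the
      p^2-part comes first.\<close>
    have t1: "K \<cong> sdp (p\<^sup>2) q 1" if "type1 p q K" for K :: "'a monoid"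
      using that iso_trans[OF _ sdp_commute_iso[of q "p\<^sup>2"]] p3 q2 by (simp add: type1_def)
    have t1': "K \<cong> sdp (p\<^sup>2) q 1" if "type1 p q K" for K :: "'b monoid"
      using that iso_trans[OF _ sdp_commute_iso[of q "p\<^sup>2"]] p3 q2 by (simp add: type1_def)
    have ne: "r \<noteq> 1" if "ord (p\<^sup>2) r = q" for r
      using that pp(2) ord1[of "p\<^sup>2"] by metis
    show ?thesis
    proof (intro conjI impI; elim conjE)
      assume t: "type1 p q Gam" "type1 p q G"
      have r: "Gam \<cong> sdp (p\<^sup>2) q 1" by (rule t1[OF t(1)])
      have u: "G \<cong> sdp (p\<^sup>2) q 1" by (rule t1'[OF t(2)])
      show "hgs_count Gam G = p" using val[of 1 1] r u by simp
    next
      assume t: "type1 p q Gam" "type4 p q G"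
      have r: "Gam \<cong> sdp (p\<^sup>2) q 1" by (rule t1[OF t(1)])
      obtain u where u: "ord (p\<^sup>2) u = q" "G \<cong> sdp (p\<^sup>2) q u" using t(2) by (auto simp: type4_def)
      show "hgs_count Gam G = 2*p*(q-1)" using val[of 1 u] r u ne[of u] by simp
    next
      assume t: "type4 p q Gam" "type1 p q G"
      obtain r where r: "ord (p\<^sup>2) r = q" "Gam \<cong> sdp (p\<^sup>2) q r" using t(1) by (auto simp: type4_def)
      have u: "G \<cong> sdp (p\<^sup>2) q 1" by (rule t1'[OF t(2)])
      show "hgs_count Gam G = p^2" using val[of r 1] r u ne[of r] by simp
    next
      assume t: "type4 p q Gam" "type4 p q G"
      obtain r where r: "ord (p\<^sup>2) r = q" "Gam \<cong> sdp (p\<^sup>2) q r" using t(1) by (auto simp: type4_def)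
      obtain u where u: "ord (p\<^sup>2) u = q" "G \<cong> sdp (p\<^sup>2) q u" using t(2) by (auto simp: type4_def)
      show "hgs_count Gam G = 2*(p^2*q-2*p^2+1)" using val[of r u] r u ne[of r] ne[of u] e44 by simp
    qed
  qed
  show ?thesis using a b c by blast
qed

end
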